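(* Let $q=p^h$ be a prime power ($p$ prime). If $\mathcal{K}$ is a $q$-arc in $\mathrm{PG}(n,q)$, $q=n+1$ or $q=n+2$, with $(n,q)\neq(2,4)$, then $\Gamma_{n,q}(\mathcal{K})$ is a semisymmetric graph. The group $\mathrm{P\Gamma L}(n+2,q)_{\mathcal{K}}$ is a subgroup of $\mathrm{Aut}(\Gamma_{n,q}(\mathcal{K}))$ and is isomorphic to $\mathrm{Persp}(H_\infty)\rtimes \mathrm{P\Gamma L}(n+1,q)_{\mathcal{K}}$, where: (i) if $q=n+2$, then $\mathrm{P\Gamma L}(n+1,q)_{\mathcal{K}}$ is isomorphic to $\mathrm{Sym}(q)\rtimes \mathrm{Aut}(\mathbb{F}_q)$, and $\mathrm{P\Gamma L}(n+2,q)_{\mathcal{K}}$ has size $hq^{n+1}(q-1)\,q!$; (ii) if $q=n+1$, then $\mathrm{P\Gamma L}(n+1,q)_{\mathcal{K}}$ is isomorphic to $\mathrm{PMon}(q)\rtimes\mathrm{Aut}(\mathbb{F}_q)$, and $\mathrm{P\Gamma L}(n+2,q)_{\mathcal{K}}$ has size $hq^{n+1}(q-1)^{n}\,q!$. Moreover, if $q=n+2$ and $q$ is prime, then $\mathrm{Aut}(\Gamma_{n,q}(\mathcal{K}))$ is isomorphic to $\mathrm{P\Gamma L}(n+2,q)_{\mathcal{K}}$.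
   Context: A $k$-arc in $\mathrm{PG}(n,q)$ is a set of $k\ge n+1$ points such that no $n+1$ of them lie in a hyperplane. Write $H_\infty=\mathrm{PG}(n,q)$ and embed it as a hyperplane in $\mathrm{PG}(n+1,q)$; points of $\mathrm{PG}(n+1,q)\setminus H_\infty$ are called affine. For a point set $\mathcal{K}$ of $H_\infty$, $\Gamma_{n,q}(\mathcal{K})$ is the bipartite graph whose vertex classes are $\mathcal{P}$, the set of affine points, and $\mathcal{L}$, the set of lines of $\mathrm{PG}(n+1,q)$ not contained in $H_\infty$ and passing through a point of $\mathcal{K}$; adjacency is incidence. A graph is semisymmetric if it is regular and edge-transitive but not vertex-transitive. $\mathrm{Aut}(\Gamma)$ is the full automorphism group of a graph $\Gamma$. $\mathrm{P\Gamma L}(n+1,q)_{\mathcal{K}}$ and $\mathrm{P\Gamma L}(n+2,q)_{\mathcal{K}}$ are the setwise stabilisers of $\mathcal{K}$ in the collineation groups of $H_\infty$ and of $\mathrm{PG}(n+1,q)$, respectively. $\mathrm{Persp}(H_\infty)$ is the group of all elements of $\mathrm{P\Gamma L}(n+2,q)$ fixing every point of $H_\infty$ (all elations and homologies with axis $H_\infty$); it has size $q^{n+1}(q-1)$. $\mathrm{Sym}(q)$ is the symmetric group on $q$ elements. $\mathrm{PMon}(q)$ is the quotient of the group of invertible monomial $q\times q$ matrices over $\mathbb{F}_q$ by the scalar matrices. $N\rtimes H$ denotes a semidirect product with normal subgroup $N$.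
   Formalization: The claim fails for n = 1, where Γ is the 8-cycle (q = 2) or the Pappus graph (q = 3), both vertex-transitive, so n ≥ 2 is assumed; in (ii) the size is hq^{n+1}(q-1)^{n+1}q!, as the printed (q-1)^n contradicts the sizes of Persp(H_∞) and PMon(q). *)

theory Defs
  imports
    "HOL-Computational_Algebra.Primes"
    "HOL-Combinatorics.Permutations"
    "HOL-Algebra.Coset"
    "HOL-Algebra.Bij"
    "HOL-Algebra.Sym_Groups"
    "Jordan_Normal_Form.Matrix"
begin

section \<open>Groups\<close>

definition map_group :: "('a \<Rightarrow> 'a) set \<Rightarrow> ('a \<Rightarrow> 'a) monoid" where
  "map_group S = \<lparr>carrier = S, monoid.mult = (\<circ>), one = id\<rparr>"

text \<open>The outer semidirect product; \<open>\<phi> h\<close> is the automorphism of \<open>N\<close> by which \<open>h\<close> acts.\<close>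

definition semidirect_product ::
    "('a, 'c) monoid_scheme \<Rightarrow> ('b, 'd) monoid_scheme \<Rightarrow> ('b \<Rightarrow> 'a \<Rightarrow> 'a) \<Rightarrow> ('a \<times> 'b) monoid" where
  "semidirect_product N H \<phi> =
     \<lparr>carrier = carrier N \<times> carrier H,
      monoid.mult = (\<lambda>(n1, h1) (n2, h2). (n1 \<otimes>\<^bsub>N\<^esub> \<phi> h1 n2, h1 \<otimes>\<^bsub>H\<^esub> h2)),
      one = (\<one>\<^bsub>N\<^esub>, \<one>\<^bsub>H\<^esub>)\<rparr>"

text \<open>\<open>G\<close> is isomorphic to a semidirect product of \<open>N\<close> (the normal factor) by \<open>H\<close>. The action
  is left unspecified, as it is in the notation \<open>N \<rtimes> H\<close>.\<close>

definition iso_semidirect ::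
    "('g, 'e) monoid_scheme \<Rightarrow> ('a, 'c) monoid_scheme \<Rightarrow> ('b, 'd) monoid_scheme \<Rightarrow> bool" where
  "iso_semidirect G N H \<longleftrightarrow> (\<exists>\<phi> \<in> hom H (AutoGroup N). G \<cong> semidirect_product N H \<phi>)"

definition field_automorphism ::
    "('a::field \<Rightarrow> 'a) \<Rightarrow> bool" where
  "field_automorphism \<sigma> \<longleftrightarrow>
     bij \<sigma> \<and> (\<forall>a b. \<sigma> (a + b) = \<sigma> a + \<sigma> b) \<and> (\<forall>a b. \<sigma> (a * b) = \<sigma> a * \<sigma> b)"

definition field_Aut :: "('a::field \<Rightarrow> 'a) monoid" where
  "field_Aut = map_group {\<sigma>. field_automorphism \<sigma>}"

definition monomial_mat :: "nat \<Rightarrow> 'a::field mat \<Rightarrow> bool" where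
  "monomial_mat m A \<longleftrightarrow> A \<in> carrier_mat m m \<and>
     (\<forall>i<m. \<exists>!j. j < m \<and> A $$ (i, j) \<noteq> 0) \<and>
     (\<forall>j<m. \<exists>!i. i < m \<and> A $$ (i, j) \<noteq> 0)"

definition Mon :: "nat \<Rightarrow> 'a::field mat monoid" where
  "Mon m = \<lparr>carrier = {A. monomial_mat m A \<and> invertible_mat A}, monoid.mult = (*), one = 1\<^sub>m m\<rparr>"

definition PMon :: "nat \<Rightarrow> 'a::field mat set monoid" where
  "PMon m = Mon m Mod {c \<cdot>\<^sub>m 1\<^sub>m m | c. c \<noteq> 0}"


section \<open>Graphs\<close>

text \<open>A simple graph is a pair of a vertex set and a set of edges, which are two-element sets of
  vertices.\<close>

type_synonym 'a graph = "'a set \<times> 'a set set"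

definition graph_automorphism :: "'a graph \<Rightarrow> ('a \<Rightarrow> 'a) \<Rightarrow> bool" where
  "graph_automorphism G f \<longleftrightarrow> f permutes (fst G) \<and>
     (\<forall>u \<in> fst G. \<forall>v \<in> fst G. {u, v} \<in> snd G \<longleftrightarrow> {f u, f v} \<in> snd G)"

definition graph_Aut :: "'a graph \<Rightarrow> ('a \<Rightarrow> 'a) monoid" where
  "graph_Aut G = map_group {f. graph_automorphism G f}"

definition regular_graph :: "'a graph \<Rightarrow> bool" where
  "regular_graph G \<longleftrightarrow> (\<exists>d. \<forall>v \<in> fst G. card {e \<in> snd G. v \<in> e} = d)"

definition vertex_transitive :: "'a graph \<Rightarrow> bool" where
  "vertex_transitive G \<longleftrightarrow> (\<forall>u \<in> fst G. \<forall>v \<in> fst G. \<exists>f. graph_automorphism G f \<and> f u = v)"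

definition edge_transitive :: "'a graph \<Rightarrow> bool" where
  "edge_transitive G \<longleftrightarrow> (\<forall>d \<in> snd G. \<forall>e \<in> snd G. \<exists>f. graph_automorphism G f \<and> f ` d = e)"

definition semisymmetric :: "'a graph \<Rightarrow> bool" where
  "semisymmetric G \<longleftrightarrow> regular_graph G \<and> edge_transitive G \<and> \<not> vertex_transitive G"


section \<open>Projective geometry\<close>

text \<open>For a subspace \<open>U\<close> of dimension \<open>m + 1\<close> over the field with \<open>q\<close> elements, the projective
  space \<open>PG(m, q)\<close> is modelled as the lattice of subspaces of \<open>U\<close>: its points are the subspaces of
  dimension 1, its lines those of dimension 2, its hyperplanes those of dimension \<open>m\<close>, and
  incidence is inclusion.\<close>

definition pg_points ::
    "('a::field \<Rightarrow> 'b::ab_group_add \<Rightarrow> 'b) \<Rightarrow> 'b set \<Rightarrow> 'b set set" where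
  "pg_points scale U = {x. module.subspace scale x \<and> x \<subseteq> U \<and> vector_space.dim scale x = 1}"

definition pg_lines ::
    "('a::field \<Rightarrow> 'b::ab_group_add \<Rightarrow> 'b) \<Rightarrow> 'b set \<Rightarrow> 'b set set" where
  "pg_lines scale U = {l. module.subspace scale l \<and> l \<subseteq> U \<and> vector_space.dim scale l = 2}"

definition pg_hyperplane ::
    "('a::field \<Rightarrow> 'b::ab_group_add \<Rightarrow> 'b) \<Rightarrow> 'b set \<Rightarrow> 'b set \<Rightarrow> bool" where
  "pg_hyperplane scale U W \<longleftrightarrow> module.subspace scale W \<and> W \<subseteq> U \<and>
     vector_space.dim scale W + 1 = vector_space.dim scale U"

text \<open>In \<open>PG(n, q)\<close> the vector space dimension \<open>dim U\<close> is \<open>n + 1\<close>.\<close>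

definition arc ::
    "('a::field \<Rightarrow> 'b::ab_group_add \<Rightarrow> 'b) \<Rightarrow> nat \<Rightarrow> 'b set \<Rightarrow> 'b set set \<Rightarrow> bool" where
  "arc scale k U K \<longleftrightarrow> K \<subseteq> pg_points scale U \<and> finite K \<and> card K = k \<and>
     vector_space.dim scale U \<le> k \<and>
     (\<forall>S \<subseteq> K. card S = vector_space.dim scale U \<longrightarrow>
       \<not> (\<exists>W. pg_hyperplane scale U W \<and> (\<forall>x \<in> S. x \<subseteq> W)))"

definition semilinear_bij ::
    "('a::field \<Rightarrow> 'b::ab_group_add \<Rightarrow> 'b) \<Rightarrow> 'b set \<Rightarrow> ('b \<Rightarrow> 'b) \<Rightarrow> bool" where
  "semilinear_bij scale U \<phi> \<longleftrightarrow> bij_betw \<phi> U U \<and>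
     (\<exists>\<sigma>. field_automorphism \<sigma> \<and>
       (\<forall>x \<in> U. \<forall>y \<in> U. \<phi> (x + y) = \<phi> x + \<phi> y) \<and>
       (\<forall>a. \<forall>x \<in> U. \<phi> (scale a x) = scale (\<sigma> a) (\<phi> x)))"

text \<open>A collineation is the permutation of the points that a semilinear bijection induces.\<close>

definition PGammaL ::
    "('a::field \<Rightarrow> 'b::ab_group_add \<Rightarrow> 'b) \<Rightarrow> 'b set \<Rightarrow> ('b set \<Rightarrow> 'b set) monoid" where
  "PGammaL scale U = map_group {g. g permutes pg_points scale U \<and>
     (\<exists>\<phi>. semilinear_bij scale U \<phi> \<and> (\<forall>x \<in> pg_points scale U. g x = \<phi> ` x))}"

definition PGammaL_stab ::
    "('a::field \<Rightarrow> 'b::ab_group_add \<Rightarrow> 'b) \<Rightarrow> 'b set \<Rightarrow> 'b set set \<Rightarrow> ('b set \<Rightarrow> 'b set) monoid" where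
  "PGammaL_stab scale U K = (PGammaL scale U)\<lparr>carrier := {g \<in> carrier (PGammaL scale U). g ` K = K}\<rparr>"

text \<open>From here on the ambient space is the whole type and \<open>H\<close> is the hyperplane at infinity.\<close>

definition Persp ::
    "('a::field \<Rightarrow> 'b::ab_group_add \<Rightarrow> 'b) \<Rightarrow> 'b set \<Rightarrow> ('b set \<Rightarrow> 'b set) monoid" where
  "Persp scale H = (PGammaL scale UNIV)\<lparr>carrier :=
     {g \<in> carrier (PGammaL scale UNIV). \<forall>x \<in> pg_points scale H. g x = x}\<rparr>"

definition affine_points ::
    "('a::field \<Rightarrow> 'b::ab_group_add \<Rightarrow> 'b) \<Rightarrow> 'b set \<Rightarrow> 'b set set" where
  "affine_points scale H = pg_points scale UNIV - pg_points scale H"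

definition affine_lines ::
    "('a::field \<Rightarrow> 'b::ab_group_add \<Rightarrow> 'b) \<Rightarrow> 'b set \<Rightarrow> 'b set set \<Rightarrow> 'b set set" where
  "affine_lines scale H K = {l \<in> pg_lines scale UNIV. \<not> l \<subseteq> H \<and> (\<exists>x \<in> K. x \<subseteq> l)}"

definition Gamma ::
    "('a::field \<Rightarrow> 'b::ab_group_add \<Rightarrow> 'b) \<Rightarrow> 'b set \<Rightarrow> 'b set set \<Rightarrow> 'b set graph" where
  "Gamma scale H K = (affine_points scale H \<union> affine_lines scale H K,
     {{x, l} | x l. x \<in> affine_points scale H \<and> l \<in> affine_lines scale H K \<and> x \<subseteq> l})"

text \<open>The action of a collineation \<open>g\<close> on the vertices of \<open>Gamma H K\<close>. A nonzero subspace is the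
  union of the points it contains, so the union below is the image under \<open>g\<close> of the vertex
  \<open>v\<close>. Since graph automorphisms are represented by permutations of the vertex set, the action is
  the identity outside it.\<close>

definition Gamma_action ::
    "('a::field \<Rightarrow> 'b::ab_group_add \<Rightarrow> 'b) \<Rightarrow> 'b set \<Rightarrow> 'b set set \<Rightarrow> ('b set \<Rightarrow> 'b set) \<Rightarrow> 'b set \<Rightarrow> 'b set" where
  "Gamma_action scale H K g v =
     (if v \<in> fst (Gamma scale H K) then (\<Union>x \<in> pg_points scale v. g x) else v)"

end

theory Submission
  imports "HOL-Algebra.Multiplicative_Group" "HOL-Computational_Algebra.Polynomial" Defs
begin

text \<open>
  Choose representatives \<open>d i\<close> of the points of the arc that form a basis of the hyperplane
  (\<open>q = n + 1\<close>), or a basis together with minus its sum (\<open>q = n + 2\<close>). A collineation stabilising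
  the arc comes from a semilinear map \<open>d i \<mapsto> c i * d (\<pi> i)\<close>, unique up to a scalar \<open>k\<close>. Rescaling
  multiplies the product of the \<open>c i\<close> by \<open>k ^ q = k\<close>, so exactly one representative has product 1;
  these representatives are closed under composition and split off the perspectivities.

  Affine points are the vectors of the hyperplane, and the lines of the graph are the cosets of the
  lines spanned by the \<open>d i\<close>. Any four points of the arc are independent. Hence two non-collinear
  affine points are both collinear with at most two others, while two coplanar parallel lines have
  \<open>q\<close> common transversals, so no automorphism interchanges points and lines.

  Skew lines have at most one common transversal, so an automorphism preserves parallelism and acts
  on vectors by \<open>F (v + t * d i) = F v + g i v t * d (\<pi> i)\<close>. If \<open>q = n + 2\<close>, all \<open>d j\<close> with \<open>j \<noteq> i\<close>
  still span, which makes \<open>g i v t\<close> independent of \<open>v\<close>; the relation that the \<open>d i\<close> sum to 0 makes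
  it independent of \<open>i\<close>. So \<open>g\<close> is an additive function of \<open>t\<close>, which is linear over a prime field.
\<close>

text \<open>Since the arc has as many points as the field has elements, \<open>k ^ q\<close> runs
  through all nonzero scalars as \<open>k\<close> does, so a lift can be normalised without
  extracting roots. The number four arises because the uniqueness arguments for the graph subtract
  two expressions that involve at most four directions together. In the excluded case (2, 4) the
  representatives sum to 0 in characteristic 2, so \<open>d 0 + d 1 = d 2 + d 3\<close>, and the
  affine points 0 and \<open>d 0 + d 1\<close> have four common neighbours. The stabiliser in the
  hyperplane is split by sending a collineation to its field automorphism. What remains is a pair
  \<open>(c, \<pi>)\<close> up to a common scalar: \<open>c\<close> is arbitrary for
  \<open>q = n + 1\<close>, while for \<open>q = n + 2\<close> the image of the zero sum forces
  \<open>c\<close> to be constant. For \<open>q = n + 1\<close> the values of each coordinate of an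
  affine point may be permuted arbitrarily and independently, which for \<open>q > 3\<close> goes
  beyond collineations. Over a field that is not prime, an additive \<open>g\<close> need not be
  linear.\<close>

hide_const (open) Polynomial.order

section \<open>Semidirect products\<close>

text \<open>This recognises a split extension: \<open>s\<close> is a section of
  \<open>\<rho>\<close>, and \<open>Q\<close> acts on the kernel by conjugation through
  \<open>s\<close>. The normal factor enters as an embedded copy of \<open>N\<close>, so that an
  abstract group such as \<open>sym_group q\<close> can take its place.\<close>

lemma iso_semidirectI:
  assumes "group G" and "group N" and "group Q"
    and rho: "\<rho> \<in> hom G Q" and sec: "s \<in> hom Q G" and rho_s: "\<And>x. x \<in> carrier Q \<Longrightarrow> \<rho> (s x) = x"
    and alpha: "\<alpha> \<in> hom N G" and inj: "inj_on \<alpha> (carrier N)"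
    and ker: "\<alpha> ` carrier N = kernel G Q \<rho>"
  shows "iso_semidirect G N Q"
proof -
  interpret G: group G by fact
  interpret N: group N by fact
  interpret Q: group Q by fact
  interpret R: group_hom G Q \<rho> by unfold_locales (rule rho)
  interpret S: group_hom Q G s by unfold_locales (rule sec)
  interpret A: group_hom N G \<alpha> by unfold_locales (rule alpha)
  define \<beta> where "\<beta> = inv_into (carrier N) \<alpha>"
  have \<beta>: "\<beta> g \<in> carrier N" "\<alpha> (\<beta> g) = g" if "g \<in> carrier G" "\<rho> g = \<one>\<^bsub>Q\<^esub>" for g
  proof -
    have "g \<in> \<alpha> ` carrier N" using that by (auto simp: ker kernel_def)
    then show "\<beta> g \<in> carrier N" "\<alpha> (\<beta> g) = g"
      by (auto simp: \<beta>_def f_inv_into_f inv_into_into)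
  qed
  have rho_alpha: "\<rho> (\<alpha> n) = \<one>\<^bsub>Q\<^esub>" if "n \<in> carrier N" for n
    using ker that by (auto simp: kernel_def)
  have alpha_eq: "x = y" if "\<alpha> x = \<alpha> y" "x \<in> carrier N" "y \<in> carrier N" for x y
    using inj that by (auto dest: inj_onD)
  \<comment> \<open>\<open>c x\<close> is conjugation by \<open>s x\<close>, transported to
    \<open>N\<close> along \<open>\<alpha>\<close>.\<close>
  define c where "c = (\<lambda>x n. \<beta> (s x \<otimes>\<^bsub>G\<^esub> \<alpha> n \<otimes>\<^bsub>G\<^esub> inv\<^bsub>G\<^esub> s x))"
  have rho_conj: "\<rho> (s x \<otimes>\<^bsub>G\<^esub> \<alpha> n \<otimes>\<^bsub>G\<^esub> inv\<^bsub>G\<^esub> s x) = \<one>\<^bsub>Q\<^esub>"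
    if "x \<in> carrier Q" "n \<in> carrier N" for x n
    using that by (simp add: rho_s rho_alpha)
  have c: "c x n \<in> carrier N" "\<alpha> (c x n) = s x \<otimes>\<^bsub>G\<^esub> \<alpha> n \<otimes>\<^bsub>G\<^esub> inv\<^bsub>G\<^esub> s x"
    if "x \<in> carrier Q" "n \<in> carrier N" for x n
    using \<beta>[OF _ rho_conj[OF that]] that by (auto simp: c_def)
  have c_mult: "c x (n \<otimes>\<^bsub>N\<^esub> m) = c x n \<otimes>\<^bsub>N\<^esub> c x m"
    if "x \<in> carrier Q" "n \<in> carrier N" "m \<in> carrier N" for x n m
    by (rule alpha_eq) (use that in \<open>simp_all add: c G.m_assoc G.inv_solve_left\<close>)
  have c_comp: "c (x \<otimes>\<^bsub>Q\<^esub> y) n = c x (c y n)"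
    if "x \<in> carrier Q" "y \<in> carrier Q" "n \<in> carrier N" for x y n
    by (rule alpha_eq) (use that in \<open>simp_all add: c G.m_assoc G.inv_mult_group\<close>)
  have c_one: "c \<one>\<^bsub>Q\<^esub> n = n" if "n \<in> carrier N" for n
    by (rule alpha_eq) (use that in \<open>simp_all add: c\<close>)
  have cancel: "inv\<^bsub>G\<^esub> a \<otimes>\<^bsub>G\<^esub> (a \<otimes>\<^bsub>G\<^esub> b) = b" if "a \<in> carrier G" "b \<in> carrier G" for a b
    using that by (simp flip: G.m_assoc)
  \<comment> \<open>Elements of \<open>auto N\<close> are extensional functions, hence the
    restriction.\<close>
  define \<phi> where "\<phi> = (\<lambda>x. restrict (c x) (carrier N))"
  have phi_auto: "\<phi> x \<in> auto N" if x: "x \<in> carrier Q" for x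
  proof -
    have "bij_betw (c x) (carrier N) (carrier N)"
      by (rule bij_betw_byWitness[where f' = "c (inv\<^bsub>Q\<^esub> x)"])
        (use x in \<open>auto simp: c(1) c_one simp flip: c_comp\<close>)
    then have "bij_betw (\<phi> x) (carrier N) (carrier N)"
      unfolding \<phi>_def by (subst bij_betw_restrict_eq) 
    then show ?thesis
      using x by (auto simp: auto_def Bij_def hom_def \<phi>_def c c_mult)
  qed
  have "\<phi> \<in> hom Q (AutoGroup N)"
  proof (rule homI)
    fix x y assume xy: "x \<in> carrier Q" "y \<in> carrier Q"
    have "\<phi> x \<otimes>\<^bsub>AutoGroup N\<^esub> \<phi> y = compose (carrier N) (\<phi> x) (\<phi> y)"
      using phi_auto[OF xy(1)] phi_auto[OF xy(2)]
      by (simp add: AutoGroup_def BijGroup_def auto_def)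
    also have "\<dots> = \<phi> (x \<otimes>\<^bsub>Q\<^esub> y)"
      using xy by (auto simp: compose_def \<phi>_def fun_eq_iff restrict_def c c_comp)
    finally show "\<phi> (x \<otimes>\<^bsub>Q\<^esub> y) = \<phi> x \<otimes>\<^bsub>AutoGroup N\<^esub> \<phi> y" by simp
  qed (simp add: AutoGroup_def phi_auto)
  \<comment> \<open>Each g is the product of \<open>g * inv (s (\<rho> g))\<close>, which lies in
    the kernel, and \<open>s (\<rho> g)\<close>.\<close>
  moreover have "(\<lambda>g. (\<beta> (g \<otimes>\<^bsub>G\<^esub> inv\<^bsub>G\<^esub> s (\<rho> g)), \<rho> g)) \<in> iso G (semidirect_product N Q \<phi>)"
    (is "?f \<in> _")
  proof (rule isoI)
    have b: "\<beta> (g \<otimes>\<^bsub>G\<^esub> inv\<^bsub>G\<^esub> s (\<rho> g)) \<in> carrier N"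
      "\<alpha> (\<beta> (g \<otimes>\<^bsub>G\<^esub> inv\<^bsub>G\<^esub> s (\<rho> g))) = g \<otimes>\<^bsub>G\<^esub> inv\<^bsub>G\<^esub> s (\<rho> g)" if "g \<in> carrier G" for g
      using that by (auto intro!: \<beta> simp: rho_s)
    show "?f \<in> hom G (semidirect_product N Q \<phi>)"
    proof (rule homI)
      fix g k assume gk: "g \<in> carrier G" "k \<in> carrier G"
      have "\<beta> (g \<otimes>\<^bsub>G\<^esub> k \<otimes>\<^bsub>G\<^esub> inv\<^bsub>G\<^esub> s (\<rho> (g \<otimes>\<^bsub>G\<^esub> k)))
        = \<beta> (g \<otimes>\<^bsub>G\<^esub> inv\<^bsub>G\<^esub> s (\<rho> g)) \<otimes>\<^bsub>N\<^esub> c (\<rho> g) (\<beta> (k \<otimes>\<^bsub>G\<^esub> inv\<^bsub>G\<^esub> s (\<rho> k)))"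
      proof (rule alpha_eq)
        have "\<alpha> (\<beta> (g \<otimes>\<^bsub>G\<^esub> inv\<^bsub>G\<^esub> s (\<rho> g)) \<otimes>\<^bsub>N\<^esub> c (\<rho> g) (\<beta> (k \<otimes>\<^bsub>G\<^esub> inv\<^bsub>G\<^esub> s (\<rho> k))))
          = g \<otimes>\<^bsub>G\<^esub> (inv\<^bsub>G\<^esub> s (\<rho> g) \<otimes>\<^bsub>G\<^esub> s (\<rho> g)) \<otimes>\<^bsub>G\<^esub> (k \<otimes>\<^bsub>G\<^esub> inv\<^bsub>G\<^esub> s (\<rho> k)) \<otimes>\<^bsub>G\<^esub> inv\<^bsub>G\<^esub> s (\<rho> g)"
          using gk by (simp add: b c G.m_assoc cancel)
        also have "\<dots> = g \<otimes>\<^bsub>G\<^esub> k \<otimes>\<^bsub>G\<^esub> inv\<^bsub>G\<^esub> s (\<rho> (g \<otimes>\<^bsub>G\<^esub> k))"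
          using gk by (simp add: G.m_assoc G.inv_mult_group)
        also have "\<dots> = \<alpha> (\<beta> (g \<otimes>\<^bsub>G\<^esub> k \<otimes>\<^bsub>G\<^esub> inv\<^bsub>G\<^esub> s (\<rho> (g \<otimes>\<^bsub>G\<^esub> k))))"
          using b[of "g \<otimes>\<^bsub>G\<^esub> k"] gk by simp
        finally show "\<alpha> (\<beta> (g \<otimes>\<^bsub>G\<^esub> k \<otimes>\<^bsub>G\<^esub> inv\<^bsub>G\<^esub> s (\<rho> (g \<otimes>\<^bsub>G\<^esub> k)))) =
          \<alpha> (\<beta> (g \<otimes>\<^bsub>G\<^esub> inv\<^bsub>G\<^esub> s (\<rho> g)) \<otimes>\<^bsub>N\<^esub> c (\<rho> g) (\<beta> (k \<otimes>\<^bsub>G\<^esub> inv\<^bsub>G\<^esub> s (\<rho> k))))" by simp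
      qed (use gk b[of "g \<otimes>\<^bsub>G\<^esub> k"] in \<open>auto simp: b c\<close>)
      then show "?f (g \<otimes>\<^bsub>G\<^esub> k) = ?f g \<otimes>\<^bsub>semidirect_product N Q \<phi>\<^esub> ?f k"
        using gk by (simp add: semidirect_product_def \<phi>_def b)
    qed (simp add: semidirect_product_def b)
    show "bij_betw ?f (carrier G) (carrier (semidirect_product N Q \<phi>))"
    proof (rule bij_betw_byWitness[where f' = "\<lambda>(n, x). \<alpha> n \<otimes>\<^bsub>G\<^esub> s x"])
      show "\<forall>g\<in>carrier G. (case ?f g of (n, x) \<Rightarrow> \<alpha> n \<otimes>\<^bsub>G\<^esub> s x) = g"
        by (simp add: b G.m_assoc)
      show "\<forall>y\<in>carrier (semidirect_product N Q \<phi>). ?f (case y of (n, x) \<Rightarrow> \<alpha> n \<otimes>\<^bsub>G\<^esub> s x) = y"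
        using inj by (auto simp: semidirect_product_def rho_s rho_alpha G.m_assoc \<beta>_def)
    qed (auto simp: semidirect_product_def b)
  qed
  ultimately show ?thesis
    unfolding iso_semidirect_def by (blast intro: is_isoI)
qed

lemma order_iso_semidirect:
  assumes "iso_semidirect G N Q"
  shows "order G = order N * order Q"
proof -
  obtain \<phi> where "G \<cong> semidirect_product N Q \<phi>"
    using assms by (auto simp: iso_semidirect_def)
  from iso_same_card[OF this] show ?thesis
    by (simp add: Coset.order_def semidirect_product_def card_cartesian_product)
qed

lemma group_map_group:
  assumes "id \<in> S" and "\<And>f g. f \<in> S \<Longrightarrow> g \<in> S \<Longrightarrow> f \<circ> g \<in> S"
    and "\<And>f. f \<in> S \<Longrightarrow> \<exists>g\<in>S. g \<circ> f = id"
  shows "group (map_group S)"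
  by (rule groupI) (use assms in \<open>auto simp: map_group_def comp_assoc\<close>)

section \<open>Automorphisms of a finite field\<close>

lemma field_automorphismD:
  assumes "field_automorphism \<sigma>"
  shows "\<sigma> (a + b) = \<sigma> a + \<sigma> b" "\<sigma> (a * b) = \<sigma> a * \<sigma> b" "\<sigma> 0 = 0" "\<sigma> 1 = 1"
    "bij \<sigma>" "\<sigma> a = \<sigma> b \<longleftrightarrow> a = b" "\<sigma> a = 0 \<longleftrightarrow> a = 0"
proof -
  show add: "\<sigma> (a + b) = \<sigma> a + \<sigma> b" and mult: "\<sigma> (a * b) = \<sigma> a * \<sigma> b" and bij: "bij \<sigma>" for a b
    using assms by (auto simp: field_automorphism_def)
  show z: "\<sigma> 0 = 0" using add[of 0 0] add_left_cancel[of "\<sigma> 0" "\<sigma> 0" 0] by simp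
  show eq: "\<sigma> a = \<sigma> b \<longleftrightarrow> a = b" for a b
    using bij by (auto simp: bij_def dest: injD)
  show "\<sigma> a = 0 \<longleftrightarrow> a = 0" using eq[of a 0] z by simp
  show "\<sigma> 1 = 1" using mult[of 1 1] eq[of 1 0] z by auto
qed

lemma field_automorphism_id: "field_automorphism id"
  by (simp add: field_automorphism_def)

lemma field_automorphism_comp:
  "field_automorphism \<sigma> \<Longrightarrow> field_automorphism \<tau> \<Longrightarrow> field_automorphism (\<sigma> \<circ> \<tau>)"
  by (auto simp: field_automorphism_def bij_comp)

lemma field_automorphism_inv:
  assumes "field_automorphism \<sigma>"
  shows "field_automorphism (inv' \<sigma>)"
proof -
  have b: "bij \<sigma>" using assms by (simp add: field_automorphism_def)
  then have s: "\<sigma> (inv' \<sigma> x) = x" "inv' \<sigma> (\<sigma> x) = x" for x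
    by (auto simp: bij_def surj_f_inv_f inv_f_f)
  have "inv' \<sigma> (a + b) = inv' \<sigma> a + inv' \<sigma> b" "inv' \<sigma> (a * b) = inv' \<sigma> a * inv' \<sigma> b" for a b
    using field_automorphismD(1,2)[OF assms, of "inv' \<sigma> a" "inv' \<sigma> b"] s by metis+
  then show ?thesis using b by (simp add: field_automorphism_def bij_imp_bij_inv)
qed

lemma group_field_Aut: "group field_Aut"
  unfolding field_Aut_def
proof (rule group_map_group)
  fix f :: "'a \<Rightarrow> 'a" assume "f \<in> {\<sigma>. field_automorphism \<sigma>}"
  then show "\<exists>g\<in>{\<sigma>. field_automorphism \<sigma>}. g \<circ> f = id"
    by (intro bexI[of _ "inv' f"]) (auto simp: field_automorphism_inv dest!: field_automorphismD(5) bij_is_inj)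
qed (auto simp: field_automorphism_id field_automorphism_comp)


lemma finite_field_primitive_element:
  "\<exists>g::'f::finite_field. \<forall>x. x \<noteq> 0 \<longrightarrow> (\<exists>i. x = g ^ i)"
proof -
  \<comment> \<open>The field type is repackaged as an algebraic structure to use that the
    multiplicative group of a finite field is cyclic.\<close>
  define R :: "'f ring" where
    "R = \<lparr>carrier = UNIV, monoid.mult = (*), one = 1, zero = 0, add = (+)\<rparr>"
  have "\<exists>y. y + x = 0" for x :: 'f by (rule exI[of _ "- x"]) simp
  moreover have "\<exists>y. y * x = 1" if "x \<noteq> 0" for x :: 'f
    using that by (intro exI[of _ "inverse x"]) simp
  ultimately have "field R"
    by (intro cring.cring_fieldI2 cringI abelian_groupI comm_monoidI)
      (auto simp: R_def algebra_simps)
  then interpret field R .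
  have pow: "x [^]\<^bsub>R\<^esub> i = x ^ i" for x :: 'f and i :: nat
    by (induction i) (simp_all add: R_def nat_pow_def mult.commute)
  obtain a where "carrier (mult_of R) = {a [^]\<^bsub>R\<^esub> i | i::nat. i \<in> UNIV}"
    using finite_field_mult_group_has_gen by (auto simp: R_def)
  then have "UNIV - {0} = {a ^ i | i. True}"
    by (simp add: pow) (simp add: R_def)
  then show ?thesis by blast
qed

lemma CHAR_eq_if_card_prime_power:
  assumes "prime p" "card (UNIV :: 'f::finite_field set) = p ^ h"
  shows "CHAR('f) = p"
proof -
  have "(of_nat (p ^ h) :: 'f) = 0"
  proof -
    \<comment> \<open>Translation by 1 permutes the field, so the sum of the added ones,
      \<open>p ^ h\<close> times 1, is 0.\<close>
    have "(\<Sum>x\<in>UNIV. x + 1) = (\<Sum>x\<in>UNIV. x :: 'f)"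
      by (rule sum.reindex_bij_witness[of _ "\<lambda>x. x - 1" "\<lambda>x. x + 1"]) auto
    then show ?thesis using assms by (simp add: sum.distrib)
  qed
  then have "CHAR('f) dvd p ^ h" by (simp only: of_nat_eq_0_iff_char_dvd)
  then have "CHAR('f) dvd p"
    using CHAR_prime prime_dvd_power by blast
  then show ?thesis using assms(1) CHAR_prime primes_dvd_imp_eq by blast
qed

lemma inj_on_of_nat_CHAR: "inj_on (of_nat :: nat \<Rightarrow> 'f::finite_field) {..<CHAR('f)}"
  by (rule linorder_inj_onI') (auto simp: of_nat_eq_iff_char_dvd dest: dvd_imp_le)

text \<open>Applying \<sigma> to the coefficients is a ring homomorphism, so on a product of linear
  factors it acts on the roots.\<close>

lemma map_poly_prod_field_automorphism:
  assumes "field_automorphism \<sigma>"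
  shows "map_poly \<sigma> (\<Prod>i\<in>A. [:- f i, 1:]) = (\<Prod>i\<in>A. [:- \<sigma> (f i), 1:])"
proof -
  note s = field_automorphismD[OF assms]
  have neg: "\<sigma> (- x) = - \<sigma> x" for x
    using s(1)[of x "- x"] s(3) by (simp add: eq_neg_iff_add_eq_0 add.commute)
  have sum: "\<sigma> (\<Sum>i\<in>A. f i) = (\<Sum>i\<in>A. \<sigma> (f i))" for A :: "nat set" and f
    by (induction A rule: infinite_finite_induct) (simp_all add: s)
  have mult: "map_poly \<sigma> (p * q) = map_poly \<sigma> p * map_poly \<sigma> q" for p q
    by (rule poly_eqI) (simp add: coeff_map_poly s(3) coeff_mult sum s(2))
  have lin: "map_poly \<sigma> [:- a, 1:] = [:- \<sigma> a, 1:]" for a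
    by (simp add: map_poly_pCons s neg)
  have one: "map_poly \<sigma> 1 = 1"
    by (rule poly_eqI) (simp add: coeff_map_poly s coeff_1)
  show ?thesis
    by (induction A rule: infinite_finite_induct) (simp_all add: one mult lin del: mult_pCons_left)
qed

text \<open>The Frobenius orbit of a primitive element \<open>g\<close> is the root set of a polynomial over the prime
  field, so every automorphism maps \<open>g\<close> into that orbit.\<close>

lemma order_field_Aut:
  assumes "prime p" "card (UNIV :: 'f::finite_field set) = p ^ h"
  shows "order (field_Aut :: ('f \<Rightarrow> 'f) monoid) = h"
proof -
  have char: "CHAR('f) = p" by (rule CHAR_eq_if_card_prime_power[OF assms])
  have p0: "p > 1" using assms(1) by (rule prime_gt_1_nat)
  have h0: "h \<noteq> 0"
  proof
    assume "h = 0"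
    then have "card (UNIV :: 'f set) = 1" using assms(2) by simp
    then obtain a :: 'f where "UNIV = {a}" by (auto simp: card_1_singleton_iff)
    then have "(0::'f) = 1" by (metis UNIV_I singletonD)
    then show False by simp
  qed
  define F :: "nat \<Rightarrow> 'f \<Rightarrow> 'f" where "F = (\<lambda>i x. x ^ (p ^ i))"
  have Fh: "F h x = x" for x
    using finite_field_power_card_eq_same[of x] by (simp add: F_def assms(2))
  have F_add: "F i (x + y) = F i x + F i y" for i x y
    unfolding F_def by (rule freshmans_dream') (use char assms in auto)
  have F_diff: "F i (x - y) = F i x - F i y" for i x y
    using F_add[of i "x - y" y] by simp
  have F_inj: "inj (F i)" for i
  proof (rule injI)
    fix x y assume "F i x = F i y"
    then have "F i (x - y) = 0" by (simp add: F_diff)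
    then show "x = y" by (simp add: F_def)
  qed
  have F_aut: "field_automorphism (F i)" for i
    using F_inj[of i] finite_UNIV_inj_surj[OF finite_UNIV F_inj[of i]] F_add[of i]
    by (simp add: field_automorphism_def bij_def) (simp add: F_def power_mult_distrib)
  obtain g :: 'f where g: "\<And>x. x \<noteq> 0 \<Longrightarrow> \<exists>i. x = g ^ i"
    using finite_field_primitive_element by blast
  \<comment> \<open>An automorphism is determined by its value at \<open>g\<close>, as the powers of
    \<open>g\<close> exhaust the nonzero elements.\<close>
  have gen: "\<sigma> = \<tau>" if "field_automorphism \<sigma>" "field_automorphism \<tau>" "\<sigma> g = \<tau> g" for \<sigma> \<tau> :: "'f \<Rightarrow> 'f"
  proof
    fix x
    note s = field_automorphismD[OF that(1)] and t = field_automorphismD[OF that(2)]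
    show "\<sigma> x = \<tau> x"
    proof (cases "x = 0")
      case False
      then obtain i where i: "x = g ^ i" using g by blast
      have "\<sigma> (g ^ i) = \<tau> (g ^ i)" by (induction i) (simp_all add: s t that(3))
      then show ?thesis by (simp add: i)
    qed (simp add: s t)
  qed
  have card_roots: "card {x::'f. x ^ m = x} \<le> m" if "m > 1" for m
  proof -
    define P :: "'f poly" where "P = monom 1 m + [:0, - 1:]"
    have deg: "degree P = m"
      unfolding P_def using that degree_add_eq_left[of "[:0, - 1:] :: 'f poly" "monom 1 m"]
      by (simp add: degree_monom_eq)
    then have "P \<noteq> 0" using that by auto
    have "{x. x ^ m = x} = {x. poly P x = 0}"
      by (auto simp: P_def poly_monom)
    then show ?thesis using card_poly_roots_bound[OF \<open>P \<noteq> 0\<close>] deg by simp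
  qed
  have prime_field: "\<exists>k. x = of_nat k" if "x ^ p = x" for x :: 'f
  proof -
    \<comment> \<open>The p multiples of 1 are roots of \<open>X ^ p - X\<close>, which has at most
      p roots, so there are no others.\<close>
    have sub: "of_nat ` {..<p} \<subseteq> {x::'f. x ^ p = x}"
    proof (clarify)
      fix k :: nat
      have "F 1 (of_nat k) = (of_nat k :: 'f)"
        using p0 by (induction k) (simp_all add: F_add, simp_all add: F_def)
      then show "(of_nat k :: 'f) ^ p = of_nat k" by (simp add: F_def)
    qed
    have "card (of_nat ` {..<p} :: 'f set) = p"
      using inj_on_of_nat_CHAR[where 'f = 'f] by (simp add: card_image char)
    with card_roots[OF p0] have "of_nat ` {..<p} = {x::'f. x ^ p = x}"
      by (intro card_seteq[OF _ sub]) auto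
    with that show ?thesis by blast
  qed
  have F_add_exp: "F (i + j) x = F i (F j x)" for i j x
    by (simp add: F_def power_add mult.commute flip: power_mult)
  have orbit: "inj_on (\<lambda>i. F i g) {..<h}"
  proof (rule linorder_inj_onI')
    fix i j assume ij: "i \<in> {..<h}" "j \<in> {..<h}" "i < j"
    show "F i g \<noteq> F j g"
    proof
      assume "F i g = F j g"
      then have "F i g = F i (F (j - i) g)" using ij F_add_exp[of i "j - i" g] by simp
      then have "g = F (j - i) g" using F_inj by (auto dest: injD)
      \<comment> \<open>A Frobenius power below the h-th that fixes the generator is the identity,
        and then \<open>X ^ (p ^ (j - i)) - X\<close> has too many roots, namely
        \<open>p ^ h\<close>.\<close>
      with gen[OF F_aut field_automorphism_id, of "j - i"] have "F (j - i) = id" by simp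
      then have "{x::'f. x ^ (p ^ (j - i)) = x} = UNIV" by (auto simp: F_def fun_eq_iff)
      moreover have "1 < p ^ (j - i)" using ij p0 by (intro one_less_power) auto
      ultimately have "p ^ h \<le> p ^ (j - i)" using card_roots assms(2) by metis
      then have "h \<le> j - i" using p0 by (rule power_le_imp_le_exp[rotated])
      then show False using ij by simp
    qed
  qed
  define P where "P = (\<Prod>i<h. [:- F i g, 1:])"
  have coeff: "\<exists>k. coeff P j = of_nat k" for j
  proof (rule prime_field)
    \<comment> \<open>Frobenius shifts the indices of the factors by one, and the index h wraps
      round to 0 because \<open>F h\<close> is the identity. So it fixes every coefficient of
      \<open>P\<close>.\<close>
    have "map_poly (F 1) P = (\<Prod>i<h. [:- F (Suc i) g, 1:])"
      unfolding P_def map_poly_prod_field_automorphism[OF F_aut] by (simp flip: F_add_exp)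
    also have "\<dots> = (\<Prod>i\<in>{1..h}. [:- F i g, 1:])"
      by (rule prod.reindex_bij_witness[of _ "\<lambda>i. i - 1" Suc]) auto
    also have "{1..h} = insert h {1..<h}" using h0 by auto
    also have "(\<Prod>i\<in>insert h {1..<h}. [:- F i g, 1:]) = [:- F h g, 1:] * (\<Prod>i\<in>{1..<h}. [:- F i g, 1:])"
      by (rule prod.insert) auto
    also have "F h g = F 0 g" by (simp only: Fh) (simp add: F_def)
    also have "[:- F 0 g, 1:] * (\<Prod>i\<in>{1..<h}. [:- F i g, 1:]) = (\<Prod>i\<in>insert 0 {1..<h}. [:- F i g, 1:])"
      by (rule prod.insert[symmetric]) auto
    also have "insert 0 {1..<h} = {..<h}" using h0 by auto
    also have "(\<Prod>i<h. [:- F i g, 1:]) = P" by (simp add: P_def)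
    finally have "coeff (map_poly (F 1) P) j = coeff P j" by simp
    then show "coeff P j ^ p = coeff P j"
      using field_automorphismD(3)[OF F_aut[of 1]] by (simp add: coeff_map_poly) (simp add: F_def)
  qed
  have "{\<sigma> :: 'f \<Rightarrow> 'f. field_automorphism \<sigma>} = F ` {..<h}"
  proof safe
    fix \<sigma> :: "'f \<Rightarrow> 'f" assume s: "field_automorphism \<sigma>"
    have "\<sigma> (of_nat k) = of_nat k" for k
      by (induction k) (simp_all add: field_automorphismD[OF s])
    then have "map_poly \<sigma> P = P"
      using coeff field_automorphismD[OF s] by (intro poly_eqI) (metis coeff_map_poly)
    then have P: "P = (\<Prod>i<h. [:- \<sigma> (F i g), 1:])"
      unfolding P_def map_poly_prod_field_automorphism[OF s] by simp
    have "poly P (\<sigma> g) = 0"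
      unfolding P using h0 by (auto simp: poly_prod F_def intro!: bexI[of _ 0])
    then obtain i where "i < h" "\<sigma> g = F i g" by (auto simp: P_def poly_prod)
    then show "\<sigma> \<in> F ` {..<h}" using gen[OF s F_aut] by blast
  qed (rule F_aut)
  moreover have "inj_on F {..<h}"
    using orbit by (auto simp: inj_on_def)
  ultimately show ?thesis
    by (simp add: Coset.order_def field_Aut_def map_group_def card_image)
qed

section \<open>Semilinear maps and collineations\<close>

locale projective_geometry = vector_space scale
  for scale :: "'a::field \<Rightarrow> 'b::ab_group_add \<Rightarrow> 'b"
begin

lemma pg_points_iff:
  assumes "subspace U"
  shows "x \<in> pg_points scale U \<longleftrightarrow> (\<exists>v\<in>U. v \<noteq> 0 \<and> x = span {v})"
proof
  assume "x \<in> pg_points scale U"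
  then have x: "subspace x" "x \<subseteq> U" "dim x = 1" by (auto simp: pg_points_def)
  obtain B where B: "B \<subseteq> x" "independent B" "x \<subseteq> span B" "card B = dim x"
    using basis_exists by blast
  then obtain v where v: "B = {v}" using x by (auto simp: card_1_singleton_iff)
  moreover have "span B \<subseteq> x" using B(1) x(1) by (rule span_minimal)
  ultimately show "\<exists>v\<in>U. v \<noteq> 0 \<and> x = span {v}"
    using B x by (intro bexI[of _ v]) auto
next
  assume "\<exists>v\<in>U. v \<noteq> 0 \<and> x = span {v}"
  then obtain v where v: "v \<in> U" "v \<noteq> 0" "x = span {v}" by blast
  then have "dim x = 1" using dim_eq_card_independent[of "{v}"] by simp
  then show "x \<in> pg_points scale U"
    using v assms by (auto simp: pg_points_def span_minimal)
qed

lemma span_singleton_eq_iff: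
  assumes "u \<noteq> 0"
  shows "span {u} = span {v} \<longleftrightarrow> (\<exists>c. c \<noteq> 0 \<and> u = scale c v)"
proof
  assume "span {u} = span {v}"
  then have "u \<in> span {v}" using span_base[of u "{u}"] by simp
  then obtain c where "u = scale c v" by (auto simp: span_singleton)
  with assms show "\<exists>c. c \<noteq> 0 \<and> u = scale c v" by auto
next
  assume "\<exists>c. c \<noteq> 0 \<and> u = scale c v"
  then obtain c where "c \<noteq> 0" "u = scale c v" by blast
  then show "span {u} = span {v}"
    using span_image_scale[of "{v}" "\<lambda>_. c"] by simp
qed

text \<open>In contrast to \<open>semilinear_bij\<close>, the field automorphism is explicit and
  bijectivity is left out, so that maps can be restricted, composed and compared before they are
  known to be bijective.\<close>

definition semilinear_on :: "'b set \<Rightarrow> ('a \<Rightarrow> 'a) \<Rightarrow> ('b \<Rightarrow> 'b) \<Rightarrow> bool" where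
  "semilinear_on U \<sigma> \<phi> \<longleftrightarrow> field_automorphism \<sigma> \<and>
     (\<forall>x\<in>U. \<forall>y\<in>U. \<phi> (x + y) = \<phi> x + \<phi> y) \<and> (\<forall>a. \<forall>x\<in>U. \<phi> (scale a x) = scale (\<sigma> a) (\<phi> x))"

lemma semilinear_bij_iff:
  "semilinear_bij scale U \<phi> \<longleftrightarrow> bij_betw \<phi> U U \<and> (\<exists>\<sigma>. semilinear_on U \<sigma> \<phi>)"
  by (simp add: semilinear_bij_def semilinear_on_def)

lemma semilinear_onD:
  assumes "semilinear_on U \<sigma> \<phi>"
  shows "field_automorphism \<sigma>"
    and "x \<in> U \<Longrightarrow> y \<in> U \<Longrightarrow> \<phi> (x + y) = \<phi> x + \<phi> y"
    and "x \<in> U \<Longrightarrow> \<phi> (scale a x) = scale (\<sigma> a) (\<phi> x)"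
  using assms by (auto simp: semilinear_on_def)

lemma semilinear_on_zero: "semilinear_on U \<sigma> \<phi> \<Longrightarrow> subspace U \<Longrightarrow> \<phi> 0 = 0"
  using semilinear_onD(3)[of U \<sigma> \<phi> 0 0] field_automorphismD(3)[of \<sigma>]
  by (simp add: subspace_0 semilinear_onD(1))

lemma semilinear_on_subset: "semilinear_on U \<sigma> \<phi> \<Longrightarrow> W \<subseteq> U \<Longrightarrow> semilinear_on W \<sigma> \<phi>"
  unfolding semilinear_on_def by blast

lemma semilinear_on_sum:
  assumes "semilinear_on U \<sigma> \<phi>" "subspace U" "\<And>i. i \<in> A \<Longrightarrow> f i \<in> U"
  shows "\<phi> (\<Sum>i\<in>A. f i) = (\<Sum>i\<in>A. \<phi> (f i))"
  using assms(3)
  by (induction A rule: infinite_finite_induct)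
    (auto simp: semilinear_on_zero[OF assms(1,2)] semilinear_onD(2)[OF assms(1)] subspace_sum[OF assms(2)])

lemma semilinear_on_comp:
  assumes "semilinear_on W \<sigma> \<phi>" "semilinear_on U \<tau> \<psi>" "\<psi> ` U \<subseteq> W"
  shows "semilinear_on U (\<sigma> \<circ> \<tau>) (\<phi> \<circ> \<psi>)"
  using assms by (auto simp: semilinear_on_def field_automorphism_comp image_subset_iff)

lemma semilinear_on_scale:
  assumes "semilinear_on U \<sigma> \<phi>"
  shows "semilinear_on U \<sigma> (\<lambda>x. scale c (\<phi> x))"
  using assms by (auto simp: semilinear_on_def scale_right_distrib mult.commute)

lemma semilinear_on_eq:
  assumes "semilinear_on (span B) \<sigma> \<phi>" "semilinear_on (span B) \<sigma> \<psi>"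
    and "\<And>b. b \<in> B \<Longrightarrow> \<phi> b = \<psi> b" and "x \<in> span B"
  shows "\<phi> x = \<psi> x"
proof -
  have "x \<in> span B \<and> \<phi> x = \<psi> x"
    using assms(4)
  proof (induction rule: span_induct_alt)
    case base
    show ?case using assms(1,2) by (simp add: semilinear_on_zero span_zero)
  next
    case (step c b y)
    then show ?case
      by (simp add: semilinear_onD(2,3)[OF assms(1)] semilinear_onD(2,3)[OF assms(2)] span_base
          span_scale span_add assms(3))
  qed
  then show ?thesis ..
qed

lemma semilinear_on_image_subspace:
  assumes "semilinear_on U \<sigma> \<phi>" "subspace U"
  shows "subspace (\<phi> ` U)"
proof (rule subspaceI)
  show "0 \<in> \<phi> ` U" using semilinear_on_zero[OF assms] subspace_0[OF assms(2)] by force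
  show "x + y \<in> \<phi> ` U" if "x \<in> \<phi> ` U" "y \<in> \<phi> ` U" for x y
  proof -
    from that obtain x' y' where "x' \<in> U" "x = \<phi> x'" "y' \<in> U" "y = \<phi> y'" by blast
    then show ?thesis
      using semilinear_onD(2)[OF assms(1), of x' y'] subspace_add[OF assms(2), of x' y']
      by (intro image_eqI[of _ _ "x' + y'"]) simp_all
  qed
  show "scale c x \<in> \<phi> ` U" if "x \<in> \<phi> ` U" for c x
  proof -
    have "surj \<sigma>"
      using field_automorphismD(5)[OF semilinear_onD(1)[OF assms(1)]] by (rule bij_is_surj)
    then obtain c' where "c = \<sigma> c'" by (auto simp: surj_def)
    moreover from that obtain x' where "x' \<in> U" "x = \<phi> x'" by blast
    ultimately show ?thesis
      using semilinear_onD(3)[OF assms(1), of x' c'] subspace_scale[OF assms(2), of x' c']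
      by (intro image_eqI[of _ _ "scale c' x'"]) simp_all
  qed
qed

lemma semilinear_on_image_span:
  assumes "semilinear_on U \<sigma> \<phi>" "subspace U" "S \<subseteq> U"
  shows "\<phi> ` span S = span (\<phi> ` S)"
proof
  have sub: "span S \<subseteq> U" using assms(2,3) by (simp add: span_minimal)
  note sl = semilinear_on_subset[OF assms(1) sub]
  show "span (\<phi> ` S) \<subseteq> \<phi> ` span S"
    by (intro span_minimal semilinear_on_image_subspace[OF sl]) (auto intro: span_base)
  show "\<phi> ` span S \<subseteq> span (\<phi> ` S)"
  proof (clarify)
    fix x assume "x \<in> span S"
    then have "x \<in> span S \<and> \<phi> x \<in> span (\<phi> ` S)"
    proof (induction rule: span_induct_alt)
      case base
      show ?case using semilinear_on_zero[OF sl] by (simp add: span_zero)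
    next
      case (step c b y)
      then show ?case
        by (auto simp: semilinear_onD(2,3)[OF sl] span_base span_scale intro!: span_add)
    qed
    then show "\<phi> x \<in> span (\<phi> ` S)" ..
  qed
qed

section \<open>Semilinear bijections and the collineations they induce\<close>

lemma semilinear_bij_id: "semilinear_bij scale U id"
  unfolding semilinear_bij_iff
  by (auto simp: semilinear_on_def field_automorphism_id intro!: exI[of _ id])

lemma semilinear_bij_comp:
  assumes "semilinear_bij scale U \<phi>" "semilinear_bij scale U \<psi>"
  shows "semilinear_bij scale U (\<phi> \<circ> \<psi>)"
proof -
  obtain \<sigma> \<tau> where sl: "semilinear_on U \<sigma> \<phi>" "semilinear_on U \<tau> \<psi>"
    and b: "bij_betw \<phi> U U" "bij_betw \<psi> U U"
    using assms by (auto simp: semilinear_bij_iff)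
  have "semilinear_on U (\<sigma> \<circ> \<tau>) (\<phi> \<circ> \<psi>)"
    using b(2) by (intro semilinear_on_comp[OF sl]) (simp add: bij_betw_def)
  then show ?thesis
    using bij_betw_trans[OF b(2,1)] by (auto simp: semilinear_bij_iff)
qed

lemma semilinear_on_inv_into:
  assumes "semilinear_on U \<sigma> \<phi>" "bij_betw \<phi> U U" "subspace U"
  shows "semilinear_on U (inv' \<sigma>) (inv_into U \<phi>)"
proof -
  let ?\<psi> = "inv_into U \<phi>"
  note sl = semilinear_onD[OF assms(1)]
  have psi: "?\<psi> x \<in> U" "\<phi> (?\<psi> x) = x" "?\<psi> (\<phi> x) = x" if "x \<in> U" for x
    using assms(2) that
    by (auto simp: bij_betw_def inv_into_into f_inv_into_f inv_into_f_f)
  have inj: "x = y" if "x \<in> U" "y \<in> U" "\<phi> x = \<phi> y" for x y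
    using psi(3) that by metis
  have surj: "\<sigma> (inv' \<sigma> a) = a" for a
    using field_automorphismD(5)[OF sl(1)] by (simp add: bij_def surj_f_inv_f)
  have "?\<psi> (x + y) = ?\<psi> x + ?\<psi> y" if "x \<in> U" "y \<in> U" for x y
    by (rule inj) (use that assms(3) in \<open>auto simp: psi sl subspace_add\<close>)
  moreover have "?\<psi> (scale a x) = scale (inv' \<sigma> a) (?\<psi> x)" if "x \<in> U" for a x
    by (rule inj) (use that assms(3) in \<open>auto simp: psi sl subspace_scale surj\<close>)
  ultimately show ?thesis
    by (simp add: semilinear_on_def field_automorphism_inv[OF sl(1)])
qed

lemma semilinear_bij_inv_into:
  "semilinear_bij scale U \<phi> \<Longrightarrow> subspace U \<Longrightarrow> semilinear_bij scale U (inv_into U \<phi>)"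
  unfolding semilinear_bij_iff by (meson bij_betw_inv_into semilinear_on_inv_into)

text \<open>The value off the points is the identity because \<open>PGammaL\<close> is made of
  functions that permute the set of points in the sense of \<open>permutes\<close>.\<close>

definition induced :: "'b set \<Rightarrow> ('b \<Rightarrow> 'b) \<Rightarrow> 'b set \<Rightarrow> 'b set" where
  "induced U \<phi> x = (if x \<in> pg_points scale U then \<phi> ` x else x)"

lemma semilinear_bij_span:
  assumes "semilinear_bij scale U \<phi>" "subspace U" "v \<in> U"
  shows "\<phi> ` span {v} = span {\<phi> v}" "\<phi> v \<in> U" "\<phi> v = 0 \<longleftrightarrow> v = 0"
proof -
  obtain \<sigma> where sl: "semilinear_on U \<sigma> \<phi>" and b: "bij_betw \<phi> U U"
    using assms(1) by (auto simp: semilinear_bij_iff)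
  show "\<phi> ` span {v} = span {\<phi> v}"
    using semilinear_on_image_span[OF sl assms(2), of "{v}"] assms(3) by simp
  show "\<phi> v \<in> U" using b assms(3) by (auto simp: bij_betw_def)
  show "\<phi> v = 0 \<longleftrightarrow> v = 0"
    using semilinear_on_zero[OF sl assms(2)] b assms(3) subspace_0[OF assms(2)]
    by (metis bij_betw_def inj_onD)
qed

lemma induced_span:
  assumes "semilinear_bij scale U \<phi>" "subspace U" "v \<in> U"
  shows "induced U \<phi> (span {v}) = span {\<phi> v}"
proof (cases "v = 0")
  \<comment> \<open>The span of 0 is not a point, so \<open>induced\<close> leaves it alone, and
    \<phi> fixes 0.\<close>
  case True
  have "dim {0} = 0" using dim_span[of "{}"] dim_eq_card_independent[of "{}"] by (simp add: dependent_def)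
  then have "span {v} \<notin> pg_points scale U" using True by (simp add: pg_points_def)
  then show ?thesis using True semilinear_bij_span(3)[OF assms] by (simp add: induced_def)
next
  case False
  then have "span {v} \<in> pg_points scale U" using assms by (auto simp: pg_points_iff)
  then show ?thesis using semilinear_bij_span(1)[OF assms] by (simp add: induced_def)
qed

lemma induced_in_points:
  assumes "semilinear_bij scale U \<phi>" "subspace U" "x \<in> pg_points scale U"
  shows "induced U \<phi> x \<in> pg_points scale U"
proof -
  obtain v where "v \<in> U" "v \<noteq> 0" "x = span {v}" using assms(2,3) by (auto simp: pg_points_iff)
  with semilinear_bij_span(2,3)[OF assms(1,2), of v] show ?thesis
    by (auto simp: induced_span[OF assms(1,2)] pg_points_iff[OF assms(2)] intro!: bexI[of _ "\<phi> v"])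
qed

lemma induced_comp:
  assumes "semilinear_bij scale U \<psi>" "subspace U"
  shows "induced U (\<phi> \<circ> \<psi>) = induced U \<phi> \<circ> induced U \<psi>"
proof
  fix x
  show "induced U (\<phi> \<circ> \<psi>) x = (induced U \<phi> \<circ> induced U \<psi>) x"
  proof (cases "x \<in> pg_points scale U")
    case True
    then show ?thesis using induced_in_points[OF assms True] by (simp add: induced_def image_comp)
  qed (simp add: induced_def)
qed

lemma induced_eq_id: "(\<And>x. x \<in> U \<Longrightarrow> \<phi> x = x) \<Longrightarrow> induced U \<phi> = id"
  by (force simp: induced_def fun_eq_iff pg_points_def)

lemma induced_cong: "(\<And>x. x \<in> U \<Longrightarrow> \<phi> x = \<psi> x) \<Longrightarrow> induced U \<phi> = induced U \<psi>"
  by (force simp: induced_def fun_eq_iff pg_points_def)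

lemma induced_inv_into:
  assumes "semilinear_bij scale U \<phi>" "subspace U"
  shows "induced U (inv_into U \<phi>) \<circ> induced U \<phi> = id" "induced U \<phi> \<circ> induced U (inv_into U \<phi>) = id"
proof -
  have b: "bij_betw \<phi> U U" using assms by (auto simp: semilinear_bij_iff)
  have "induced U (inv_into U \<phi> \<circ> \<phi>) = id" "induced U (\<phi> \<circ> inv_into U \<phi>) = id"
    using bij_betw_inv_into_left[OF b] bij_betw_inv_into_right[OF b] by (simp_all add: induced_eq_id)
  then show "induced U (inv_into U \<phi>) \<circ> induced U \<phi> = id" "induced U \<phi> \<circ> induced U (inv_into U \<phi>) = id"
    by (simp_all only: induced_comp[OF assms] induced_comp[OF semilinear_bij_inv_into[OF assms] assms(2)])
qed

lemma carrier_PGammaL: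
  assumes "subspace U"
  shows "carrier (PGammaL scale U) = {induced U \<phi> | \<phi>. semilinear_bij scale U \<phi>}"
proof (rule Set.set_eqI)
  fix g
  have "g permutes pg_points scale U" if g: "semilinear_bij scale U \<phi>" "g = induced U \<phi>" for \<phi>
  proof (rule bij_imp_permutes)
    have "induced U (inv_into U \<phi>) (induced U \<phi> x) = x" "induced U \<phi> (induced U (inv_into U \<phi>) x) = x" for x
      using induced_inv_into[OF g(1) assms] by (metis comp_apply id_apply)+
    then show "bij_betw g (pg_points scale U) (pg_points scale U)"
      using g induced_in_points[OF g(1) assms]
        induced_in_points[OF semilinear_bij_inv_into[OF g(1) assms] assms]
      by (intro bij_betw_byWitness[where f' = "induced U (inv_into U \<phi>)"]) auto
  qed (simp add: g induced_def)
  moreover have "g = induced U \<phi>"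
    if "g permutes pg_points scale U" "\<forall>x\<in>pg_points scale U. g x = \<phi> ` x" for \<phi>
    by (rule ext) (use that in \<open>simp add: induced_def permutes_def\<close>)
  moreover have "\<forall>x\<in>pg_points scale U. induced U \<phi> x = \<phi> ` x" for \<phi>
    by (simp add: induced_def)
  ultimately show "g \<in> carrier (PGammaL scale U) \<longleftrightarrow> g \<in> {induced U \<phi> | \<phi>. semilinear_bij scale U \<phi>}"
    unfolding PGammaL_def map_group_def by auto
qed

lemma PGammaL_simps:
  "monoid.mult (PGammaL scale U) = (\<circ>)" "\<one>\<^bsub>PGammaL scale U\<^esub> = id"
  "monoid.mult (PGammaL_stab scale U K) = (\<circ>)" "\<one>\<^bsub>PGammaL_stab scale U K\<^esub> = id"
  "monoid.mult (Persp scale U) = (\<circ>)" "\<one>\<^bsub>Persp scale U\<^esub> = id"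
  "carrier (PGammaL_stab scale U K) = {g \<in> carrier (PGammaL scale U). g ` K = K}"
  "carrier (Persp scale U) = {g \<in> carrier (PGammaL scale UNIV). \<forall>x\<in>pg_points scale U. g x = x}"
  by (simp_all add: PGammaL_stab_def Persp_def PGammaL_def map_group_def)

lemma PGammaL_I: "subspace U \<Longrightarrow> semilinear_bij scale U \<phi> \<Longrightarrow> induced U \<phi> \<in> carrier (PGammaL scale U)"
  unfolding carrier_PGammaL by blast

lemma PGammaL_E:
  assumes "g \<in> carrier (PGammaL scale U)" "subspace U"
  obtains \<phi> where "semilinear_bij scale U \<phi>" "g = induced U \<phi>"
  using assms unfolding carrier_PGammaL[OF assms(2)] by blast

lemma PGammaL_id: "subspace U \<Longrightarrow> id \<in> carrier (PGammaL scale U)"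
  using PGammaL_I[OF _ semilinear_bij_id] by (simp add: induced_eq_id)

lemma PGammaL_comp:
  assumes "subspace U" "f \<in> carrier (PGammaL scale U)" "g \<in> carrier (PGammaL scale U)"
  shows "f \<circ> g \<in> carrier (PGammaL scale U)"
proof -
  obtain \<phi> \<psi> where "semilinear_bij scale U \<phi>" "f = induced U \<phi>" "semilinear_bij scale U \<psi>" "g = induced U \<psi>"
    using assms PGammaL_E by metis
  then show ?thesis
    using PGammaL_I[OF assms(1) semilinear_bij_comp, of \<phi> \<psi>] by (simp add: induced_comp assms(1))
qed

lemma PGammaL_inverse:
  assumes "subspace U" "f \<in> carrier (PGammaL scale U)"
  shows "\<exists>g\<in>carrier (PGammaL scale U). g \<circ> f = id"
proof -
  obtain \<phi> where \<phi>: "semilinear_bij scale U \<phi>" "f = induced U \<phi>"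
    using assms PGammaL_E by metis
  show ?thesis
    unfolding \<phi>(2) using induced_inv_into(1)[OF \<phi>(1) assms(1)]
      PGammaL_I[OF assms(1) semilinear_bij_inv_into[OF \<phi>(1) assms(1)]] by blast
qed

lemma group_PGammaL_stab:
  assumes "subspace U"
  shows "group (PGammaL_stab scale U K)"
proof -
  have "PGammaL_stab scale U K = map_group {g \<in> carrier (PGammaL scale U). g ` K = K}"
    by (simp add: PGammaL_stab_def PGammaL_def map_group_def)
  also have "Group.group \<dots>"
  proof (rule group_map_group)
    fix f assume f: "f \<in> {g \<in> carrier (PGammaL scale U). g ` K = K}"
    then have "f \<in> carrier (PGammaL scale U)" by simp
    from PGammaL_inverse[OF assms this]
    obtain g where g: "g \<in> carrier (PGammaL scale U)" "g \<circ> f = id" ..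
    have "g ` f ` K = K" unfolding image_comp g(2) by simp
    then have "g ` K = K" using f by simp
    with g show "\<exists>g\<in>{g \<in> carrier (PGammaL scale U). g ` K = K}. g \<circ> f = id"
      by (intro bexI[of _ g]) simp_all
  next
    fix f g assume "f \<in> {g \<in> carrier (PGammaL scale U). g ` K = K}" "g \<in> {g \<in> carrier (PGammaL scale U). g ` K = K}"
    moreover from this have "(f \<circ> g) ` K = K" unfolding image_comp[symmetric] by simp
    ultimately show "f \<circ> g \<in> {g \<in> carrier (PGammaL scale U). g ` K = K}"
      using assms by (simp add: PGammaL_comp)
  qed (use assms in \<open>simp add: PGammaL_id\<close>)
  finally show ?thesis .
qed

lemma group_Persp: "group (Persp scale U)"
proof -
  have "Persp scale U = map_group {g \<in> carrier (PGammaL scale UNIV). \<forall>x\<in>pg_points scale U. g x = x}"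
    by (simp add: Persp_def PGammaL_def map_group_def)
  also have "Group.group \<dots>"
  proof (rule group_map_group)
    fix f assume f: "f \<in> {g \<in> carrier (PGammaL scale UNIV). \<forall>x\<in>pg_points scale U. g x = x}"
    then have "f \<in> carrier (PGammaL scale UNIV)" by simp
    from PGammaL_inverse[OF subspace_UNIV this]
    obtain g where g: "g \<in> carrier (PGammaL scale UNIV)" "g \<circ> f = id" ..
    have "g x = x" if "x \<in> pg_points scale U" for x
    proof -
      have "g (f x) = x" using g(2) by (simp add: fun_eq_iff)
      then show ?thesis using f that by simp
    qed
    with g show "\<exists>g\<in>{g \<in> carrier (PGammaL scale UNIV). \<forall>x\<in>pg_points scale U. g x = x}. g \<circ> f = id"
      by (intro bexI[of _ g]) simp_all
  qed (auto simp: PGammaL_id PGammaL_comp)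
  finally show ?thesis .
qed

text \<open>Additivity at x + y shows that independent x and y are scaled by the same factor.
  Vectors on the line of u are compared with v, which lies off it; this is why two independent
  vectors are assumed.\<close>

lemma semilinear_on_fixing_lines:
  assumes "semilinear_on U \<sigma> \<phi>" and U: "subspace U"
    and uv: "u \<in> U" "v \<in> U" "u \<noteq> 0" "v \<notin> span {u}"
    and fix_lines: "\<And>x. x \<in> U \<Longrightarrow> \<phi> x \<in> span {x}" and nz: "\<phi> u \<noteq> 0"
  shows "\<sigma> = id \<and> (\<exists>c. c \<noteq> 0 \<and> (\<forall>x\<in>U. \<phi> x = scale c x))"
proof -
  note sl = semilinear_onD[OF assms(1)]
  have ex: "\<exists>a. \<phi> x = scale a x" if "x \<in> U" for x
    using fix_lines[OF that] by (auto simp: span_singleton)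
  have indep: "a = 0 \<and> b = 0" if "scale a x + scale b y = 0" "x \<noteq> 0" "y \<notin> span {x}" for a b x y
  proof -
    have "b = 0"
    proof (rule ccontr)
      assume b: "b \<noteq> 0"
      have "scale (inverse b) (scale a x + scale b y) = 0" by (simp only: that(1) scale_zero_right)
      then have "scale (inverse b * a) x + y = 0" using b by (simp add: scale_right_distrib)
      then have "y = - scale (inverse b * a) x" by (metis add.inverse_unique)
      then have "y \<in> span {x}" by (simp add: span_neg span_scale span_base)
      with that show False by simp
    qed
    with that show ?thesis by simp
  qed
  have same: "\<phi> y = scale a y" if "x \<in> U" "y \<in> U" "x \<noteq> 0" "y \<notin> span {x}" "\<phi> x = scale a x" for x y a
  proof -
    from ex[OF that(2)] obtain b where b: "\<phi> y = scale b y" ..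
    from ex[OF subspace_add[OF U that(1,2)]] obtain c where c: "\<phi> (x + y) = scale c (x + y)" ..
    have "scale (a - c) x + scale (b - c) y = 0"
    proof -
      have "scale a x + scale b y = scale c x + scale c y"
        using c sl(2)[OF that(1,2)] that(5) b by (simp add: scale_right_distrib)
      then have "(scale a x + scale b y) - (scale c x + scale c y) = 0" by simp
      then show ?thesis by (simp only: add_diff_add scale_left_diff_distrib)
    qed
    from indep[OF this that(3,4)] b show ?thesis by simp
  qed
  obtain c where c: "\<phi> u = scale c u" using ex uv by blast
  then have c0: "c \<noteq> 0" using nz by auto
  have cv: "\<phi> v = scale c v" using same[OF uv c] .
  have v0: "v \<noteq> 0" using uv(4) by (auto simp: span_zero)
  have all: "\<phi> x = scale c x" if "x \<in> U" for x
  proof (cases "x \<in> span {u}")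
    case False
    then show ?thesis using same[OF uv(1) that uv(3) _ c] by simp
  next
    case True
    then obtain t where t: "x = scale t u" by (auto simp: span_singleton)
    show ?thesis
    proof (cases "t = 0")
      case True
      then show ?thesis using t semilinear_on_zero[OF assms(1) U] by simp
    next
      case False
      have "x \<notin> span {v}"
      proof
        assume "x \<in> span {v}"
        then obtain s where "x = scale s v" by (auto simp: span_singleton)
        then have "scale t u + scale (- s) v = 0" using t by simp
        from indep[OF this uv(3,4)] False show False by simp
      qed
      then show ?thesis using same[OF uv(2) that v0 _ cv] by simp
    qed
  qed
  \<comment> \<open>Evaluating \<phi> at \<open>s u + v\<close> both as a multiple and by
    semilinearity equates \<open>c * s\<close> with \<open>\<sigma> s * c\<close>.\<close>
  have "\<sigma> s = s" for s
  proof -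
    have "scale s u + v \<in> U" using uv U by (simp add: subspace_add subspace_scale)
    then have "scale c (scale s u + v) = scale (\<sigma> s) (scale c u) + scale c v"
      using all[of "scale s u + v"] sl(2)[of "scale s u" v] sl(3)[OF uv(1), of s] uv(1,2) U c cv
      by (simp add: subspace_scale)
    then have "c * s = \<sigma> s * c" using uv(3) by (simp add: scale_right_distrib)
    then show ?thesis using c0 by simp
  qed
  then show ?thesis using c0 all by (simp add: fun_eq_iff) blast
qed

text \<open>The map \<phi> followed by the inverse of \<psi> fixes every point, hence is a
  multiplication by a scalar; \<psi> carries that scalar to the factor between \<phi> and
  \<psi>.\<close>

lemma induced_eqD:
  assumes U: "subspace U" and uv: "u \<in> U" "v \<in> U" "u \<noteq> 0" "v \<notin> span {u}"
    and phi: "semilinear_on U \<sigma> \<phi>" "bij_betw \<phi> U U"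
    and psi: "semilinear_on U \<tau> \<psi>" "bij_betw \<psi> U U"
    and eq: "induced U \<phi> = induced U \<psi>"
  shows "\<sigma> = \<tau> \<and> (\<exists>c. c \<noteq> 0 \<and> (\<forall>x\<in>U. \<phi> x = scale c (\<psi> x)))"
proof -
  have sphi: "semilinear_bij scale U \<phi>" and spsi: "semilinear_bij scale U \<psi>"
    using phi psi by (auto simp: semilinear_bij_iff)
  let ?\<theta> = "inv_into U \<psi> \<circ> \<phi>"
  have inv: "inv_into U \<psi> y \<in> U" "\<psi> (inv_into U \<psi> y) = y" if "y \<in> U" for y
    using psi(2) that by (auto simp: bij_betw_def inv_into_into f_inv_into_f)
  have st: "semilinear_bij scale U ?\<theta>"
    using sphi spsi U by (intro semilinear_bij_comp semilinear_bij_inv_into)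
  have "induced U ?\<theta> = id"
    using induced_inv_into(1)[OF spsi U] eq by (simp add: induced_comp[OF sphi U])
  then have fix_lines: "?\<theta> x \<in> span {x}" if "x \<in> U" for x
    using induced_span[OF st U that] span_base[of "?\<theta> x" "{?\<theta> x}"] by simp
  have "semilinear_on U (inv' \<tau> \<circ> \<sigma>) ?\<theta>"
    using semilinear_on_comp[OF semilinear_on_inv_into[OF psi U] phi(1)] phi(2) by (simp add: bij_betw_def)
  from semilinear_on_fixing_lines[OF this U uv fix_lines]
  have *: "inv' \<tau> \<circ> \<sigma> = id \<and> (\<exists>c. c \<noteq> 0 \<and> (\<forall>x\<in>U. ?\<theta> x = scale c x))"
    using semilinear_bij_span(3)[OF st U uv(1)] uv(3) by simp
  then obtain c where c: "c \<noteq> 0" "\<And>x. x \<in> U \<Longrightarrow> ?\<theta> x = scale c x" by blast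
  have bt: "bij \<tau>" using semilinear_onD(1)[OF psi(1)] field_automorphismD(5) by blast
  have "\<tau> \<circ> (inv' \<tau> \<circ> \<sigma>) = \<tau>" using * by simp
  moreover have "\<tau> (inv' \<tau> a) = a" for a using bt by (simp add: bij_def surj_f_inv_f)
  ultimately have "\<sigma> = \<tau>" by (simp add: fun_eq_iff)
  moreover have "\<phi> x = scale (\<tau> c) (\<psi> x)" if "x \<in> U" for x
  proof -
    have "\<phi> x \<in> U" using phi(2) that by (auto simp: bij_betw_def)
    then have "\<phi> x = \<psi> (?\<theta> x)" by (simp add: inv)
    then show ?thesis using c(2)[OF that] semilinear_onD(3)[OF psi(1) that] by simp
  qed
  moreover have "\<tau> c \<noteq> 0" using c(1) field_automorphismD(7)[OF semilinear_onD(1)[OF psi(1)]] by simp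
  ultimately show ?thesis by blast
qed

lemma induced_scale:
  assumes "c \<noteq> 0" "semilinear_bij scale U \<phi>" "subspace U"
  shows "semilinear_bij scale U (\<lambda>x. scale c (\<phi> x))"
    "induced U (\<lambda>x. scale c (\<phi> x)) = induced U \<phi>"
proof -
  obtain \<sigma> where sl: "semilinear_on U \<sigma> \<phi>" and b: "bij_betw \<phi> U U"
    using assms(2) by (auto simp: semilinear_bij_iff)
  have "bij_betw (scale c) U U"
    by (rule bij_betw_byWitness[where f' = "scale (inverse c)"])
      (use assms in \<open>auto intro: subspace_scale\<close>)
  from bij_betw_trans[OF b this] show s: "semilinear_bij scale U (\<lambda>x. scale c (\<phi> x))"
    using semilinear_on_scale[OF sl, of c] by (auto simp: semilinear_bij_iff comp_def)
  show "induced U (\<lambda>x. scale c (\<phi> x)) = induced U \<phi>"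
  proof
    fix x
    show "induced U (\<lambda>x. scale c (\<phi> x)) x = induced U \<phi> x"
    proof (cases "x \<in> pg_points scale U")
      case True
      then obtain v where v: "v \<in> U" "v \<noteq> 0" "x = span {v}" using assms(3) by (auto simp: pg_points_iff)
      then have "scale c (\<phi> v) \<noteq> 0" using semilinear_bij_span(3)[OF assms(2,3)] assms(1) by simp
      then have "span {scale c (\<phi> v)} = span {\<phi> v}"
        using assms(1) span_singleton_eq_iff by blast
      then show ?thesis using v by (simp add: induced_span[OF s] induced_span[OF assms(2)] assms(3))
    qed (simp add: induced_def)
  qed
qed

lemma exists_semilinear:
  assumes "field_automorphism \<sigma>" "independent B" "finite B" "span B = UNIV"
  shows "\<exists>\<phi>. semilinear_on UNIV \<sigma> \<phi> \<and> (\<forall>b\<in>B. \<phi> b = f b)"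
proof (intro exI conjI ballI)
  let ?\<phi> = "\<lambda>x. \<Sum>b\<in>B. scale (\<sigma> (representation B x b)) (f b)"
  note s = field_automorphismD[OF assms(1)]
  show "semilinear_on UNIV \<sigma> ?\<phi>"
    by (auto simp: semilinear_on_def assms(1) representation_add[OF assms(2)] assms(4) s
        representation_scale[OF assms(2)] scale_left_distrib sum.distrib scale_sum_right)
  fix b assume "b \<in> B"
  then show "?\<phi> b = f b"
    using assms by (simp add: representation_basis s if_distrib[of \<sigma>] if_distrib[of "\<lambda>a. scale a _"] cong: if_cong)
qed

lemma card_span_independent:
  assumes "independent B" "finite B" "finite (UNIV :: 'a set)"
  shows "finite (span B)" "card (span B) = card (UNIV :: 'a set) ^ card B"
proof -
  let ?f = "\<lambda>u. \<Sum>b\<in>B. scale (u b) b"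
  have "inj_on ?f (PiE B (\<lambda>_. UNIV))"
  proof (rule inj_onI)
    fix u w assume uw: "u \<in> PiE B (\<lambda>_. UNIV)" "w \<in> PiE B (\<lambda>_. UNIV)" "?f u = ?f w"
    have "(\<Sum>b\<in>B. scale (u b - w b) b) = 0"
      using uw(3) by (simp add: scale_left_diff_distrib sum_subtractf)
    then have "u b = w b" if "b \<in> B" for b
      using independentD[OF assms(1,2) order_refl, of "\<lambda>b. u b - w b"] that by simp
    then show "u = w" by (rule PiE_ext[OF uw(1,2)])
  qed
  moreover have "?f ` PiE B (\<lambda>_. UNIV) = span B"
  proof -
    have "?f u \<in> ?f ` PiE B (\<lambda>_. UNIV)" for u
      by (rule image_eqI[of _ _ "restrict u B"]) auto
    then show ?thesis unfolding span_finite[OF assms(2)] by auto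
  qed
  ultimately have "bij_betw ?f (PiE B (\<lambda>_. UNIV)) (span B)" by (simp add: bij_betw_def)
  then show "card (span B) = card (UNIV :: 'a set) ^ card B" "finite (span B)"
    using assms by (auto simp: bij_betw_same_card[symmetric] card_PiE bij_betw_finite[symmetric] finite_PiE)
qed

end

section \<open>Coordinates adapted to the arc\<close>

text \<open>Here \<open>q\<close> is at once the size of the field and of the arc, and the clause
  \<open>n \<ge> 3\<close> in the case \<open>q = n + 2\<close> encodes
  \<open>(n, q) \<noteq> (2, 4)\<close>. The vector \<open>e\<close> completes a basis of the
  hyperplane to one of the whole space and serves as origin of the affine points.\<close>

locale arc_frame = projective_geometry scale
  for scale :: "'f::finite_field \<Rightarrow> 'v::ab_group_add \<Rightarrow> 'v" +
  fixes n q :: nat and e :: 'v and d :: "nat \<Rightarrow> 'v" and H :: "'v set" and K :: "'v set set"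
  assumes card_field: "card (UNIV :: 'f set) = q"
    and n_ge_2: "n \<ge> 2"
    and q_cases: "q = n + 1 \<or> q = n + 2 \<and> n \<ge> 3"
    and inj_d: "inj_on d {..n}"
    and indep_d: "independent (d ` {..n})"
    and H_eq: "H = span (d ` {..n})"
    and e_notin_H: "e \<notin> H"
    and span_frame: "span (insert e (d ` {..n})) = UNIV"
    and sum_d: "q = n + 2 \<Longrightarrow> (\<Sum>i<q. d i) = 0"
    and K_eq: "K = (\<lambda>i. span {d i}) ` {..<q}"
begin

abbreviation "stab_H \<equiv> PGammaL_stab scale H K"

abbreviation "stab_UNIV \<equiv> PGammaL_stab scale UNIV K"

lemma subspace_H: "subspace H" by (simp add: H_eq)

lemma q_gt_2: "q > 2" and n_lt_q: "n < q"
  using q_cases n_ge_2 by auto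

lemma indep_frame: "independent (insert e (d ` {..n}))"
  using e_notin_H indep_d by (simp add: independent_insertI H_eq)

lemma d_in_H:
  assumes "i < q"
  shows "d i \<in> H"
proof (cases "i \<le> n")
  case True
  then show ?thesis by (auto simp: H_eq intro: span_base)
next
  case False
  then have i: "i = n + 1" "q = n + 2" using assms q_cases by auto
  have "{..<q} = insert i {..n}" using i by auto
  then have "d i = - (\<Sum>j\<le>n. d j)" using sum_d[OF i(2)] i by (simp add: eq_neg_iff_add_eq_0)
  then show ?thesis unfolding H_eq by (auto intro!: span_neg span_sum intro: span_base)
qed

lemma span_d_subset_H: "i < q \<Longrightarrow> span {d i} \<subseteq> H"
  by (rule span_minimal) (simp_all add: d_in_H subspace_H)

lemma span_d: "span (d ` {..<q}) = H"
proof
  show "span (d ` {..<q}) \<subseteq> H" using d_in_H by (intro span_minimal subspace_H) auto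
  show "H \<subseteq> span (d ` {..<q})" unfolding H_eq using n_lt_q by (intro span_mono) auto
qed

text \<open>The relations among the \<open>d i\<close> are the multiples of the zero sum if
  \<open>q = n + 2\<close>, and only the trivial one if \<open>q = n + 1\<close>.\<close>

lemma d_relation:
  assumes "(\<Sum>i<q. scale (c i) (d i)) = 0"
  shows "i < q \<Longrightarrow> c i = c 0" and "q = n + 1 \<Longrightarrow> i < q \<Longrightarrow> c i = 0"
proof -
  have basis: "c i = 0" if "(\<Sum>i\<le>n. scale (c i) (d i)) = 0" "i \<le> n" for c :: "nat \<Rightarrow> 'f" and i
  proof -
    have "(\<Sum>v\<in>d ` {..n}. scale (c (the_inv_into {..n} d v)) v) = (\<Sum>i\<le>n. scale (c i) (d i))"
      by (subst sum.reindex[OF inj_d]) (auto simp: the_inv_into_f_f[OF inj_d] intro!: sum.cong)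
    with that have "c (the_inv_into {..n} d (d i)) = 0"
      by (intro independentD[OF indep_d _ order_refl, of "\<lambda>v. c (the_inv_into {..n} d v)"]) auto
    then show ?thesis using that by (simp add: the_inv_into_f_f[OF inj_d])
  qed
  have zero: "c j = 0" if "q = n + 1" "j < q" for j
    using basis[of c j] assms that by (simp add: lessThan_Suc_atMost)
  show "c i = 0" if "q = n + 1" "i < q" using zero that .
  show "c i = c 0" if "i < q"
  proof (cases "q = n + 1")
    case True
    then show ?thesis using zero[of i] zero[of 0] that by simp
  next
    case False
    then have q: "q = n + 2" using q_cases by auto
    \<comment> \<open>Subtracting a multiple of the zero sum removes the last vector and leaves a
      relation among basis vectors.\<close>
    have "(\<Sum>i<q. scale (c i - c (n + 1)) (d i)) = (\<Sum>i<q. scale (c i) (d i)) - scale (c (n + 1)) (\<Sum>i<q. d i)"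
      by (simp add: scale_left_diff_distrib sum_subtractf scale_sum_right)
    then have "(\<Sum>i\<le>n. scale (c i - c (n + 1)) (d i)) = 0"
      using assms sum_d[OF q] q by (simp add: lessThan_Suc_atMost)
    then have "c j = c (n + 1)" if "j \<le> n" for j
      using basis[of "\<lambda>i. c i - c (n + 1)" j] that by simp
    then show ?thesis using that q by (cases "i = n + 1") auto
  qed
qed

text \<open>This is where \<open>(n, q) \<noteq> (2, 4)\<close> is used: any at most four points of the arc are independent.\<close>

lemma d_independent:
  assumes "S \<subseteq> {..<q}" "card S \<le> 4" "(\<Sum>i\<in>S. scale (c i) (d i)) = 0" "i \<in> S"
  shows "c i = 0"
proof -
  have fin: "finite S" using assms(1) finite_subset by blast
  let ?c = "\<lambda>i. if i \<in> S then c i else 0"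
  have "(\<Sum>i<q. scale (?c i) (d i)) = (\<Sum>i\<in>S. scale (c i) (d i))"
    using assms(1) by (intro sum.mono_neutral_cong_right) auto
  then have 0: "(\<Sum>i<q. scale (?c i) (d i)) = 0" using assms(3) by simp
  show ?thesis
  proof (cases "S = {..<q}")
    \<comment> \<open>Here q is at most 4, which rules out \<open>q = n + 2\<close> because that
      case has \<open>n \<ge> 3\<close>.\<close>
    case True
    then have "q = n + 1" using assms(2) q_cases by auto
    from d_relation(2)[OF 0 this, of i] assms show ?thesis by auto
  next
    \<comment> \<open>All coefficients of a relation are equal, and the extension by 0 vanishes at
      an index outside S.\<close>
    case False
    then obtain j where j: "j < q" "j \<notin> S" using assms(1) by auto
    have "?c i = ?c j" using d_relation(1)[OF 0, of i] d_relation(1)[OF 0, of j] assms j by auto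
    then show ?thesis using j assms(4) by simp
  qed
qed

lemma d_pair:
  assumes "i < q" "j < q" "i \<noteq> j" "scale a (d i) = scale b (d j)"
  shows "a = 0" "b = 0"
proof -
  let ?c = "\<lambda>k. if k = i then a else - b"
  have 0: "(\<Sum>k\<in>{i, j}. scale (?c k) (d k)) = 0" using assms by simp
  have "?c i = 0" by (rule d_independent[OF _ _ 0]) (use assms in auto)
  then show "a = 0" by simp
  have "?c j = 0" by (rule d_independent[OF _ _ 0]) (use assms in auto)
  then show "b = 0" using assms(3) by simp
qed

lemma d_nonzero: "i < q \<Longrightarrow> d i \<noteq> 0"
  using d_independent[of "{i}" "\<lambda>_. 1" i] by auto

lemma d_notin_span:
  assumes "i < q" "j < q" "i \<noteq> j"
  shows "d i \<notin> span {d j}"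
proof
  assume "d i \<in> span {d j}"
  then obtain b where "scale 1 (d i) = scale b (d j)" by (auto simp: span_singleton)
  from d_pair(1)[OF assms this] show False by simp
qed

lemma inj_span_d: "inj_on (\<lambda>i. span {d i}) {..<q}"
proof (rule inj_onI)
  fix i j assume ij: "i \<in> {..<q}" "j \<in> {..<q}" "span {d i} = span {d j}"
  then have "d i \<in> span {d j}" using span_base[of "d i" "{d i}"] by simp
  then show "i = j" using d_notin_span ij by auto
qed

lemma finite_UNIV_v: "finite (UNIV :: 'v set)"
  using card_span_independent(1)[OF indep_frame] by (simp add: span_frame)

lemma finite_H: "finite H" by (rule finite_subset[OF subset_UNIV finite_UNIV_v])

lemma card_H: "card H = q ^ (n + 1)"
  using card_span_independent(2)[OF indep_d] by (simp add: H_eq card_field card_image[OF inj_d])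

lemma decompose: obtains a h where "h \<in> H" "v = scale a e + h"
proof -
  have "v \<in> span (insert e (d ` {..n}))" by (simp add: span_frame)
  then obtain a where "v - scale a e \<in> span (d ` {..n})" by (auto simp: span_insert)
  then show ?thesis using that[of "v - scale a e" a] by (simp add: H_eq)
qed

lemma decompose_unique:
  assumes "h \<in> H" "h' \<in> H" "scale a e + h = scale b e + h'"
  shows "a = b" "h = h'"
proof -
  have "scale (a - b) e = h' - h" using assms(3) by (simp add: scale_left_diff_distrib algebra_simps)
  then have m: "scale (a - b) e \<in> H" using assms subspace_H by (simp add: subspace_diff)
  show ab: "a = b"
  proof (rule ccontr)
    assume "a \<noteq> b"
    then have "scale (inverse (a - b)) (scale (a - b) e) = e" by simp
    then show False using subspace_scale[OF subspace_H m, of "inverse (a - b)"] e_notin_H by simp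
  qed
  then show "h = h'" using assms(3) by simp
qed

text \<open>The values at \<open>e\<close> and at the basis vectors can be prescribed freely. For
  \<open>q = n + 2\<close> the value at the last vector is then forced by the zero sum, and it is
  the desired one because the coefficients are constant and a permutation does not change the
  sum.\<close>

lemma exists_frame_map:
  assumes "field_automorphism \<sigma>" "\<pi> permutes {..<q}" "q = n + 2 \<Longrightarrow> \<forall>i<q. c i = c 0"
  shows "\<exists>\<phi>. semilinear_on UNIV \<sigma> \<phi> \<and> \<phi> e = w \<and> (\<forall>i<q. \<phi> (d i) = scale (c i) (d (\<pi> i)))"
proof -
  define f where "f = (\<lambda>b. if b = e then w else scale (c (the_inv_into {..n} d b)) (d (\<pi> (the_inv_into {..n} d b))))"
  obtain \<phi> where sl: "semilinear_on UNIV \<sigma> \<phi>" and f: "\<forall>b\<in>insert e (d ` {..n}). \<phi> b = f b"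
    using exists_semilinear[OF assms(1) indep_frame finite.insertI[OF finite_imageI[OF finite_atMost]] span_frame, of f]
    by (elim exE conjE)
  have e: "\<phi> e = w" using f by (simp add: f_def)
  have di: "\<phi> (d i) = scale (c i) (d (\<pi> i))" if "i \<le> n" for i
  proof -
    have "d i \<noteq> e" using d_in_H[of i] that n_lt_q e_notin_H by auto
    then show ?thesis using f that by (simp add: f_def the_inv_into_f_f[OF inj_d])
  qed
  have "\<phi> (d i) = scale (c i) (d (\<pi> i))" if "i < q" for i
  proof (cases "i \<le> n")
    case False
    then have q: "q = n + 2" and i: "i = n + 1" using that q_cases by auto
    have split: "{..<q} = insert i {..n}" using q i by auto
    have "(\<Sum>j<q. d (\<pi> j)) = (\<Sum>j<q. d j)"
      using sum.permute[OF assms(2), of d] by (simp add: comp_def)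
    then have "scale (c 0) (\<Sum>j<q. d (\<pi> j)) = 0" using sum_d[OF q] by simp
    moreover have "(\<Sum>j<q. scale (c j) (d (\<pi> j))) = (\<Sum>j<q. scale (c 0) (d (\<pi> j)))"
      using assms(3)[OF q] by (intro sum.cong) (metis lessThan_iff)+
    ultimately have "(\<Sum>j<q. scale (c j) (d (\<pi> j))) = 0"
      by (simp add: scale_sum_right)
    then have 1: "scale (c i) (d (\<pi> i)) + (\<Sum>j\<le>n. scale (c j) (d (\<pi> j))) = 0"
      unfolding split using i by simp
    have "\<phi> (\<Sum>j<q. d j) = 0" using sum_d[OF q] semilinear_on_zero[OF sl] by simp
    then have "\<phi> (d i) + (\<Sum>j\<le>n. \<phi> (d j)) = 0"
      unfolding split using i by (simp add: semilinear_on_sum[OF sl] semilinear_onD(2)[OF sl])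
    then have "\<phi> (d i) + (\<Sum>j\<le>n. scale (c j) (d (\<pi> j))) = 0" using di by simp
    with 1 show ?thesis by (metis add_right_cancel)
  qed (rule di)
  with sl e show ?thesis by (intro exI[of _ \<phi>]) simp
qed

text \<open>These maps are monomial with respect to the frame. The value at \<open>e\<close> is left
  open: it is \<open>e\<close> for lifts of collineations of H, and some vector outside H for
  collineations of the whole space.\<close>

definition frame_map :: "('f \<Rightarrow> 'f) \<Rightarrow> (nat \<Rightarrow> nat) \<Rightarrow> (nat \<Rightarrow> 'f) \<Rightarrow> ('v \<Rightarrow> 'v) \<Rightarrow> bool" where
  "frame_map \<sigma> \<pi> c \<phi> \<longleftrightarrow> semilinear_on UNIV \<sigma> \<phi> \<and> \<pi> permutes {..<q} \<and>
     (\<forall>i<q. c i \<noteq> 0 \<and> \<phi> (d i) = scale (c i) (d (\<pi> i)))"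

lemma frame_mapD:
  assumes "frame_map \<sigma> \<pi> c \<phi>"
  shows "semilinear_on UNIV \<sigma> \<phi>" "semilinear_on H \<sigma> \<phi>" "\<pi> permutes {..<q}"
    "i < q \<Longrightarrow> c i \<noteq> 0" "i < q \<Longrightarrow> \<phi> (d i) = scale (c i) (d (\<pi> i))" "i < q \<Longrightarrow> \<pi> i < q"
  using assms permutes_in_image[of \<pi> "{..<q}" i] semilinear_on_subset[of UNIV \<sigma> \<phi> H]
  by (auto simp: frame_map_def)

lemma frame_map_comp:
  assumes "frame_map \<sigma> \<pi> c \<phi>" "frame_map \<tau> \<rho> b \<psi>"
  shows "frame_map (\<sigma> \<circ> \<tau>) (\<pi> \<circ> \<rho>) (\<lambda>i. \<sigma> (b i) * c (\<rho> i)) (\<phi> \<circ> \<psi>)"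
  unfolding frame_map_def
proof (intro conjI allI impI)
  note 1 = frame_mapD[OF assms(1)] and 2 = frame_mapD[OF assms(2)]
  show "semilinear_on UNIV (\<sigma> \<circ> \<tau>) (\<phi> \<circ> \<psi>)" using semilinear_on_comp[OF 1(1) 2(1)] by simp
  show "\<pi> \<circ> \<rho> permutes {..<q}" using 1(3) 2(3) by (simp add: permutes_compose)
  fix i assume i: "i < q"
  show "\<sigma> (b i) * c (\<rho> i) \<noteq> 0"
    using 1(4)[OF 2(6)[OF i]] 2(4)[OF i] field_automorphismD(7)[OF semilinear_onD(1)[OF 1(1)]] by simp
  show "(\<phi> \<circ> \<psi>) (d i) = scale (\<sigma> (b i) * c (\<rho> i)) (d ((\<pi> \<circ> \<rho>) i))"
    using 1(5)[OF 2(6)[OF i]] 2(5)[OF i] semilinear_onD(3)[OF 1(1)] by simp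
qed

lemma frame_map_image_H:
  assumes "frame_map \<sigma> \<pi> c \<phi>"
  shows "\<phi> ` H = H"
proof -
  note f = frame_mapD[OF assms]
  have "\<phi> ` H = span (\<phi> ` d ` {..<q})"
    using semilinear_on_image_span[OF f(1), of "d ` {..<q}"] by (simp add: span_d)
  also have "\<dots> = H"
  proof
    show "span (\<phi> ` d ` {..<q}) \<subseteq> H"
      using f(5,6) d_in_H by (intro span_minimal subspace_H) (auto intro!: subspace_scale[OF subspace_H])
    have "d j \<in> span (\<phi> ` d ` {..<q})" if "j < q" for j
    proof -
      from that permutes_image[OF f(3)] obtain i where i: "i < q" "j = \<pi> i" by (metis imageE lessThan_iff)
      have "\<phi> (d i) \<in> span (\<phi> ` d ` {..<q})" using i by (auto intro: span_base)
      then have "scale (inverse (c i)) (\<phi> (d i)) \<in> span (\<phi> ` d ` {..<q})" by (rule span_scale)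
      then show ?thesis using f(4,5)[OF i(1)] i by simp
    qed
    then show "H \<subseteq> span (\<phi> ` d ` {..<q})" unfolding span_d[symmetric] by (intro span_minimal) auto
  qed
  finally show ?thesis .
qed

lemma frame_map_image_K:
  assumes "frame_map \<sigma> \<pi> c \<phi>"
  shows "(`) \<phi> ` K = K"
proof -
  note f = frame_mapD[OF assms]
  have 1: "\<phi> ` span {d i} = span {d (\<pi> i)}" if "i < q" for i
  proof -
    have "\<phi> ` span {d i} = span {scale (c i) (d (\<pi> i))}"
      using semilinear_on_image_span[OF f(1), of "{d i}"] f(5)[OF that] by simp
    also have "\<dots> = span {d (\<pi> i)}"
      using span_singleton_eq_iff[of "scale (c i) (d (\<pi> i))" "d (\<pi> i)"] f(4)[OF that] d_nonzero[OF f(6)[OF that]]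
      by auto
    finally show ?thesis .
  qed
  have "(`) \<phi> ` K = (\<lambda>i. span {d (\<pi> i)}) ` {..<q}"
    unfolding K_eq image_image using 1 by (intro image_cong) auto
  also have "\<dots> = (\<lambda>i. span {d i}) ` \<pi> ` {..<q}" by (simp add: image_image)
  also have "\<dots> = K" by (simp add: permutes_image[OF f(3)] K_eq)
  finally show ?thesis .
qed

lemma frame_map_bij_H:
  assumes "frame_map \<sigma> \<pi> c \<phi>"
  shows "bij_betw \<phi> H H" "semilinear_bij scale H \<phi>"
proof -
  show "bij_betw \<phi> H H"
    using frame_map_image_H[OF assms] finite_H by (simp add: bij_betw_def eq_card_imp_inj_on)
  then show "semilinear_bij scale H \<phi>"
    using frame_mapD(2)[OF assms] by (auto simp: semilinear_bij_iff)
qed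

lemma frame_map_bij_UNIV:
  assumes "frame_map \<sigma> \<pi> c \<phi>" "\<phi> e = scale a e + w" "a \<noteq> 0" "w \<in> H"
  shows "bij \<phi>" "semilinear_bij scale UNIV \<phi>"
proof -
  note f = frame_mapD[OF assms(1)]
  have im: "subspace (range \<phi>)" using semilinear_on_image_subspace[OF f(1)] by simp
  have H: "H \<subseteq> range \<phi>" using frame_map_image_H[OF assms(1)] by blast
  have "\<phi> e - w \<in> range \<phi>" using H assms(4) im by (auto intro!: subspace_diff)
  then have "scale (inverse a) (\<phi> e - w) \<in> range \<phi>" by (rule subspace_scale[OF im])
  then have e: "e \<in> range \<phi>" using assms(2,3) by simp
  have "surj \<phi>"
  proof -
    have "v \<in> range \<phi>" for v
    proof -
      obtain b h where "h \<in> H" "v = scale b e + h" by (rule decompose)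
      then show ?thesis using subspace_add[OF im subspace_scale[OF im e, of b], of h] H by auto
    qed
    then show ?thesis by blast
  qed
  then show "bij \<phi>" using finite_UNIV_v by (simp add: bij_def finite_UNIV_surj_inj)
  then show "semilinear_bij scale UNIV \<phi>" using f(1) by (auto simp: semilinear_bij_iff)
qed

section \<open>From collineations stabilising the arc to monomial coefficients\<close>

lemma K_points: "K \<subseteq> pg_points scale H"
proof
  fix x assume "x \<in> K"
  then obtain i where "i < q" "x = span {d i}" by (auto simp: K_eq)
  then show "x \<in> pg_points scale H"
    unfolding pg_points_iff[OF subspace_H] using d_in_H[of i] d_nonzero[of i] by (intro bexI[of _ "d i"]) auto
qed

lemma pg_points_mono: "pg_points scale H \<subseteq> pg_points scale UNIV"
  by (auto simp: pg_points_def)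

lemma frame_map_stab:
  assumes "frame_map \<sigma> \<pi> c \<phi>"
  shows "induced H \<phi> \<in> carrier stab_H"
    and "\<phi> e = scale a e + w \<Longrightarrow> a \<noteq> 0 \<Longrightarrow> w \<in> H \<Longrightarrow> induced UNIV \<phi> \<in> carrier stab_UNIV"
proof -
  have "induced H \<phi> ` K = (`) \<phi> ` K" "induced UNIV \<phi> ` K = (`) \<phi> ` K"
    using K_points pg_points_mono by (auto simp: induced_def intro!: image_cong)
  then show "induced H \<phi> \<in> carrier stab_H"
    "\<phi> e = scale a e + w \<Longrightarrow> a \<noteq> 0 \<Longrightarrow> w \<in> H \<Longrightarrow> induced UNIV \<phi> \<in> carrier stab_UNIV"
    using frame_map_image_K[OF assms] PGammaL_I[OF subspace_H frame_map_bij_H(2)[OF assms]]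
      PGammaL_I[OF subspace_UNIV frame_map_bij_UNIV(2)[OF assms]]
    by (simp_all add: PGammaL_simps)
qed

text \<open>A map that permutes the points of the arc sends each representative to a multiple of
  another one. For \<open>q = n + 2\<close> the image of the zero sum is a relation with these
  multiples as coefficients, and every relation has constant coefficients.\<close>

lemma stab_coefficients:
  assumes sl: "semilinear_on H \<sigma> \<phi>" and bij: "bij_betw \<phi> H H" and K: "\<And>x. x \<in> K \<Longrightarrow> \<phi> ` x \<in> K"
  obtains \<pi> c where "\<pi> permutes {..<q}" "\<forall>i<q. c i \<noteq> 0"
    "\<forall>i<q. \<phi> (d i) = scale (c i) (d (\<pi> i))" "q = n + 2 \<longrightarrow> (\<forall>i<q. c i = c 0)"
proof -
  have sb: "semilinear_bij scale H \<phi>" using sl bij by (auto simp: semilinear_bij_iff)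
  have "\<exists>j c. j < q \<and> c \<noteq> 0 \<and> \<phi> (d i) = scale c (d j)" if i: "i < q" for i
  proof -
    have "span {\<phi> (d i)} \<in> K"
      using K[of "span {d i}"] semilinear_bij_span(1)[OF sb subspace_H d_in_H[OF i]] i by (auto simp: K_eq)
    then obtain j where j: "j < q" "span {\<phi> (d i)} = span {d j}" by (auto simp: K_eq)
    moreover have "\<phi> (d i) \<noteq> 0"
      using semilinear_bij_span(3)[OF sb subspace_H d_in_H[OF i]] d_nonzero[OF i] by simp
    ultimately show ?thesis using span_singleton_eq_iff[of "\<phi> (d i)" "d j"] by auto
  qed
  then obtain p c where pc: "\<And>i. i < q \<Longrightarrow> p i < q \<and> c i \<noteq> 0 \<and> \<phi> (d i) = scale (c i) (d (p i))"
    by metis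
  define \<pi> where "\<pi> = (\<lambda>i. if i < q then p i else i)"
  have im: "\<phi> ` span {d i} = span {d (p i)}" if "i < q" for i
    using semilinear_bij_span[OF sb subspace_H d_in_H[OF that]] d_nonzero[OF that] pc[OF that]
      span_singleton_eq_iff[of "\<phi> (d i)" "d (p i)"] by auto
  have "inj_on p {..<q}"
  proof (rule inj_onI)
    fix i j assume ij: "i \<in> {..<q}" "j \<in> {..<q}" "p i = p j"
    then have "\<phi> ` span {d i} = \<phi> ` span {d j}" using im by simp
    moreover have "span {d i} \<subseteq> H" "span {d j} \<subseteq> H"
      using ij by (simp_all add: span_d_subset_H)
    ultimately have "span {d i} = span {d j}"
      using bij inj_on_image_eq_iff[of \<phi> H] by (auto simp: bij_betw_def)
    then show "i = j" using inj_span_d ij by (auto dest: inj_onD)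
  qed
  then have "inj_on \<pi> {..<q}" by (simp add: \<pi>_def inj_on_def)
  moreover have "\<pi> ` {..<q} \<subseteq> {..<q}" using pc by (auto simp: \<pi>_def)
  ultimately have "bij_betw \<pi> {..<q} {..<q}"
    by (simp add: bij_betw_def endo_inj_surj)
  then have perm: "\<pi> permutes {..<q}" by (rule bij_imp_permutes) (simp add: \<pi>_def)
  have phi: "\<phi> (d i) = scale (c i) (d (\<pi> i))" if "i < q" for i using pc that by (simp add: \<pi>_def)
  have "q = n + 2 \<Longrightarrow> \<forall>i<q. c i = c 0"
  proof -
    assume q: "q = n + 2"
    let ?r = "inv' \<pi>"
    have r: "?r permutes {..<q}" using perm by (rule permutes_inv)
    have "(\<Sum>i<q. scale (c i) (d (\<pi> i))) = (\<Sum>i<q. \<phi> (d i))"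
      by (rule sum.cong) (simp_all add: phi)
    also have "\<dots> = \<phi> (\<Sum>i<q. d i)"
      by (rule semilinear_on_sum[OF sl subspace_H, symmetric]) (simp add: d_in_H)
    also have "\<dots> = 0" using sum_d[OF q] semilinear_on_zero[OF sl subspace_H] by simp
    finally have "(\<Sum>i<q. scale (c i) (d (\<pi> i))) = 0" .
    \<comment> \<open>Reindexing by the inverse permutation puts the relation into the form that
      \<open>d_relation\<close> expects.\<close>
    also have "(\<Sum>i<q. scale (c i) (d (\<pi> i))) = (\<Sum>i<q. scale (c (?r i)) (d i))"
      by (subst sum.permute[OF perm]) (simp add: permutes_inverses[OF perm])
    finally have 0: "(\<Sum>i<q. scale (c (?r i)) (d i)) = 0" .
    have "c i = c (?r 0)" if "i < q" for i
    proof -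
      have "\<pi> i < q" using permutes_in_image[OF perm, of i] that by simp
      with d_relation(1)[OF 0, of "\<pi> i"] show ?thesis by (simp add: permutes_inverses[OF perm])
    qed
    note const = this
    show "\<forall>i<q. c i = c 0"
    proof (intro allI impI)
      fix i assume "i < q"
      then show "c i = c 0" using const[of i] const[of 0] n_lt_q by simp
    qed
  qed
  then have adm: "q = n + 2 \<longrightarrow> (\<forall>i<q. c i = c 0)" by (rule impI)
  have nz: "\<forall>i<q. c i \<noteq> 0" using pc by simp
  have "\<forall>i<q. \<phi> (d i) = scale (c i) (d (\<pi> i))" using phi by simp
  from that[OF perm nz this adm] show ?thesis .
qed

text \<open>The lift is defined on the whole space and fixes \<open>e\<close>, so that collineations
  of H and of the ambient space share the calculus of \<open>frame_map\<close>.\<close>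

lemma stab_H_E:
  assumes "g \<in> carrier stab_H"
  obtains \<sigma> \<pi> c \<phi> where "frame_map \<sigma> \<pi> c \<phi>" "\<phi> e = e" "g = induced H \<phi>"
proof -
  have g: "g \<in> carrier (PGammaL scale H)" "g ` K = K" using assms by (auto simp: PGammaL_simps)
  from g(1) subspace_H obtain \<phi> where \<phi>: "semilinear_bij scale H \<phi>" "g = induced H \<phi>" by (rule PGammaL_E)
  then obtain \<sigma> where sl: "semilinear_on H \<sigma> \<phi>" and bij: "bij_betw \<phi> H H" by (auto simp: semilinear_bij_iff)
  have K: "\<phi> ` x \<in> K" if "x \<in> K" for x
  proof -
    have "g x = \<phi> ` x" using K_points that by (auto simp: \<phi>(2) induced_def)
    then show ?thesis using g(2) imageI[OF that, of g] by simp
  qed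
  obtain \<pi> c where pc: "\<pi> permutes {..<q}" "\<forall>i<q. c i \<noteq> 0"
    "\<forall>i<q. \<phi> (d i) = scale (c i) (d (\<pi> i))" "q = n + 2 \<longrightarrow> (\<forall>i<q. c i = c 0)"
    by (rule stab_coefficients[OF sl bij K])
  have "\<exists>\<psi>. semilinear_on UNIV \<sigma> \<psi> \<and> \<psi> e = e \<and> (\<forall>i<q. \<psi> (d i) = scale (c i) (d (\<pi> i)))"
    by (rule exists_frame_map[OF semilinear_onD(1)[OF sl] pc(1)]) (rule mp[OF pc(4)])
  then obtain \<psi> where psi: "semilinear_on UNIV \<sigma> \<psi>" "\<psi> e = e" "\<forall>i<q. \<psi> (d i) = scale (c i) (d (\<pi> i))"
    by (elim exE conjE)
  then have f: "frame_map \<sigma> \<pi> c \<psi>" using pc by (simp add: frame_map_def)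
  have "\<phi> b = \<psi> b" if "b \<in> d ` {..<q}" for b
    using that psi(3) pc(3) by auto
  then have "\<phi> x = \<psi> x" if "x \<in> H" for x
    using semilinear_on_eq[of "d ` {..<q}" \<sigma> \<phi> \<psi> x] sl frame_mapD(2)[OF f] that
    by (simp add: span_d)
  then have "g = induced H \<psi>" using induced_cong[of H \<phi> \<psi>] \<phi>(2) by simp
  with f psi(2) show ?thesis by (rule that)
qed

lemma stab_UNIV_E:
  assumes "g \<in> carrier stab_UNIV"
  obtains \<sigma> \<pi> c \<phi> a w where "frame_map \<sigma> \<pi> c \<phi>" "\<phi> e = scale a e + w" "a \<noteq> 0" "w \<in> H" "g = induced UNIV \<phi>"
proof -
  have g: "g \<in> carrier (PGammaL scale UNIV)" "g ` K = K" using assms by (auto simp: PGammaL_simps)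
  from g(1) subspace_UNIV obtain \<phi> where \<phi>: "semilinear_bij scale UNIV \<phi>" "g = induced UNIV \<phi>" by (rule PGammaL_E)
  then obtain \<sigma> where sl: "semilinear_on UNIV \<sigma> \<phi>" and bij: "bij \<phi>" by (auto simp: semilinear_bij_iff)
  have K: "\<phi> ` x \<in> K" if "x \<in> K" for x
  proof -
    have "g x = \<phi> ` x" using K_points pg_points_mono that by (auto simp: \<phi>(2) induced_def)
    then show ?thesis using g(2) imageI[OF that, of g] by simp
  qed
  \<comment> \<open>A collineation of the whole space that preserves the arc preserves H, because
    the arc spans H.\<close>
  have "\<phi> (d i) \<in> H" if "i < q" for i
  proof -
    have "\<phi> ` span {d i} \<in> K" using that by (intro K) (auto simp: K_eq)
    then have "\<phi> ` span {d i} \<subseteq> H" using K_points by (auto simp: pg_points_def)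
    then show ?thesis using span_base[of "d i" "{d i}"] by auto
  qed
  then have "span (\<phi> ` d ` {..<q}) \<subseteq> H" by (intro span_minimal subspace_H) auto
  then have "\<phi> ` H \<subseteq> H" using semilinear_on_image_span[OF sl, of "d ` {..<q}"] by (simp add: span_d)
  moreover have inj: "inj_on \<phi> H" by (rule inj_on_subset[OF bij_is_inj[OF bij] subset_UNIV])
  ultimately have H: "bij_betw \<phi> H H" using endo_inj_surj[OF finite_H] by (simp add: bij_betw_def)
  obtain \<pi> c where pc: "\<pi> permutes {..<q}" "\<forall>i<q. c i \<noteq> 0"
    "\<forall>i<q. \<phi> (d i) = scale (c i) (d (\<pi> i))"
    by (rule stab_coefficients[OF semilinear_on_subset[OF sl subset_UNIV] H K])
  then have f: "frame_map \<sigma> \<pi> c \<phi>" using sl by (simp add: frame_map_def)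
  obtain a w where aw: "w \<in> H" "\<phi> e = scale a e + w" by (rule decompose)
  have "a \<noteq> 0"
  proof
    assume "a = 0"
    then have "\<phi> e \<in> \<phi> ` H" using aw H by (simp add: bij_betw_def)
    then obtain x where "x \<in> H" "\<phi> e = \<phi> x" by (elim imageE)
    then show False using injD[OF bij_is_inj[OF bij], of e x] e_notin_H by simp
  qed
  from that[OF f aw(2) this aw(1) \<phi>(2)] show ?thesis .
qed

end

section \<open>Monomial matrices\<close>

text \<open>The only entry of column j stands in row \<open>\<pi> j\<close>. With this convention
  the product of matrices follows the composition rule of \<open>frame_map\<close> for the trivial
  field automorphism.\<close>

definition monom_mat :: "nat \<Rightarrow> (nat \<Rightarrow> 'a::field) \<Rightarrow> (nat \<Rightarrow> nat) \<Rightarrow> 'a mat" where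
  "monom_mat m c \<pi> = mat m m (\<lambda>(i, j). if i = \<pi> j then c j else 0)"

lemma monom_mat_dim [simp]: "monom_mat m c \<pi> \<in> carrier_mat m m"
  by (simp add: monom_mat_def)

lemma monom_mat_index: "i < m \<Longrightarrow> j < m \<Longrightarrow> monom_mat m c \<pi> $$ (i, j) = (if i = \<pi> j then c j else 0)"
  by (simp add: monom_mat_def)

lemma monom_mat_cong:
  "(\<And>j. j < m \<Longrightarrow> c j = b j \<and> \<pi> j = \<rho> j) \<Longrightarrow> monom_mat m c \<pi> = monom_mat m b \<rho>"
  by (rule eq_matI) (auto simp: monom_mat_def)

lemma monom_mat_one: "monom_mat m (\<lambda>_. k) id = k \<cdot>\<^sub>m 1\<^sub>m m"
  by (rule eq_matI) (auto simp: monom_mat_def)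

lemma one_mat_eq_monom_mat: "1\<^sub>m m = monom_mat m (\<lambda>_. 1) id"
  by (rule eq_matI) (auto simp: monom_mat_def)

lemma monom_mat_mult:
  assumes "\<rho> permutes {..<m}"
  shows "monom_mat m c \<pi> * monom_mat m b \<rho> = monom_mat m (\<lambda>j. b j * c (\<rho> j)) (\<pi> \<circ> \<rho>)"
proof (rule eq_matI)
  fix i j assume "i < dim_row (monom_mat m (\<lambda>j. b j * c (\<rho> j)) (\<pi> \<circ> \<rho>))"
    "j < dim_col (monom_mat m (\<lambda>j. b j * c (\<rho> j)) (\<pi> \<circ> \<rho>))"
  then have ij: "i < m" "j < m" by (simp_all add: monom_mat_def)
  have rj: "\<rho> j < m" using permutes_in_image[OF assms, of j] ij by simp
  have "(monom_mat m c \<pi> * monom_mat m b \<rho>) $$ (i, j)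
      = (\<Sum>k = 0..<m. monom_mat m c \<pi> $$ (i, k) * monom_mat m b \<rho> $$ (k, j))"
    using ij by (simp add: monom_mat_def scalar_prod_def)
  also have "\<dots> = (\<Sum>k = 0..<m. if k = \<rho> j then monom_mat m c \<pi> $$ (i, k) * b j else 0)"
    using ij by (intro sum.cong) (auto simp: monom_mat_index)
  also have "\<dots> = monom_mat m c \<pi> $$ (i, \<rho> j) * b j" using rj by simp
  also have "\<dots> = monom_mat m (\<lambda>j. b j * c (\<rho> j)) (\<pi> \<circ> \<rho>) $$ (i, j)"
    using ij rj by (simp add: monom_mat_index)
  finally show "(monom_mat m c \<pi> * monom_mat m b \<rho>) $$ (i, j)
    = monom_mat m (\<lambda>j. b j * c (\<rho> j)) (\<pi> \<circ> \<rho>) $$ (i, j)" .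
qed (simp_all add: monom_mat_def)

lemma monom_mat_eqD:
  assumes eq: "monom_mat m c \<pi> = monom_mat m b \<rho>" and "\<pi> permutes {..<m}" and "\<forall>j<m. c j \<noteq> 0"
    and j: "j < m"
  shows "c j = b j" "\<pi> j = \<rho> j"
proof -
  have "\<pi> j < m" using permutes_in_image[OF assms(2), of j] j by simp
  then have "monom_mat m c \<pi> $$ (\<pi> j, j) = c j" "monom_mat m b \<rho> $$ (\<pi> j, j) = (if \<pi> j = \<rho> j then b j else 0)"
    using j by (simp_all add: monom_mat_index)
  then have 1: "c j = (if \<pi> j = \<rho> j then b j else 0)" by (simp only: eq)
  have "c j \<noteq> 0" using assms(3) j by simp
  with 1 show "\<pi> j = \<rho> j" by (cases "\<pi> j = \<rho> j") simp_all
  with 1 show "c j = b j" by simp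
qed

lemma carrier_Mon:
  "carrier (Mon m :: 'a::field mat monoid) = {monom_mat m c \<pi> | c \<pi>. \<pi> permutes {..<m} \<and> (\<forall>j<m. c j \<noteq> 0)}"
proof (rule Set.set_eqI, rule iffI)
  fix A :: "'a mat" assume "A \<in> carrier (Mon m)"
  then have "monomial_mat m A" by (simp add: Mon_def)
  note mon = this[unfolded monomial_mat_def]
  from mon have A: "A \<in> carrier_mat m m" ..
  have row: "\<exists>!j. j < m \<and> A $$ (i, j) \<noteq> 0" if "i < m" for i
    using mon[THEN conjunct2, THEN conjunct1, THEN spec, THEN mp, OF that] .
  have col: "\<exists>!i. i < m \<and> A $$ (i, j) \<noteq> 0" if "j < m" for j
    using mon[THEN conjunct2, THEN conjunct2, THEN spec, THEN mp, OF that] .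
  \<comment> \<open>The column condition gives the row of the only nonzero entry; the row condition
    will make this assignment injective.\<close>
  define \<pi> where "\<pi> j = (if j < m then (THE i. i < m \<and> A $$ (i, j) \<noteq> 0) else j)" for j
  have pi: "\<pi> j < m \<and> A $$ (\<pi> j, j) \<noteq> 0" if "j < m" for j
    using theI'[OF col[OF that]] that by (simp add: \<pi>_def)
  have pi_eq: "i = \<pi> j" if "j < m" "i < m" "A $$ (i, j) \<noteq> 0" for i j
    using the1_equality[OF col[OF that(1)], of i] that by (simp add: \<pi>_def)
  have "inj_on \<pi> {..<m}"
  proof (rule inj_onI)
    fix j k assume jk: "j \<in> {..<m}" "k \<in> {..<m}" "\<pi> j = \<pi> k"
    then have "\<pi> j < m" "j < m \<and> A $$ (\<pi> j, j) \<noteq> 0" "k < m \<and> A $$ (\<pi> j, k) \<noteq> 0"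
      using pi[of j] pi[of k] by simp_all
    then show "j = k"
      using the1_equality[OF row[of "\<pi> j"], of j] the1_equality[OF row[of "\<pi> j"], of k] by simp
  qed
  moreover have "\<pi> ` {..<m} \<subseteq> {..<m}" using pi by auto
  ultimately have "bij_betw \<pi> {..<m} {..<m}" by (simp add: bij_betw_def endo_inj_surj)
  then have perm: "\<pi> permutes {..<m}" by (rule bij_imp_permutes) (simp add: \<pi>_def)
  have "A = monom_mat m (\<lambda>j. A $$ (\<pi> j, j)) \<pi>"
  proof (rule eq_matI)
    fix i j assume "i < dim_row (monom_mat m (\<lambda>j. A $$ (\<pi> j, j)) \<pi>)" "j < dim_col (monom_mat m (\<lambda>j. A $$ (\<pi> j, j)) \<pi>)"
    then have "i < m" "j < m" by (simp_all add: monom_mat_def)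
    then show "A $$ (i, j) = monom_mat m (\<lambda>j. A $$ (\<pi> j, j)) \<pi> $$ (i, j)"
      using pi_eq[of j i] by (auto simp: monom_mat_index)
  qed (use A in \<open>auto simp: monom_mat_def\<close>)
  moreover have "\<forall>j<m. A $$ (\<pi> j, j) \<noteq> 0" using pi by simp
  ultimately show "A \<in> {monom_mat m c \<pi> | c \<pi>. \<pi> permutes {..<m} \<and> (\<forall>j<m. c j \<noteq> 0)}"
    using perm by (intro CollectI exI conjI)
next
  fix A :: "'a mat" assume "A \<in> {monom_mat m c \<pi> | c \<pi>. \<pi> permutes {..<m} \<and> (\<forall>j<m. c j \<noteq> 0)}"
  then obtain c \<pi> where A: "A = monom_mat m c \<pi>" and perm: "\<pi> permutes {..<m}" and c: "\<forall>j<m. c j \<noteq> 0"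
    by (elim CollectE exE conjE)
  \<comment> \<open>Column j of the inverse matrix carries the inverse of the nonzero entry in row j
    of \<open>A\<close>.\<close>
  let ?r = "inv' \<pi>" and ?b = "\<lambda>j. inverse (c (inv' \<pi> j))"
  have r: "?r permutes {..<m}" using perm by (rule permutes_inv)
  have pm: "\<pi> j < m" "?r j < m" if "j < m" for j
    using permutes_in_image[OF perm, of j] permutes_in_image[OF r, of j] that by simp_all
  have inv: "\<pi> (?r j) = j" "?r (\<pi> j) = j" for j using permutes_inverses[OF perm] by simp_all
  have entry: "A $$ (i, j) \<noteq> 0 \<longleftrightarrow> i = \<pi> j" if "i < m" "j < m" for i j
    using that c by (simp add: A monom_mat_index)
  have "monomial_mat m A"
    unfolding monomial_mat_def
  proof (intro conjI allI impI)
    show "A \<in> carrier_mat m m" by (simp add: A)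
    fix i assume i: "i < m"
    show "\<exists>!j. j < m \<and> A $$ (i, j) \<noteq> 0"
    proof (rule ex1I[of _ "?r i"])
      show "?r i < m \<and> A $$ (i, ?r i) \<noteq> 0" using i pm(2)[OF i] by (simp add: entry inv)
      fix j assume "j < m \<and> A $$ (i, j) \<noteq> 0"
      then show "j = ?r i" using i entry[of i j] inv(2)[of j] by simp
    qed
  next
    fix j assume j: "j < m"
    show "\<exists>!i. i < m \<and> A $$ (i, j) \<noteq> 0"
    proof (rule ex1I[of _ "\<pi> j"])
      show "\<pi> j < m \<and> A $$ (\<pi> j, j) \<noteq> 0" using j pm(1)[OF j] by (simp add: entry)
      fix i assume "i < m \<and> A $$ (i, j) \<noteq> 0"
      then show "i = \<pi> j" using j entry[of i j] by simp
    qed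
  qed
  moreover have "invertible_mat A"
  proof -
    have 1: "A * monom_mat m ?b ?r = 1\<^sub>m m"
      unfolding A monom_mat_mult[OF r] one_mat_eq_monom_mat
      by (rule monom_mat_cong) (use c pm inv in simp)
    have 2: "monom_mat m ?b ?r * A = 1\<^sub>m m"
      unfolding A monom_mat_mult[OF perm] one_mat_eq_monom_mat
      by (rule monom_mat_cong) (use c inv in simp)
    have "dim_row A = m" "dim_col A = m" "dim_row (monom_mat m ?b ?r) = m"
      by (simp_all add: A monom_mat_def)
    with 1 2 show ?thesis
      unfolding invertible_mat_def inverts_mat_def by (intro conjI exI[of _ "monom_mat m ?b ?r"]) simp_all
  qed
  ultimately show "A \<in> carrier (Mon m)" by (simp add: Mon_def)
qed

lemma monom_mat_in_Mon:
  "\<pi> permutes {..<m} \<Longrightarrow> \<forall>j<m. c j \<noteq> 0 \<Longrightarrow> monom_mat m c \<pi> \<in> carrier (Mon m)"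
  unfolding carrier_Mon by (intro CollectI exI conjI) simp_all

lemma group_Mon: "group (Mon m :: 'a::field mat monoid)"
proof (rule groupI)
  note mult = monom_mat_mult
  note one = one_mat_eq_monom_mat[where 'a = 'a]
  show "\<one>\<^bsub>Mon m\<^esub> \<in> carrier (Mon m :: 'a mat monoid)"
    using monom_mat_in_Mon[OF permutes_id, of m "\<lambda>_. 1 :: 'a"] one[of m] by (simp add: Mon_def)
  fix x :: "'a mat" assume "x \<in> carrier (Mon m)"
  then obtain c \<pi> where x: "x = monom_mat m c \<pi>" "\<pi> permutes {..<m}" "\<forall>j<m. c j \<noteq> 0"
    unfolding carrier_Mon by (elim CollectE exE conjE)
  then show "\<one>\<^bsub>Mon m\<^esub> \<otimes>\<^bsub>Mon m\<^esub> x = x"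
    using left_mult_one_mat[OF monom_mat_dim, of m c \<pi>] by (simp add: Mon_def)
  let ?r = "inv' \<pi>"
  have r: "?r permutes {..<m}" using x(2) by (rule permutes_inv)
  have rm: "?r j < m" if "j < m" for j using permutes_in_image[OF r, of j] that by simp
  have pm: "\<pi> j < m" if "j < m" for j using permutes_in_image[OF x(2), of j] that by simp
  have "monom_mat m (\<lambda>j. inverse (c (?r j))) ?r * x = 1\<^sub>m m"
    unfolding x(1) mult[OF x(2)] one using x(3) pm permutes_inverses[OF x(2)]
    by (intro monom_mat_cong) simp
  then show "\<exists>y\<in>carrier (Mon m). y \<otimes>\<^bsub>Mon m\<^esub> x = \<one>\<^bsub>Mon m\<^esub>"
    using r x(3) rm
    by (intro bexI[of _ "monom_mat m (\<lambda>j. inverse (c (?r j))) ?r"]) (simp_all add: monom_mat_in_Mon, simp add: Mon_def)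
  fix y :: "'a mat" assume "y \<in> carrier (Mon m)"
  then obtain b \<rho> where y: "y = monom_mat m b \<rho>" "\<rho> permutes {..<m}" "\<forall>j<m. b j \<noteq> 0"
    unfolding carrier_Mon by (elim CollectE exE conjE)
  have "\<rho> j < m" if "j < m" for j using permutes_in_image[OF y(2), of j] that by simp
  then show "x \<otimes>\<^bsub>Mon m\<^esub> y \<in> carrier (Mon m)"
    using x y monom_mat_in_Mon[of "\<pi> \<circ> \<rho>" m "\<lambda>j. b j * c (\<rho> j)"]
    by (simp add: mult permutes_compose) (simp add: Mon_def mult)
  fix z :: "'a mat" assume "z \<in> carrier (Mon m)"
  then have "z \<in> carrier_mat m m" by (auto simp: Mon_def monomial_mat_def)
  then show "x \<otimes>\<^bsub>Mon m\<^esub> y \<otimes>\<^bsub>Mon m\<^esub> z = x \<otimes>\<^bsub>Mon m\<^esub> (y \<otimes>\<^bsub>Mon m\<^esub> z)"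
    unfolding x(1) y(1) using assoc_mult_mat[OF monom_mat_dim monom_mat_dim, of z m] by (simp add: Mon_def)
qed

lemma order_Mon:
  assumes "card (UNIV :: 'a::finite_field set) = q"
  shows "order (Mon m :: 'a mat monoid) = (q - 1) ^ m * fact m"
proof -
  \<comment> \<open>Coefficient functions are taken extensional on \<open>{..<m}\<close>, so that a
    matrix determines its pair and is counted once.\<close>
  let ?D = "(PiE {..<m} (\<lambda>_. UNIV - {0 :: 'a})) \<times> {\<pi>. \<pi> permutes {..<m}}"
  let ?f = "\<lambda>(c, \<pi>). monom_mat m c \<pi>"
  have "inj_on ?f ?D"
  proof (rule inj_onI, clarsimp)
    fix c b :: "nat \<Rightarrow> 'a" and \<pi> \<rho>
    assume A: "c \<in> {..<m} \<rightarrow>\<^sub>E UNIV - {0}" "\<pi> permutes {..<m}" "b \<in> {..<m} \<rightarrow>\<^sub>E UNIV - {0}"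
      "\<rho> permutes {..<m}" "monom_mat m c \<pi> = monom_mat m b \<rho>"
    have "\<forall>j<m. c j \<noteq> 0" using A(1) by auto
    note D = monom_mat_eqD[OF A(5) A(2) this]
    have "c = b" using D(1) by (intro PiE_ext[OF A(1,3)]) simp
    moreover have "\<pi> = \<rho>"
    proof
      fix j show "\<pi> j = \<rho> j"
        using D(2)[of j] permutes_not_in[OF A(2), of j] permutes_not_in[OF A(4), of j] by (cases "j < m") auto
    qed
    ultimately show "c = b \<and> \<pi> = \<rho>" by simp
  qed
  moreover have "?f ` ?D = carrier (Mon m)"
  proof
    show "?f ` ?D \<subseteq> carrier (Mon m)" unfolding carrier_Mon by auto
    show "carrier (Mon m) \<subseteq> ?f ` ?D"
    proof
      fix A :: "'a mat" assume "A \<in> carrier (Mon m)"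
      then obtain c \<pi> where A: "A = monom_mat m c \<pi>" "\<pi> permutes {..<m}" "\<forall>j<m. c j \<noteq> 0"
        unfolding carrier_Mon by (elim CollectE exE conjE)
      have "A = ?f (restrict c {..<m}, \<pi>)" unfolding A(1) prod.case by (rule monom_mat_cong) simp
      moreover have "(restrict c {..<m}, \<pi>) \<in> ?D" using A(2,3) by simp
      ultimately show "A \<in> ?f ` ?D" by (rule image_eqI)
    qed
  qed
  ultimately have "order (Mon m :: 'a mat monoid) = card ?D"
    unfolding Coset.order_def using card_image[of ?f ?D] by simp
  also have "\<dots> = (q - 1) ^ m * fact m"
    using assms by (simp add: card_cartesian_product card_PiE card_permutations card_Diff_subset)
  finally show ?thesis .
qed

section \<open>The stabilisers of the arc\<close>

context arc_frame
begin

lemma d_01: "d 0 \<in> H" "d 1 \<in> H" "d 0 \<noteq> 0" "d 1 \<notin> span {d 0}"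
  using q_gt_2 d_in_H[of 0] d_in_H[of 1] d_nonzero[of 0] d_notin_span[of 1 0] by simp_all

lemma frame_map_cong:
  assumes "frame_map \<sigma> \<pi> c \<phi>" "frame_map \<sigma> \<rho> b \<psi>" "\<And>i. i < q \<Longrightarrow> \<pi> i = \<rho> i \<and> c i = b i" "x \<in> H"
  shows "\<phi> x = \<psi> x"
proof -
  have "\<phi> v = \<psi> v" if "v \<in> d ` {..<q}" for v
    using that assms(3) frame_mapD(5)[OF assms(1)] frame_mapD(5)[OF assms(2)] by auto
  then show ?thesis
    using semilinear_on_eq[of "d ` {..<q}" \<sigma> \<phi> \<psi> x] frame_mapD(2)[OF assms(1)] frame_mapD(2)[OF assms(2)] assms(4)
    by (simp add: span_d)
qed

lemma frame_map_eq:
  assumes "frame_map \<sigma> \<pi> c \<phi>" "frame_map \<sigma> \<rho> b \<psi>" "\<And>i. i < q \<Longrightarrow> \<pi> i = \<rho> i \<and> c i = b i" "\<phi> e = \<psi> e"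
  shows "\<phi> = \<psi>"
proof
  fix v
  obtain a h where v: "h \<in> H" "v = scale a e + h" by (rule decompose)
  then show "\<phi> v = \<psi> v"
    using frame_map_cong[OF assms(1-3) v(1)] assms(4)
      semilinear_onD(2,3)[OF frame_mapD(1)[OF assms(1)]] semilinear_onD(2,3)[OF frame_mapD(1)[OF assms(2)]]
    by simp
qed

lemma induced_H_eqD:
  assumes "frame_map \<sigma> \<pi> c \<phi>" "frame_map \<tau> \<rho> b \<psi>" "induced H \<phi> = induced H \<psi>"
  shows "\<sigma> = \<tau>" "\<exists>k. k \<noteq> 0 \<and> (\<forall>i<q. \<pi> i = \<rho> i \<and> c i = k * b i)"
proof -
  note f = frame_mapD[OF assms(1)] and g = frame_mapD[OF assms(2)]
  have *: "\<sigma> = \<tau> \<and> (\<exists>k. k \<noteq> 0 \<and> (\<forall>x\<in>H. \<phi> x = scale k (\<psi> x)))"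
    by (rule induced_eqD[OF subspace_H d_01 f(2) frame_map_bij_H(1)[OF assms(1)]
        g(2) frame_map_bij_H(1)[OF assms(2)] assms(3)])
  then show "\<sigma> = \<tau>" ..
  from * obtain k where k: "k \<noteq> 0" "\<forall>x\<in>H. \<phi> x = scale k (\<psi> x)" by (elim conjE exE)
  have "\<pi> i = \<rho> i \<and> c i = k * b i" if i: "i < q" for i
  proof -
    have 1: "scale (c i) (d (\<pi> i)) = scale (k * b i) (d (\<rho> i))"
      using bspec[OF k(2) d_in_H[OF i]] f(5)[OF i] g(5)[OF i] by simp
    have 2: "\<pi> i = \<rho> i"
    proof (rule ccontr)
      assume "\<pi> i \<noteq> \<rho> i"
      from d_pair(1)[OF f(6)[OF i] g(6)[OF i] this 1] f(4)[OF i] show False by simp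
    qed
    with 1 d_nonzero[OF g(6)[OF i]] show ?thesis by simp
  qed
  with k(1) show "\<exists>k. k \<noteq> 0 \<and> (\<forall>i<q. \<pi> i = \<rho> i \<and> c i = k * b i)" by (intro exI[of _ k]) simp
qed

text \<open>This homology with centre \<open>e\<close> and axis H acts trivially on the points of H.
  Composing with it changes the coefficients of a lift but neither the induced collineation of H nor
  the image of \<open>e\<close> when that is \<open>e\<close>.\<close>

lemma exists_dilation:
  assumes "k \<noteq> 0"
  shows "\<exists>\<phi>. frame_map id id (\<lambda>_. k) \<phi> \<and> \<phi> e = e \<and> (\<forall>x\<in>H. \<phi> x = scale k x)"
proof -
  have "\<exists>\<phi>. semilinear_on UNIV id \<phi> \<and> \<phi> e = e \<and> (\<forall>i<q. \<phi> (d i) = scale k (d (id i)))"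
    by (rule exists_frame_map[OF field_automorphism_id permutes_id]) simp
  then obtain \<phi> where p: "semilinear_on UNIV id \<phi>" "\<phi> e = e" "\<forall>i<q. \<phi> (d i) = scale k (d i)"
    by (elim exE conjE) simp
  have f: "frame_map id id (\<lambda>_. k) \<phi>" using p assms by (simp add: frame_map_def permutes_id)
  have "semilinear_on H id (\<lambda>x. scale k x)"
    by (simp add: semilinear_on_def field_automorphism_id scale_right_distrib mult.commute)
  then have "\<phi> x = scale k x" if "x \<in> H" for x
    using semilinear_on_eq[of "d ` {..<q}" id \<phi> "scale k" x] frame_mapD(2)[OF f] that p(3)
    by (auto simp: span_d)
  with f p(2) show ?thesis by (intro exI[of _ \<phi>]) simp
qed

lemma frame_map_rescale:
  assumes f: "frame_map \<sigma> \<pi> c \<phi>" and e: "\<phi> e = e" and k: "k \<noteq> 0"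
  shows "\<exists>\<psi>. frame_map \<sigma> \<pi> (\<lambda>i. c i * k) \<psi> \<and> \<psi> e = e \<and> induced H \<psi> = induced H \<phi>"
proof -
  obtain \<theta> where t: "frame_map id id (\<lambda>_. k) \<theta>" "\<theta> e = e" "\<forall>x\<in>H. \<theta> x = scale k x"
    using exists_dilation[OF k] by (elim exE conjE)
  have "frame_map \<sigma> \<pi> (\<lambda>i. c i * k) (\<theta> \<circ> \<phi>)" using frame_map_comp[OF t(1) f] by simp
  moreover have "(\<theta> \<circ> \<phi>) e = e" using t e by simp
  moreover have "induced H (\<theta> \<circ> \<phi>) = induced H \<phi>"
  proof -
    have "(\<theta> \<circ> \<phi>) x = scale k (\<phi> x)" if "x \<in> H" for x
      using frame_map_image_H[OF f] t(3) that by auto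
    then have "induced H (\<theta> \<circ> \<phi>) = induced H (\<lambda>x. scale k (\<phi> x))" by (rule induced_cong)
    also have "\<dots> = induced H \<phi>" by (rule induced_scale(2)[OF k frame_map_bij_H(2)[OF f] subspace_H])
    finally show ?thesis .
  qed
  ultimately show ?thesis by (intro exI[of _ "\<theta> \<circ> \<phi>"] conjI)
qed

text \<open>\<open>stab_coefficients\<close> yields some monomial description with constant
  coefficients; distinct \<open>d i\<close> are independent, so it coincides with the given
  one.\<close>

lemma frame_map_coeff_const:
  assumes f: "frame_map \<sigma> \<pi> c \<phi>" and q: "q = n + 2" and i: "i < q"
  shows "c i = c 0"
proof -
  have K: "\<phi> ` x \<in> K" if "x \<in> K" for x using frame_map_image_K[OF f] that by blast
  obtain \<rho> b where b: "\<rho> permutes {..<q}" "\<forall>i<q. \<phi> (d i) = scale (b i) (d (\<rho> i))"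
    "q = n + 2 \<longrightarrow> (\<forall>i<q. b i = b 0)"
    by (rule stab_coefficients[OF frame_mapD(2)[OF f] frame_map_bij_H(1)[OF f] K])
  have "c j = b j" if j: "j < q" for j
  proof -
    have r: "\<rho> j < q" using permutes_in_image[OF b(1), of j] j by simp
    have 1: "scale (c j) (d (\<pi> j)) = scale (b j) (d (\<rho> j))"
      using b(2) j frame_mapD(5)[OF f j] by simp
    have "\<pi> j = \<rho> j"
    proof (rule ccontr)
      assume "\<pi> j \<noteq> \<rho> j"
      from d_pair(1)[OF frame_mapD(6)[OF f j] r this 1] frame_mapD(4)[OF f j] show False by simp
    qed
    with 1 d_nonzero[OF r] show ?thesis by simp
  qed
  from this[of i] this[of 0] mp[OF b(3) q, THEN spec[of _ i]] i show ?thesis by simp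
qed

subsection \<open>Splitting off the perspectivities\<close>

text \<open>Among the monomial maps that induce a given collineation of H, fixing \<open>e\<close>
  leaves a choice up to dilation of H, and the product condition removes this choice.\<close>

definition norm_lift :: "('v \<Rightarrow> 'v) \<Rightarrow> bool" where
  "norm_lift \<phi> \<longleftrightarrow> \<phi> e = e \<and> (\<exists>\<sigma> \<pi> c. frame_map \<sigma> \<pi> c \<phi> \<and> (\<Prod>i<q. c i) = 1)"

text \<open>The coefficient product of a composite is the product of the first map times the image
  under \<sigma> of the other product, as permuting the indices does not change a product.\<close>

lemma norm_lift_comp:
  assumes "norm_lift \<phi>" "norm_lift \<psi>"
  shows "norm_lift (\<phi> \<circ> \<psi>)"
proof -
  obtain \<sigma> \<pi> c where f: "frame_map \<sigma> \<pi> c \<phi>" "(\<Prod>i<q. c i) = 1"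
    using assms(1) unfolding norm_lift_def by (elim exE conjE)
  obtain \<tau> \<rho> b where g: "frame_map \<tau> \<rho> b \<psi>" "(\<Prod>i<q. b i) = 1"
    using assms(2) unfolding norm_lift_def by (elim exE conjE)
  note s = field_automorphismD[OF semilinear_onD(1)[OF frame_mapD(1)[OF f(1)]]]
  have "(\<Prod>i<q. \<sigma> (b i)) = \<sigma> (\<Prod>i<q. b i)"
    by (induction q) (simp_all add: s)
  moreover have "(\<Prod>i<q. c (\<rho> i)) = (\<Prod>i<q. c i)"
    using prod.permute[OF frame_mapD(3)[OF g(1)], of c] by (simp add: comp_def)
  ultimately have "(\<Prod>i<q. \<sigma> (b i) * c (\<rho> i)) = 1" using f(2) g(2) s(4) by (simp add: prod.distrib)
  moreover have "(\<phi> \<circ> \<psi>) e = e" using assms by (simp add: norm_lift_def)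
  ultimately show ?thesis
    unfolding norm_lift_def using frame_map_comp[OF f(1) g(1)] by (intro conjI exI)
qed

text \<open>Rescaling by \<open>k\<close> multiplies the product of the \<open>q\<close> coefficients by \<open>k ^ q = k\<close>, so exactly one
  lift has coefficient product 1.\<close>

lemma norm_lift_unique:
  assumes "norm_lift \<phi>" "norm_lift \<psi>" "induced H \<phi> = induced H \<psi>"
  shows "\<phi> = \<psi>"
proof -
  obtain \<sigma> \<pi> c where f: "frame_map \<sigma> \<pi> c \<phi>" "(\<Prod>i<q. c i) = 1"
    using assms(1) unfolding norm_lift_def by (elim exE conjE)
  obtain \<tau> \<rho> b where g: "frame_map \<tau> \<rho> b \<psi>" "(\<Prod>i<q. b i) = 1"
    using assms(2) unfolding norm_lift_def by (elim exE conjE)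
  note eq = induced_H_eqD[OF f(1) g(1) assms(3)]
  obtain k where k: "\<forall>i<q. \<pi> i = \<rho> i \<and> c i = k * b i" using eq(2) by (elim exE conjE)
  have "(\<Prod>i<q. c i) = (\<Prod>i<q. k * b i)" using k by (intro prod.cong) simp_all
  then have "k ^ q = 1" using f(2) g(2) by (simp add: prod.distrib)
  then have "k = 1" using finite_field_power_card_eq_same[of k] by (simp add: card_field)
  then show ?thesis
    using frame_map_eq[of \<sigma> \<pi> c \<phi> \<rho> b \<psi>] f(1) g(1) eq(1) k assms(1,2) by (simp add: norm_lift_def)
qed

lemma exists_norm_lift:
  assumes "g \<in> carrier stab_H"
  shows "\<exists>\<phi>. norm_lift \<phi> \<and> induced H \<phi> = g"
proof -
  obtain \<sigma> \<pi> c \<phi> where f: "frame_map \<sigma> \<pi> c \<phi>" "\<phi> e = e" "g = induced H \<phi>"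
    using assms by (rule stab_H_E)
  \<comment> \<open>Since \<open>k ^ q = k\<close>, rescaling by \<open>k\<close> multiplies the
    coefficient product by \<open>k\<close> itself, so its inverse is the right factor.\<close>
  define k where "k = inverse (\<Prod>i<q. c i)"
  have k0: "k \<noteq> 0" using frame_mapD(4)[OF f(1)] by (simp add: k_def)
  obtain \<psi> where p: "frame_map \<sigma> \<pi> (\<lambda>i. c i * k) \<psi>" "\<psi> e = e" "induced H \<psi> = induced H \<phi>"
    using frame_map_rescale[OF f(1,2) k0] by (elim exE conjE)
  have "(\<Prod>i<q. c i * k) = (\<Prod>i<q. c i) * k ^ q" by (simp add: prod.distrib)
  also have "k ^ q = k" using finite_field_power_card_eq_same[of k] by (simp add: card_field)
  also have "(\<Prod>i<q. c i) * k = 1" using k0 by (simp add: k_def)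
  finally have "norm_lift \<psi>" unfolding norm_lift_def using p by (intro conjI exI)
  with p(3) f(3) show ?thesis by (intro exI[of _ \<psi>]) simp
qed

definition restrict_H :: "('v set \<Rightarrow> 'v set) \<Rightarrow> 'v set \<Rightarrow> 'v set" where
  "restrict_H g x = (if x \<in> pg_points scale H then g x else x)"

lemma restrict_H_induced: "restrict_H (induced UNIV \<phi>) = induced H \<phi>"
  using pg_points_mono by (auto simp: restrict_H_def induced_def fun_eq_iff)

definition lift_H :: "('v set \<Rightarrow> 'v set) \<Rightarrow> 'v \<Rightarrow> 'v" where
  "lift_H g = (SOME \<phi>. norm_lift \<phi> \<and> induced H \<phi> = g)"

lemma lift_H:
  assumes "g \<in> carrier stab_H"
  shows "norm_lift (lift_H g)" "induced H (lift_H g) = g"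
  using someI_ex[OF exists_norm_lift[OF assms]] by (simp_all add: lift_H_def)

lemma norm_lift_bij:
  assumes "norm_lift \<phi>"
  shows "semilinear_bij scale UNIV \<phi>" "semilinear_bij scale H \<phi>"
    "induced UNIV \<phi> \<in> carrier stab_UNIV" "induced H \<phi> \<in> carrier stab_H"
proof -
  obtain \<sigma> \<pi> c where f: "frame_map \<sigma> \<pi> c \<phi>" using assms unfolding norm_lift_def by (elim exE conjE)
  have e: "\<phi> e = scale 1 e + 0" using assms by (simp add: norm_lift_def)
  show "semilinear_bij scale UNIV \<phi>" "semilinear_bij scale H \<phi>"
    "induced UNIV \<phi> \<in> carrier stab_UNIV" "induced H \<phi> \<in> carrier stab_H"
    using frame_map_bij_UNIV(2)[OF f e] frame_map_bij_H(2)[OF f] frame_map_stab(1)[OF f]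
      frame_map_stab(2)[OF f e] subspace_0[OF subspace_H] by simp_all
qed

lemma hom_restrict_H: "restrict_H \<in> hom stab_UNIV stab_H"
proof (rule homI)
  fix g assume "g \<in> carrier stab_UNIV"
  then obtain \<sigma> \<pi> c \<phi> a w where f: "frame_map \<sigma> \<pi> c \<phi>" "\<phi> e = scale a e + w" "a \<noteq> 0" "w \<in> H" "g = induced UNIV \<phi>"
    by (rule stab_UNIV_E)
  show "restrict_H g \<in> carrier stab_H"
    using frame_map_stab(1)[OF f(1)] by (simp add: f(5) restrict_H_induced)
  fix g' assume "g' \<in> carrier stab_UNIV"
  then obtain \<tau> \<rho> b \<psi> r u where p: "frame_map \<tau> \<rho> b \<psi>" "\<psi> e = scale r e + u" "r \<noteq> 0" "u \<in> H" "g' = induced UNIV \<psi>"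
    by (rule stab_UNIV_E)
  have "induced UNIV \<phi> \<circ> induced UNIV \<psi> = induced UNIV (\<phi> \<circ> \<psi>)"
    using induced_comp[OF frame_map_bij_UNIV(2)[OF p(1-4)] subspace_UNIV] by simp
  moreover have "induced H \<phi> \<circ> induced H \<psi> = induced H (\<phi> \<circ> \<psi>)"
    using induced_comp[OF frame_map_bij_H(2)[OF p(1)] subspace_H] by simp
  ultimately show "restrict_H (g \<otimes>\<^bsub>stab_UNIV\<^esub> g') =
      restrict_H g \<otimes>\<^bsub>stab_H\<^esub> restrict_H g'"
    by (simp add: PGammaL_simps f(5) p(5) restrict_H_induced)
qed

lemma hom_lift_H: "(\<lambda>g. induced UNIV (lift_H g)) \<in> hom stab_H stab_UNIV"
proof (rule homI)
  fix g assume g: "g \<in> carrier stab_H"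
  show "induced UNIV (lift_H g) \<in> carrier stab_UNIV"
    by (rule norm_lift_bij(3)[OF lift_H(1)[OF g]])
  fix g' assume g': "g' \<in> carrier stab_H"
  have gg: "g \<circ> g' \<in> carrier stab_H"
    using group.is_monoid[OF group_PGammaL_stab[OF subspace_H, of K], THEN monoid.m_closed, OF g g']
    by (simp add: PGammaL_simps(3))
  have "induced H (lift_H g \<circ> lift_H g') = g \<circ> g'"
    using induced_comp[OF norm_lift_bij(2)[OF lift_H(1)[OF g']] subspace_H, of "lift_H g"]
    by (simp add: lift_H(2) g g')
  then have "lift_H (g \<circ> g') = lift_H g \<circ> lift_H g'"
    by (intro norm_lift_unique[OF lift_H(1)[OF gg] norm_lift_comp[OF lift_H(1)[OF g] lift_H(1)[OF g']]])
      (simp add: lift_H(2)[OF gg])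
  then show "induced UNIV (lift_H (g \<otimes>\<^bsub>stab_H\<^esub> g')) =
    induced UNIV (lift_H g) \<otimes>\<^bsub>stab_UNIV\<^esub> induced UNIV (lift_H g')"
    using induced_comp[OF norm_lift_bij(1)[OF lift_H(1)[OF g']] subspace_UNIV, of "lift_H g"]
    by (simp add: PGammaL_simps)
qed

text \<open>The arc lies in H, so a collineation that fixes H pointwise stabilises it. This
  identifies the perspectivities with the kernel of restriction to H.\<close>

lemma carrier_Persp:
  "carrier (Persp scale H) =
     {g \<in> carrier stab_UNIV. restrict_H g = id}"
proof (rule Set.set_eqI)
  fix g
  let ?P = "\<forall>x\<in>pg_points scale H. g x = x"
  have 1: "restrict_H g = id \<longleftrightarrow> ?P"
    by (auto simp: restrict_H_def fun_eq_iff)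
  have 2: "g ` K = K" if ?P
  proof -
    have "g ` K = (\<lambda>x. x) ` K"
      by (rule image_cong) (use that K_points in auto)
    then show ?thesis by simp
  qed
  show "g \<in> carrier (Persp scale H) \<longleftrightarrow> g \<in> {g \<in> carrier stab_UNIV. restrict_H g = id}"
    unfolding PGammaL_simps mem_Collect_eq 1 using 2 by argo
qed

text \<open>Restriction to H is the projection, and the normalised lift is a homomorphic section of
  it by uniqueness.\<close>

theorem stab_UNIV_semidirect:
  "iso_semidirect stab_UNIV (Persp scale H) stab_H"
proof (rule iso_semidirectI[OF _ _ _ hom_restrict_H hom_lift_H, where \<alpha> = id])
  show "id \<in> hom (Persp scale H) stab_UNIV"
    by (rule homI) (simp_all add: carrier_Persp, simp add: PGammaL_simps)
  show "id ` carrier (Persp scale H) = kernel stab_UNIV stab_H restrict_H"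
    by (simp add: carrier_Persp kernel_def PGammaL_simps(4))
qed (simp_all add: group_PGammaL_stab group_Persp subspace_H restrict_H_induced lift_H)

lemma exists_persp_map:
  "\<exists>\<phi>. frame_map id id (\<lambda>_. 1) \<phi> \<and> \<phi> e = w"
proof -
  have "\<exists>\<phi>. semilinear_on UNIV id \<phi> \<and> \<phi> e = w \<and> (\<forall>i<q. \<phi> (d i) = scale 1 (d (id i)))"
    by (rule exists_frame_map[OF field_automorphism_id permutes_id]) simp
  then obtain \<phi> where "semilinear_on UNIV id \<phi>" "\<phi> e = w" "\<forall>i<q. \<phi> (d i) = scale 1 (d (id i))"
    by (elim exE conjE)
  then show ?thesis by (intro exI[of _ \<phi>]) (simp add: frame_map_def permutes_id)
qed

definition persp_map :: "'v \<Rightarrow> 'v \<Rightarrow> 'v" where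
  "persp_map w = (SOME \<phi>. frame_map id id (\<lambda>_. 1) \<phi> \<and> \<phi> e = w)"

lemma persp_map:
  "frame_map id id (\<lambda>_. 1) (persp_map w)" "persp_map w e = w"
  using someI_ex[OF exists_persp_map[of w]] by (simp_all add: persp_map_def)

lemma persp_map_H: "x \<in> H \<Longrightarrow> persp_map w x = x"
proof -
  assume x: "x \<in> H"
  have "frame_map id id (\<lambda>_. 1) id"
    by (simp add: frame_map_def permutes_id semilinear_on_def field_automorphism_id)
  from frame_map_cong[OF persp_map(1) this _ x] show ?thesis by simp
qed

text \<open>A perspectivity has exactly one representative that is the identity on H, and this is
  determined by the image of \<open>e\<close>. That image is an arbitrary vector outside H, with
  \<open>q - 1\<close> choices for its \<open>e\<close>-coefficient and \<open>q ^ (n + 1)\<close>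
  for its part in H.\<close>

lemma order_Persp: "order (Persp scale H) = q ^ (n + 1) * (q - 1)"
proof -
  let ?D = "(UNIV - {0 :: 'f}) \<times> H"
  let ?f = "\<lambda>(a, w). induced UNIV (persp_map (scale a e + w))"
  have bij: "semilinear_bij scale UNIV (persp_map (scale a e + w))" "bij (persp_map (scale a e + w))"
    "induced UNIV (persp_map (scale a e + w)) \<in> carrier stab_UNIV"
    if "a \<noteq> 0" "w \<in> H" for a w
    using frame_map_bij_UNIV[OF persp_map that] frame_map_stab(2)[OF persp_map that] by simp_all
  have "inj_on ?f ?D"
  proof (rule inj_onI)
    fix s t assume st: "s \<in> ?D" "t \<in> ?D" "?f s = ?f t"
    obtain a w b u where pairs: "s = (a, w)" "t = (b, u)" by (cases s, cases t)
    with st have A: "a \<noteq> 0" "w \<in> H" "b \<noteq> 0" "u \<in> H"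
      "induced UNIV (persp_map (scale a e + w)) = induced UNIV (persp_map (scale b e + u))"
      by simp_all
    let ?p = "persp_map (scale a e + w)" and ?r = "persp_map (scale b e + u)"
    have "\<exists>k. k \<noteq> 0 \<and> (\<forall>x\<in>UNIV. ?p x = scale k (?r x))"
      using induced_eqD[OF subspace_UNIV UNIV_I UNIV_I d_01(3,4) frame_mapD(1)[OF persp_map(1)] bij(2)[OF A(1,2)]
        frame_mapD(1)[OF persp_map(1)] bij(2)[OF A(3,4)] A(5)] by (rule conjunct2)
    then obtain k where k: "\<forall>x\<in>UNIV. ?p x = scale k (?r x)" by (elim exE conjE)
    \<comment> \<open>Both maps are the identity on H, so the scalar between them must be 1.\<close>
    have "scale 1 (d 0) = scale k (d 0)"
      using bspec[OF k UNIV_I, of "d 0"] persp_map_H[OF d_01(1)] by simp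
    then have "k = 1" using d_01(3) by (simp only: scale_cancel_right) simp
    then have "scale a e + w = scale b e + u" using bspec[OF k UNIV_I, of e] by (simp add: persp_map(2))
    from decompose_unique[OF A(2,4) this] show "s = t" by (simp add: pairs)
  qed
  moreover have "?f ` ?D = carrier (Persp scale H)"
  proof
    have "induced UNIV (persp_map (scale a e + w)) \<in> carrier (Persp scale H)" if "a \<noteq> 0" "w \<in> H" for a w
      using bij(3)[OF that] by (simp add: carrier_Persp restrict_H_induced induced_eq_id persp_map_H)
    then show "?f ` ?D \<subseteq> carrier (Persp scale H)" by auto
    show "carrier (Persp scale H) \<subseteq> ?f ` ?D"
    proof
      fix g assume "g \<in> carrier (Persp scale H)"
      then have g: "g \<in> carrier stab_UNIV" "restrict_H g = id" by (simp_all add: carrier_Persp)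
      from g(1) obtain \<sigma> \<pi> c \<phi> a w where f: "frame_map \<sigma> \<pi> c \<phi>" "\<phi> e = scale a e + w" "a \<noteq> 0" "w \<in> H"
        "g = induced UNIV \<phi>" by (rule stab_UNIV_E)
      have "induced H \<phi> = induced H (persp_map e)"
        using g(2) by (simp add: f(5) restrict_H_induced induced_eq_id persp_map_H)
      note eq = induced_H_eqD[OF f(1) persp_map(1) this]
      obtain k where k: "k \<noteq> 0" "\<forall>i<q. \<pi> i = id i \<and> c i = k * 1" using eq(2) by (elim exE conjE)
      \<comment> \<open>The map \<phi> multiplies H by \<open>k\<close>; dividing by
        \<open>k\<close> yields a map that is the identity on H and sends \<open>e\<close> to
        \<open>?u\<close>.\<close>
      let ?u = "scale (inverse k * a) e + scale (inverse k) w"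
      have u: "inverse k * a \<noteq> 0" "scale (inverse k) w \<in> H"
        using k(1) f(3,4) subspace_scale[OF subspace_H] by simp_all
      have "frame_map id id (\<lambda>_. k) (\<lambda>x. scale k (persp_map ?u x))"
        using persp_map(1)[of ?u] semilinear_on_scale[of UNIV id "persp_map ?u" k] k(1)
        by (simp add: frame_map_def)
      moreover have "\<phi> e = scale k (persp_map ?u e)"
        using f(2) k(1) by (simp add: persp_map(2) scale_right_distrib)
      ultimately have "\<phi> = (\<lambda>x. scale k (persp_map ?u x))"
        using frame_map_eq[of \<sigma> \<pi> c \<phi> id "\<lambda>_. k"] f(1) eq(1) k(2) by simp
      then have "g = ?f (inverse k * a, scale (inverse k) w)"
        using induced_scale(2)[OF k(1) bij(1)[OF u] subspace_UNIV] by (simp add: f(5))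
      then show "g \<in> ?f ` ?D" by (rule image_eqI) (use u in simp)
    qed
  qed
  ultimately have "order (Persp scale H) = card ?D"
    unfolding Coset.order_def using card_image[of ?f ?D] by simp
  also have "\<dots> = q ^ (n + 1) * (q - 1)"
    by (simp add: card_cartesian_product card_Diff_subset card_field card_H)
  finally show ?thesis .
qed

end

text \<open>\<open>sym_group q\<close> permutes \<open>{1..q}\<close> while the arc is indexed by
  \<open>{..<q}\<close>; this lemma and the next one translate between the two.\<close>

lemma permutes_atLeastAtMost_shift:
  assumes "\<pi> permutes {1..m}"
  shows "(\<lambda>i. if i < m then \<pi> (Suc i) - 1 else i) permutes {..<m}"
proof (rule bij_imp_permutes)
  have r: "inv' \<pi> permutes {1..m}" using assms by (rule permutes_inv)
  have a: "\<pi> (Suc i) \<ge> 1 \<and> \<pi> (Suc i) \<le> m" if "i < m" for i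
    using permutes_in_image[OF assms, of "Suc i"] that by simp
  have b: "inv' \<pi> (Suc i) \<ge> 1 \<and> inv' \<pi> (Suc i) \<le> m" if "i < m" for i
    using permutes_in_image[OF r, of "Suc i"] that by simp
  show "bij_betw (\<lambda>i. if i < m then \<pi> (Suc i) - 1 else i) {..<m} {..<m}"
  proof (rule bij_betw_byWitness[where f' = "\<lambda>i. inv' \<pi> (Suc i) - 1"])
    show "\<forall>i\<in>{..<m}. inv' \<pi> (Suc (if i < m then \<pi> (Suc i) - 1 else i)) - 1 = i"
    proof
      fix i assume "i \<in> {..<m}"
      then have "i < m" "Suc (\<pi> (Suc i) - 1) = \<pi> (Suc i)" using a[of i] by auto
      then show "inv' \<pi> (Suc (if i < m then \<pi> (Suc i) - 1 else i)) - 1 = i"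
        by (simp add: permutes_inverses[OF assms])
    qed
    show "\<forall>i\<in>{..<m}. (if inv' \<pi> (Suc i) - 1 < m then \<pi> (Suc (inv' \<pi> (Suc i) - 1)) - 1 else inv' \<pi> (Suc i) - 1) = i"
    proof
      fix i assume "i \<in> {..<m}"
      then have "inv' \<pi> (Suc i) - 1 < m" "Suc (inv' \<pi> (Suc i) - 1) = inv' \<pi> (Suc i)" using b[of i] by auto
      then show "(if inv' \<pi> (Suc i) - 1 < m then \<pi> (Suc (inv' \<pi> (Suc i) - 1)) - 1 else inv' \<pi> (Suc i) - 1) = i"
        by (simp add: permutes_inverses[OF assms])
    qed
    show "(\<lambda>i. if i < m then \<pi> (Suc i) - 1 else i) ` {..<m} \<subseteq> {..<m}" using a by fastforce
    show "(\<lambda>i. inv' \<pi> (Suc i) - 1) ` {..<m} \<subseteq> {..<m}" using b by fastforce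
  qed
qed simp

lemma permutes_lessThan_shift:
  assumes "\<pi> permutes {..<m}"
  shows "(\<lambda>j. if j \<in> {1..m} then Suc (\<pi> (j - 1)) else j) permutes {1..m}"
proof (rule bij_imp_permutes)
  have r: "inv' \<pi> permutes {..<m}" using assms by (rule permutes_inv)
  have a: "\<pi> i < m" "inv' \<pi> i < m" if "i < m" for i
    using permutes_in_image[OF assms, of i] permutes_in_image[OF r, of i] that by simp_all
  have b: "j - 1 < m" "Suc (j - 1) = j" if "j \<in> {1..m}" for j using that by auto
  show "bij_betw (\<lambda>j. if j \<in> {1..m} then Suc (\<pi> (j - 1)) else j) {1..m} {1..m}"
    by (rule bij_betw_byWitness[where f' = "\<lambda>j. Suc (inv' \<pi> (j - 1))"])
      (use a b in \<open>auto simp: permutes_inverses[OF assms] Suc_le_eq\<close>)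
qed auto

section \<open>The stabiliser in the hyperplane: field automorphisms and the kernel\<close>

context arc_frame
begin

lemma induced_H_eq:
  assumes "frame_map \<sigma> \<pi> c \<phi>" "frame_map \<sigma> \<rho> b \<psi>" "\<And>i. i < q \<Longrightarrow> \<pi> i = \<rho> i \<and> c i = b i"
  shows "induced H \<phi> = induced H \<psi>"
  by (rule induced_cong) (rule frame_map_cong[OF assms])

lemma induced_H_comp:
  assumes f: "frame_map \<sigma> \<pi> c \<phi>" and g: "frame_map \<tau> \<rho> b \<psi>" and h: "frame_map (\<sigma> \<circ> \<tau>) \<kappa> a \<theta>"
    and "\<And>i. i < q \<Longrightarrow> \<kappa> i = \<pi> (\<rho> i) \<and> a i = \<sigma> (b i) * c (\<rho> i)"
  shows "induced H \<theta> = induced H \<phi> \<circ> induced H \<psi>"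
proof -
  have "induced H \<theta> = induced H (\<phi> \<circ> \<psi>)"
    by (rule induced_H_eq[OF h frame_map_comp[OF f g]]) (simp add: assms(4))
  then show ?thesis by (simp add: induced_comp[OF frame_map_bij_H(2)[OF g] subspace_H])
qed

definition frame_lift :: "('f \<Rightarrow> 'f) \<Rightarrow> (nat \<Rightarrow> nat) \<Rightarrow> (nat \<Rightarrow> 'f) \<Rightarrow> 'v \<Rightarrow> 'v" where
  "frame_lift \<sigma> \<pi> c = (SOME \<phi>. frame_map \<sigma> \<pi> c \<phi>)"

lemma frame_lift:
  assumes "field_automorphism \<sigma>" "\<pi> permutes {..<q}" "\<forall>i<q. c i \<noteq> 0" "q = n + 2 \<Longrightarrow> \<forall>i<q. c i = c 0"
  shows "frame_map \<sigma> \<pi> c (frame_lift \<sigma> \<pi> c)"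
proof -
  obtain \<phi> where "semilinear_on UNIV \<sigma> \<phi> \<and> \<phi> e = e \<and> (\<forall>i<q. \<phi> (d i) = scale (c i) (d (\<pi> i)))"
    using exists_frame_map[OF assms(1,2,4), where w = e] by (rule exE)
  then have "frame_map \<sigma> \<pi> c \<phi>" using assms(2,3) by (simp add: frame_map_def)
  then show ?thesis unfolding frame_lift_def by (rule someI[of "frame_map \<sigma> \<pi> c"])
qed

text \<open>The choice is unique on \<open>stab_H\<close>, because semilinear maps that induce the
  same collineation of H have the same field automorphism.\<close>

definition twist :: "('v set \<Rightarrow> 'v set) \<Rightarrow> 'f \<Rightarrow> 'f" where
  "twist g = (SOME \<sigma>. \<exists>\<pi> c \<phi>. frame_map \<sigma> \<pi> c \<phi> \<and> g = induced H \<phi>)"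

lemma twist_induced:
  assumes f: "frame_map \<sigma> \<pi> c \<phi>"
  shows "twist (induced H \<phi>) = \<sigma>"
  unfolding twist_def
proof (rule some_equality)
  show "\<exists>\<pi> c \<psi>. frame_map \<sigma> \<pi> c \<psi> \<and> induced H \<phi> = induced H \<psi>"
    by (intro exI conjI) (rule f, rule refl)
next
  fix \<tau> assume "\<exists>\<pi> c \<psi>. frame_map \<tau> \<pi> c \<psi> \<and> induced H \<phi> = induced H \<psi>"
  then obtain \<pi>' c' \<psi> where g: "frame_map \<tau> \<pi>' c' \<psi>" "induced H \<phi> = induced H \<psi>" by (elim exE conjE)
  from induced_H_eqD(1)[OF g(1) f g(2)[symmetric]] show "\<tau> = \<sigma>" .
qed

lemma field_Aut_simps:
  "carrier field_Aut = {\<sigma>. field_automorphism \<sigma>}" "monoid.mult field_Aut = (\<circ>)" "\<one>\<^bsub>field_Aut\<^esub> = id"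
  by (simp_all add: field_Aut_def map_group_def)

lemma hom_twist: "twist \<in> hom stab_H field_Aut"
proof (rule homI)
  fix g assume "g \<in> carrier stab_H"
  then obtain \<sigma> \<pi> c \<phi> where f: "frame_map \<sigma> \<pi> c \<phi>" "g = induced H \<phi>" by (rule stab_H_E)
  show "twist g \<in> carrier field_Aut"
    using semilinear_onD(1)[OF frame_mapD(1)[OF f(1)]] by (simp add: f(2) twist_induced[OF f(1)] field_Aut_simps)
  fix g' assume "g' \<in> carrier stab_H"
  then obtain \<tau> \<rho> b \<psi> where p: "frame_map \<tau> \<rho> b \<psi>" "g' = induced H \<psi>" by (rule stab_H_E)
  have "induced H \<phi> \<circ> induced H \<psi> = induced H (\<phi> \<circ> \<psi>)"
    by (rule induced_comp[OF frame_map_bij_H(2)[OF p(1)] subspace_H, symmetric])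
  then show "twist (g \<otimes>\<^bsub>stab_H\<^esub> g') = twist g \<otimes>\<^bsub>field_Aut\<^esub> twist g'"
    by (simp add: PGammaL_simps field_Aut_simps f(2) p(2) twist_induced[OF f(1)] twist_induced[OF p(1)]
        twist_induced[OF frame_map_comp[OF f(1) p(1)]])
qed

lemma frame_lift_id:
  assumes "field_automorphism \<sigma>"
  shows "frame_map \<sigma> id (\<lambda>_. 1) (frame_lift \<sigma> id (\<lambda>_. 1))"
  by (rule frame_lift[OF assms permutes_id]) simp_all

text \<open>With the trivial permutation and all coefficients 1, the field automorphism acts on
  coordinates. Such maps are closed under composition because automorphisms fix 1.\<close>

lemma hom_frame_lift:
  "(\<lambda>\<sigma>. induced H (frame_lift \<sigma> id (\<lambda>_. 1))) \<in> hom field_Aut stab_H"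
proof (rule homI)
  fix \<sigma> :: "'f \<Rightarrow> 'f" assume "\<sigma> \<in> carrier field_Aut"
  then have s: "field_automorphism \<sigma>" by (simp add: field_Aut_simps)
  show "induced H (frame_lift \<sigma> id (\<lambda>_. 1)) \<in> carrier stab_H"
    by (rule frame_map_stab(1)[OF frame_lift_id[OF s]])
  fix \<tau> :: "'f \<Rightarrow> 'f" assume "\<tau> \<in> carrier field_Aut"
  then have t: "field_automorphism \<tau>" by (simp add: field_Aut_simps)
  show "induced H (frame_lift (\<sigma> \<otimes>\<^bsub>field_Aut\<^esub> \<tau>) id (\<lambda>_. 1)) =
    induced H (frame_lift \<sigma> id (\<lambda>_. 1)) \<otimes>\<^bsub>stab_H\<^esub> induced H (frame_lift \<tau> id (\<lambda>_. 1))"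
    unfolding field_Aut_simps PGammaL_simps
    by (rule induced_H_comp[OF frame_lift_id[OF s] frame_lift_id[OF t] frame_lift_id[OF field_automorphism_comp[OF s t]]])
      (simp add: field_automorphismD(4)[OF s])
qed

lemma stab_H_semidirect:
  assumes "group N" "\<alpha> \<in> hom N stab_H" "inj_on \<alpha> (carrier N)"
    and "\<alpha> ` carrier N = kernel stab_H field_Aut twist"
  shows "iso_semidirect stab_H N (field_Aut :: ('f \<Rightarrow> 'f) monoid)"
proof (rule iso_semidirectI[OF _ assms(1) _ hom_twist hom_frame_lift _ assms(2-4)])
  fix \<sigma> :: "'f \<Rightarrow> 'f" assume "\<sigma> \<in> carrier field_Aut"
  then show "twist (induced H (frame_lift \<sigma> id (\<lambda>_. 1))) = \<sigma>"
    by (intro twist_induced[OF frame_lift_id]) (simp add: field_Aut_simps)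
qed (simp_all add: group_PGammaL_stab subspace_H group_field_Aut)

lemma kernel_twist_E:
  assumes "g \<in> kernel stab_H field_Aut twist"
  obtains \<pi> c \<phi> where "frame_map id \<pi> c \<phi>" "\<phi> e = e" "g = induced H \<phi>"
proof -
  have g: "g \<in> carrier stab_H" "twist g = id"
    using assms by (simp_all add: kernel_def field_Aut_simps)
  from g(1) obtain \<sigma> \<pi> c \<phi> where f: "frame_map \<sigma> \<pi> c \<phi>" "\<phi> e = e" "g = induced H \<phi>" by (rule stab_H_E)
  then have "\<sigma> = id" using twist_induced[OF f(1)] g(2) by simp
  with f show ?thesis by (intro that) simp_all
qed

lemma kernel_twist_I: "frame_map id \<pi> c \<phi> \<Longrightarrow> induced H \<phi> \<in> kernel stab_H field_Aut twist"
  using frame_map_stab(1)[of id \<pi> c \<phi>] twist_induced[of id \<pi> c \<phi>] by (simp add: kernel_def field_Aut_simps)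

text \<open>For \<open>q = n + 2\<close> the coefficients are all equal to \<open>c 0\<close>, so
  rescaling by its inverse makes them 1. The kernel of \<open>twist\<close> is therefore described
  by the permutation alone.\<close>

lemma stab_H_sym_group:
  assumes q: "q = n + 2"
  shows "iso_semidirect stab_H (sym_group q) (field_Aut :: ('f \<Rightarrow> 'f) monoid)"
proof (rule stab_H_semidirect)
  define sh where "sh \<pi> i = (if i < q then \<pi> (Suc i) - 1 else i)" for \<pi> :: "nat \<Rightarrow> nat" and i
  have sh: "sh \<pi> permutes {..<q}" if "\<pi> permutes {1..q}" for \<pi>
    using permutes_atLeastAtMost_shift[OF that] by (simp add: sh_def[abs_def])
  have sh_eq: "Suc (sh \<pi> i) = \<pi> (Suc i)" if "\<pi> permutes {1..q}" "i < q" for \<pi> i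
    using permutes_in_image[OF that(1), of "Suc i"] that(2) by (simp add: sh_def)
  let ?\<alpha> = "\<lambda>\<pi>. induced H (frame_lift id (sh \<pi>) (\<lambda>_. 1))"
  have f: "frame_map id (sh \<pi>) (\<lambda>_. 1) (frame_lift id (sh \<pi>) (\<lambda>_. 1))" if "\<pi> permutes {1..q}" for \<pi>
    by (rule frame_lift[OF field_automorphism_id sh[OF that]]) simp_all
  show "group (sym_group q)" by (rule sym_group_is_group)
  show "?\<alpha> \<in> hom (sym_group q) stab_H"
  proof (rule homI)
    fix \<pi> assume "\<pi> \<in> carrier (sym_group q)"
    then have p: "\<pi> permutes {1..q}" by (simp add: sym_group_carrier)
    show "?\<alpha> \<pi> \<in> carrier stab_H" by (rule frame_map_stab(1)[OF f[OF p]])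
    fix \<rho> assume "\<rho> \<in> carrier (sym_group q)"
    then have r: "\<rho> permutes {1..q}" by (simp add: sym_group_carrier)
    have pr: "\<pi> \<circ> \<rho> permutes {1..q}" using r p by (rule permutes_compose)
    have fpr: "frame_map (id \<circ> id) (sh (\<pi> \<circ> \<rho>)) (\<lambda>_. 1) (frame_lift id (sh (\<pi> \<circ> \<rho>)) (\<lambda>_. 1))"
      using f[OF pr] by simp
    have "sh (\<pi> \<circ> \<rho>) i = sh \<pi> (sh \<rho> i)" if i: "i < q" for i
    proof -
      have j: "sh \<rho> i < q" using permutes_in_image[OF sh[OF r], of i] i by simp
      have "Suc (sh (\<pi> \<circ> \<rho>) i) = Suc (sh \<pi> (sh \<rho> i))"
        by (simp only: sh_eq[OF pr i] sh_eq[OF p j] sh_eq[OF r i] comp_apply)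
      then show ?thesis by simp
    qed
    then show "?\<alpha> (\<pi> \<otimes>\<^bsub>sym_group q\<^esub> \<rho>) = ?\<alpha> \<pi> \<otimes>\<^bsub>stab_H\<^esub> ?\<alpha> \<rho>"
      unfolding sym_group_mult PGammaL_simps by (intro induced_H_comp[OF f[OF p] f[OF r] fpr]) simp
  qed
  show "inj_on ?\<alpha> (carrier (sym_group q))"
  proof (rule inj_onI)
    fix \<pi> \<rho> assume "\<pi> \<in> carrier (sym_group q)" "\<rho> \<in> carrier (sym_group q)" and eq: "?\<alpha> \<pi> = ?\<alpha> \<rho>"
    then have p: "\<pi> permutes {1..q}" and r: "\<rho> permutes {1..q}" by (simp_all add: sym_group_carrier)
    from induced_H_eqD(2)[OF f[OF p] f[OF r] eq] have sheq: "\<forall>i<q. sh \<pi> i = sh \<rho> i" by (elim exE conjE) simp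
    show "\<pi> = \<rho>"
    proof
      fix j
      show "\<pi> j = \<rho> j"
      proof (cases "j \<in> {1..q}")
        case True
        then have "j - 1 < q" "Suc (j - 1) = j" by auto
        then show ?thesis using sh_eq[OF p, of "j - 1"] sh_eq[OF r, of "j - 1"] sheq by simp
      qed (simp add: permutes_not_in[OF p] permutes_not_in[OF r])
    qed
  qed
  show "?\<alpha> ` carrier (sym_group q) = kernel stab_H field_Aut twist"
  proof
    show "?\<alpha> ` carrier (sym_group q) \<subseteq> kernel stab_H field_Aut twist"
      using kernel_twist_I[OF f] by (auto simp: sym_group_carrier)
    show "kernel stab_H field_Aut twist \<subseteq> ?\<alpha> ` carrier (sym_group q)"
    proof
      fix g assume "g \<in> kernel stab_H field_Aut twist"
      then obtain \<pi> c \<phi> where p: "frame_map id \<pi> c \<phi>" "\<phi> e = e" "g = induced H \<phi>" by (rule kernel_twist_E)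
      have c0: "inverse (c 0) \<noteq> 0" using frame_mapD(4)[OF p(1), of 0] q by simp
      obtain \<psi> where s: "frame_map id \<pi> (\<lambda>i. c i * inverse (c 0)) \<psi>" "induced H \<psi> = induced H \<phi>"
        using frame_map_rescale[OF p(1,2) c0] by (elim exE conjE)
      let ?r = "\<lambda>j. if j \<in> {1..q} then Suc (\<pi> (j - 1)) else j"
      have r: "?r permutes {1..q}" by (rule permutes_lessThan_shift[OF frame_mapD(3)[OF p(1)]])
      have "induced H \<psi> = ?\<alpha> ?r"
      proof (rule induced_H_eq[OF s(1) f[OF r]])
        fix i assume i: "i < q"
        have "c i * inverse (c 0) = 1" using frame_map_coeff_const[OF p(1) q i] c0 by simp
        with i show "\<pi> i = sh ?r i \<and> c i * inverse (c 0) = 1" by (simp add: sh_def)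
      qed
      then have "g = ?\<alpha> ?r" using s(2) p(3) by simp
      moreover have "?r \<in> carrier (sym_group q)" using r by (simp add: sym_group_carrier)
      ultimately show "g \<in> ?\<alpha> ` carrier (sym_group q)" by (rule image_eqI)
    qed
  qed
qed

text \<open>The choice of lift does not matter: the matrix determines the coefficients and the
  permutation below \<open>q\<close>, and these determine the map on H.\<close>

definition of_monomial :: "'f mat \<Rightarrow> 'v set \<Rightarrow> 'v set" where
  "of_monomial A = induced H (SOME \<phi>. \<exists>\<pi> c. frame_map id \<pi> c \<phi> \<and> A = monom_mat q c \<pi>)"

lemma of_monomial:
  assumes f: "frame_map id \<pi> c \<phi>"
  shows "of_monomial (monom_mat q c \<pi>) = induced H \<phi>"
proof -
  let ?P = "\<lambda>\<phi>. \<exists>\<pi>' c'. frame_map id \<pi>' c' \<phi> \<and> monom_mat q c \<pi> = monom_mat q c' \<pi>'"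
  have "?P \<phi>" by (intro exI conjI) (rule f, rule refl)
  then have "?P (SOME \<phi>. ?P \<phi>)" by (rule someI[of ?P])
  then obtain \<pi>' c' where g: "frame_map id \<pi>' c' (SOME \<phi>. ?P \<phi>)" "monom_mat q c \<pi> = monom_mat q c' \<pi>'"
    by (elim exE conjE)
  have "\<forall>i<q. c i \<noteq> 0" using frame_mapD(4)[OF f] by simp
  note D = monom_mat_eqD[OF g(2) frame_mapD(3)[OF f] this]
  show ?thesis unfolding of_monomial_def by (rule induced_H_eq[OF g(1) f]) (simp add: D)
qed

text \<open>For \<open>q = n + 1\<close> the \<open>d i\<close> are a basis of H, so every monomial
  matrix occurs. Those acting trivially are the scalar matrices, and the first isomorphism theorem
  identifies \<open>PMon q\<close> with the kernel of \<open>twist\<close>.\<close>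

lemma stab_H_PMon:
  assumes q: "q = n + 1"
  shows "iso_semidirect stab_H (PMon q :: 'f mat set monoid) (field_Aut :: ('f \<Rightarrow> 'f) monoid)"
    and "order (PMon q :: 'f mat set monoid) = (q - 1) ^ n * fact q"
proof -
  let ?M = "Mon q :: 'f mat monoid" and ?G = "stab_H"
  let ?N = "kernel ?G (field_Aut :: ('f \<Rightarrow> 'f) monoid) twist"
  let ?Z = "{k \<cdot>\<^sub>m 1\<^sub>m q | k :: 'f. k \<noteq> 0}"
  interpret T: group_hom ?G "field_Aut :: ('f \<Rightarrow> 'f) monoid" twist
    by (intro group_hom.intro group_hom_axioms.intro group_PGammaL_stab subspace_H group_field_Aut hom_twist)
  interpret M: group ?M by (rule group_Mon)
  let ?L = "\<lambda>\<pi> c. frame_lift id \<pi> c"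
  have f: "frame_map id \<pi> c (?L \<pi> c)" if "\<pi> permutes {..<q}" "\<forall>i<q. c i \<noteq> 0" for \<pi> c
    by (rule frame_lift[OF field_automorphism_id that]) (use q in simp)
  have E: thesis if "A \<in> carrier ?M" "\<And>\<pi> c. A = monom_mat q c \<pi> \<Longrightarrow> frame_map id \<pi> c (?L \<pi> c) \<Longrightarrow> thesis" for A thesis
  proof -
    from that(1) obtain c \<pi> where "A = monom_mat q c \<pi>" "\<pi> permutes {..<q}" "\<forall>j<q. c j \<noteq> 0"
      unfolding carrier_Mon by (elim CollectE exE conjE)
    then show thesis using that(2) f by simp
  qed
  let ?GN = "?G\<lparr>carrier := ?N\<rparr>"
  have hom: "of_monomial \<in> hom ?M ?GN"
  proof (rule homI)
    fix A assume "A \<in> carrier ?M"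
    then obtain \<pi> c where A: "A = monom_mat q c \<pi>" "frame_map id \<pi> c (?L \<pi> c)" by (rule E)
    show "of_monomial A \<in> carrier ?GN"
      unfolding A(1) of_monomial[OF A(2)] using kernel_twist_I[OF A(2)] by simp
    fix B assume "B \<in> carrier ?M"
    then obtain \<rho> b where B: "B = monom_mat q b \<rho>" "frame_map id \<rho> b (?L \<rho> b)" by (rule E)
    have AB: "A \<otimes>\<^bsub>?M\<^esub> B = monom_mat q (\<lambda>j. b j * c (\<rho> j)) (\<pi> \<circ> \<rho>)"
      by (simp add: Mon_def A(1) B(1) monom_mat_mult[OF frame_mapD(3)[OF B(2)]])
    have "frame_map id (\<pi> \<circ> \<rho>) (\<lambda>j. b j * c (\<rho> j)) (?L \<pi> c \<circ> ?L \<rho> b)"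
      using frame_map_comp[OF A(2) B(2)] by simp
    then have "of_monomial (A \<otimes>\<^bsub>?M\<^esub> B) = induced H (?L \<pi> c \<circ> ?L \<rho> b)"
      unfolding AB by (rule of_monomial)
    also have "\<dots> = of_monomial A \<circ> of_monomial B"
      unfolding A(1) B(1) of_monomial[OF A(2)] of_monomial[OF B(2)]
      by (rule induced_comp[OF frame_map_bij_H(2)[OF B(2)] subspace_H])
    finally show "of_monomial (A \<otimes>\<^bsub>?M\<^esub> B) = of_monomial A \<otimes>\<^bsub>?GN\<^esub> of_monomial B" by (simp add: PGammaL_simps)
  qed
  have gN: "group ?GN"
    by (rule subgroup.subgroup_is_group[OF T.subgroup_kernel T.G.group_axioms])
  interpret B: group_hom ?M ?GN of_monomial
    by (intro group_hom.intro group_hom_axioms.intro M.group_axioms gN hom)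
  have surj: "of_monomial ` carrier ?M = carrier ?GN"
  proof
    show "of_monomial ` carrier ?M \<subseteq> carrier ?GN" using hom by (auto simp: hom_def)
    show "carrier ?GN \<subseteq> of_monomial ` carrier ?M"
    proof
      fix g assume "g \<in> carrier ?GN"
      then have "g \<in> ?N" by simp
      then obtain \<pi> c \<phi> where p: "frame_map id \<pi> c \<phi>" "g = induced H \<phi>" by (rule kernel_twist_E)
      have "g = of_monomial (monom_mat q c \<pi>)" by (simp add: of_monomial[OF p(1)] p(2))
      moreover have "monom_mat q c \<pi> \<in> carrier ?M"
        using frame_mapD(3,4)[OF p(1)] by (simp add: monom_mat_in_Mon)
      ultimately show "g \<in> of_monomial ` carrier ?M" by (rule image_eqI)
    qed
  qed
  have unit: "frame_map id id (\<lambda>_. 1) id"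
    by (simp add: frame_map_def permutes_id semilinear_on_def field_automorphism_id)
  have Z: "kernel ?M ?GN of_monomial = ?Z"
  proof (rule Set.set_eqI, rule iffI)
    fix A assume "A \<in> kernel ?M ?GN of_monomial"
    then have A: "A \<in> carrier ?M" "of_monomial A = id" by (simp_all add: kernel_def PGammaL_simps)
    from A(1) obtain \<pi> c where p: "A = monom_mat q c \<pi>" "frame_map id \<pi> c (?L \<pi> c)" by (rule E)
    have "induced H (?L \<pi> c) = induced H id"
      using A(2) unfolding p(1) of_monomial[OF p(2)] by (simp add: induced_eq_id)
    from induced_H_eqD(2)[OF p(2) unit this] obtain k where k: "k \<noteq> 0" "\<forall>i<q. \<pi> i = id i \<and> c i = k * 1"
      by (elim exE conjE)
    have "A = monom_mat q (\<lambda>_. k) id" unfolding p(1) by (rule monom_mat_cong) (use k(2) in simp)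
    with k(1) show "A \<in> ?Z" unfolding monom_mat_one by (intro CollectI exI conjI)
  next
    fix A assume "A \<in> ?Z"
    then obtain k where k: "A = k \<cdot>\<^sub>m 1\<^sub>m q" "k \<noteq> 0" by (elim CollectE exE conjE)
    obtain \<phi> where p: "frame_map id id (\<lambda>_. k) \<phi>" "\<forall>x\<in>H. \<phi> x = scale k x"
      using exists_dilation[OF k(2)] by (elim exE conjE)
    have A: "A = monom_mat q (\<lambda>_. k) id" by (simp add: monom_mat_one k(1))
    have "induced H \<phi> = induced H (\<lambda>x. scale k (id x))" by (rule induced_cong) (simp add: p(2))
    also have "\<dots> = induced H id" by (rule induced_scale(2)[OF k(2) semilinear_bij_id subspace_H])
    also have "\<dots> = id" by (rule induced_eq_id) simp
    finally have "of_monomial A = id" unfolding A of_monomial[OF p(1)] .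
    moreover have "A \<in> carrier ?M"
      unfolding A by (rule monom_mat_in_Mon[OF permutes_id]) (simp add: k(2))
    ultimately show "A \<in> kernel ?M ?GN of_monomial" by (simp add: kernel_def PGammaL_simps)
  qed
  have PMon: "(PMon q :: 'f mat set monoid) = ?M Mod kernel ?M ?GN of_monomial"
    by (simp add: PMon_def Z)
  let ?\<alpha> = "\<lambda>X. the_elem (of_monomial ` X)"
  have iso: "?\<alpha> \<in> iso (PMon q) ?GN" unfolding PMon by (rule B.FactGroup_iso_set[OF surj])
  show "iso_semidirect ?G (PMon q :: 'f mat set monoid) (field_Aut :: ('f \<Rightarrow> 'f) monoid)"
  proof (rule stab_H_semidirect)
    show "group (PMon q :: 'f mat set monoid)"
      unfolding PMon by (rule normal.factorgroup_is_group[OF B.normal_kernel])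
    have bij: "bij_betw ?\<alpha> (carrier (PMon q)) (carrier ?GN)" and h: "?\<alpha> \<in> hom (PMon q) ?GN"
      using iso by (simp_all add: iso_def)
    show "inj_on ?\<alpha> (carrier (PMon q))" "?\<alpha> ` carrier (PMon q) = ?N"
      using bij by (simp_all add: bij_betw_def)
    show "?\<alpha> \<in> hom (PMon q) ?G"
    proof (rule homI)
      fix X assume X: "X \<in> carrier (PMon q :: 'f mat set monoid)"
      have "?\<alpha> X \<in> ?N" using hom_in_carrier[OF h X] by simp
      then show "?\<alpha> X \<in> carrier ?G" by (simp add: kernel_def)
      fix Y assume Y: "Y \<in> carrier (PMon q :: 'f mat set monoid)"
      show "?\<alpha> (X \<otimes>\<^bsub>PMon q\<^esub> Y) = ?\<alpha> X \<otimes>\<^bsub>?G\<^esub> ?\<alpha> Y" using hom_mult[OF h X Y] by simp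
    qed
  qed
  have "card ?Z = q - 1"
  proof -
    have "?Z = (\<lambda>k. k \<cdot>\<^sub>m 1\<^sub>m q) ` (UNIV - {0 :: 'f})" by auto
    moreover have "inj_on (\<lambda>k :: 'f. k \<cdot>\<^sub>m 1\<^sub>m q) (UNIV - {0})"
    proof (rule inj_onI)
      fix k l :: 'f assume "k \<cdot>\<^sub>m 1\<^sub>m q = l \<cdot>\<^sub>m 1\<^sub>m q"
      then have "(k \<cdot>\<^sub>m 1\<^sub>m q) $$ (0, 0) = (l \<cdot>\<^sub>m 1\<^sub>m q) $$ (0, 0)" by simp
      then show "k = l" using q by simp
    qed
    ultimately show ?thesis by (simp add: card_image card_Diff_subset card_field)
  qed
  \<comment> \<open>By Lagrange, the \<open>q - 1\<close> scalars cancel one of the q factors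
    \<open>q - 1\<close> in the order of \<open>Mon q\<close>, which leaves the exponent n.\<close>
  moreover have "card (carrier (PMon q :: 'f mat set monoid)) * card (kernel ?M ?GN of_monomial) = order ?M"
    unfolding PMon using M.lagrange[OF B.subgroup_kernel] by (simp add: FactGroup_def)
  ultimately have "order (PMon q :: 'f mat set monoid) * (q - 1) = (q - 1) ^ q * fact q"
    by (simp add: Coset.order_def[of "PMon q"] Z order_Mon[OF card_field])
  also have "\<dots> = (q - 1) ^ n * fact q * (q - 1)" by (simp add: q)
  finally show "order (PMon q :: 'f mat set monoid) = (q - 1) ^ n * fact q" using q_gt_2 by simp
qed

end

section \<open>Graph invariants\<close>

lemma graph_automorphismD:
  assumes "graph_automorphism G f"
  shows "f permutes fst G"
    and "u \<in> fst G \<Longrightarrow> v \<in> fst G \<Longrightarrow> {f u, f v} \<in> snd G \<longleftrightarrow> {u, v} \<in> snd G"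
  using assms by (simp_all add: graph_automorphism_def)

text \<open>In the incidence graph this is collinearity of distinct points and concurrency of
  distinct lines in an affine point.\<close>

definition dist2 :: "'a graph \<Rightarrow> 'a \<Rightarrow> 'a \<Rightarrow> bool" where
  "dist2 G u v \<longleftrightarrow> u \<noteq> v \<and> (\<exists>w\<in>fst G. {u, w} \<in> snd G \<and> {v, w} \<in> snd G)"

lemma dist2_automorphism:
  assumes f: "graph_automorphism G f" and u: "u \<in> fst G" and v: "v \<in> fst G"
  shows "dist2 G (f u) (f v) \<longleftrightarrow> dist2 G u v"
proof -
  note D = graph_automorphismD[OF f]
  have "f u = f v \<longleftrightarrow> u = v" using permutes_inj[OF D(1)] by (simp add: inj_eq)
  moreover have "(\<exists>w\<in>fst G. {f u, w} \<in> snd G \<and> {f v, w} \<in> snd G)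
      \<longleftrightarrow> (\<exists>w\<in>f ` fst G. {f u, w} \<in> snd G \<and> {f v, w} \<in> snd G)"
    by (simp only: permutes_image[OF D(1)])
  moreover have "\<dots> \<longleftrightarrow> (\<exists>w\<in>fst G. {u, w} \<in> snd G \<and> {v, w} \<in> snd G)"
    using D(2)[OF u] D(2)[OF v] by (simp add: bex_simps(7) cong: bex_cong)
  ultimately show ?thesis by (simp add: dist2_def)
qed

text \<open>This invariant separates the two vertex classes of the graph: lines are rich, points are not.\<close>

definition rich_vertex :: "'a graph \<Rightarrow> 'a \<Rightarrow> bool" where
  "rich_vertex G v \<longleftrightarrow> (\<exists>w\<in>fst G. w \<noteq> v \<and> \<not> dist2 G v w \<and>
     (\<exists>x\<in>fst G. \<exists>y\<in>fst G. \<exists>z\<in>fst G. x \<noteq> y \<and> x \<noteq> z \<and> y \<noteq> z \<and>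
       dist2 G v x \<and> dist2 G v y \<and> dist2 G v z \<and> dist2 G x w \<and> dist2 G y w \<and> dist2 G z w))"

lemma rich_vertex_automorphism:
  assumes f: "graph_automorphism G f" and v: "v \<in> fst G" and rich: "rich_vertex G v"
  shows "rich_vertex G (f v)"
proof -
  from rich obtain w x y z where V: "w \<in> fst G" "x \<in> fst G" "y \<in> fst G" "z \<in> fst G"
    and P: "w \<noteq> v" "\<not> dist2 G v w" "x \<noteq> y" "x \<noteq> z" "y \<noteq> z" "dist2 G v x" "dist2 G v y" "dist2 G v z"
      "dist2 G x w" "dist2 G y w" "dist2 G z w"
    unfolding rich_vertex_def by (elim bexE conjE)
  note D = graph_automorphismD(1)[OF f]
  have inj: "f a = f b \<longleftrightarrow> a = b" for a b using permutes_inj[OF D] by (simp add: inj_eq)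
  have mem: "f a \<in> fst G \<longleftrightarrow> a \<in> fst G" for a by (rule permutes_in_image[OF D])
  note d = dist2_automorphism[OF f]
  show ?thesis unfolding rich_vertex_def
    by (rule bexI[of _ "f w"], intro conjI, simp_all only: inj mem d v V P not_False_eq_True,
        rule bexI[of _ "f x"], rule bexI[of _ "f y"], rule bexI[of _ "f z"])
      (simp_all add: inj mem d v V P)
qed

lemma graph_automorphism_inv:
  assumes "graph_automorphism G f"
  shows "graph_automorphism G (inv' f)"
proof -
  note D = graph_automorphismD[OF assms]
  have p: "inv' f permutes fst G" by (rule permutes_inv[OF D(1)])
  have "{inv' f u, inv' f v} \<in> snd G \<longleftrightarrow> {u, v} \<in> snd G" if "u \<in> fst G" "v \<in> fst G" for u v
    using D(2)[of "inv' f u" "inv' f v"] that by (simp add: permutes_in_image[OF p] permutes_inverses[OF D(1)])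
  with p show ?thesis by (simp add: graph_automorphism_def)
qed

lemma rich_vertex_automorphism_iff:
  assumes f: "graph_automorphism G f" and v: "v \<in> fst G"
  shows "rich_vertex G (f v) \<longleftrightarrow> rich_vertex G v"
proof
  note D = graph_automorphismD(1)[OF f]
  assume "rich_vertex G (f v)"
  from rich_vertex_automorphism[OF graph_automorphism_inv[OF f] _ this]
  show "rich_vertex G v" using v by (simp add: permutes_in_image[OF D] permutes_inverses[OF D])
qed (rule rich_vertex_automorphism[OF f v])

section \<open>The incidence graph in coordinates\<close>

context arc_frame
begin

abbreviation "\<Gamma> \<equiv> Gamma scale H K"

definition apoint :: "'v \<Rightarrow> 'v set" where "apoint v = span {e + v}"

definition aline :: "'v \<Rightarrow> nat \<Rightarrow> 'v set" where "aline v i = span {e + v, d i}"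

lemma e_plus_notin_H: "v \<in> H \<Longrightarrow> e + v \<notin> H"
  using subspace_diff[OF subspace_H, of "e + v" v] e_notin_H by auto

lemma e_plus_nonzero: "v \<in> H \<Longrightarrow> e + v \<noteq> 0"
  using e_plus_notin_H subspace_0[OF subspace_H] by metis

lemma affine_normal_form:
  assumes "u \<notin> H"
  obtains v a where "v \<in> H" "a \<noteq> 0" "u = scale a (e + v)"
proof -
  obtain a h where u: "h \<in> H" "u = scale a e + h" by (rule decompose)
  have a: "a \<noteq> 0" using u assms by auto
  show ?thesis
    by (rule that[of "scale (inverse a) h" a])
      (use a u subspace_scale[OF subspace_H] in \<open>simp_all add: scale_right_distrib\<close>)
qed

lemma affine_points_eq: "affine_points scale H = apoint ` H"
proof (rule Set.set_eqI, rule iffI)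
  fix x assume "x \<in> affine_points scale H"
  then have x: "x \<in> pg_points scale UNIV" "x \<notin> pg_points scale H" by (simp_all add: affine_points_def)
  from x(1) obtain u where u: "u \<noteq> 0" "x = span {u}" unfolding pg_points_iff[OF subspace_UNIV] by (elim bexE conjE)
  have "u \<notin> H" using x(2) u unfolding pg_points_iff[OF subspace_H] by auto
  then obtain v a where v: "v \<in> H" "a \<noteq> 0" "u = scale a (e + v)" by (rule affine_normal_form)
  have "x = apoint v" unfolding u(2) apoint_def span_singleton_eq_iff[OF u(1)] using v by (intro exI[of _ a]) simp
  with v(1) show "x \<in> apoint ` H" by simp
next
  fix x assume "x \<in> apoint ` H"
  then obtain v where v: "v \<in> H" "x = span {e + v}" unfolding apoint_def by (elim imageE)
  have "x \<in> pg_points scale UNIV"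
    unfolding pg_points_iff[OF subspace_UNIV] using v e_plus_nonzero by (intro bexI[of _ "e + v"]) simp_all
  moreover have "e + v \<in> x" using v(2) by (simp add: span_base)
  then have "\<not> x \<subseteq> H" using e_plus_notin_H[OF v(1)] by auto
  then have "x \<notin> pg_points scale H" by (simp add: pg_points_def)
  ultimately show "x \<in> affine_points scale H" by (simp add: affine_points_def)
qed

lemma in_pt: "x \<in> apoint v \<longleftrightarrow> (\<exists>a. x = scale a (e + v))"
  by (auto simp: apoint_def span_singleton)

lemma in_ln: "x \<in> aline v i \<longleftrightarrow> (\<exists>a b. x = scale a (e + v) + scale b (d i))"
proof
  assume "x \<in> aline v i"
  then obtain a where "x - scale a (e + v) \<in> span {d i}" unfolding aline_def span_insert[of "e + v"] by auto
  then obtain b where "x - scale a (e + v) = scale b (d i)" by (auto simp: span_singleton)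
  then have "x = scale a (e + v) + scale b (d i)" by (simp add: algebra_simps)
  then show "\<exists>a b. x = scale a (e + v) + scale b (d i)" by (intro exI)
next
  assume "\<exists>a b. x = scale a (e + v) + scale b (d i)"
  then obtain a b where "x = scale a (e + v) + scale b (d i)" by (elim exE)
  then show "x \<in> aline v i" by (simp add: aline_def span_add span_scale span_base)
qed

lemma pt_subset_iff: "subspace l \<Longrightarrow> apoint v \<subseteq> l \<longleftrightarrow> e + v \<in> l"
  unfolding apoint_def using span_base[of "e + v" "{e + v}"] span_minimal[of "{e + v}" l] by auto

lemma subspace_ln: "subspace (aline v i)" by (simp add: aline_def)

lemma pt_subset_ln:
  assumes "v \<in> H" "w \<in> H" "i < q"
  shows "apoint v \<subseteq> aline w i \<longleftrightarrow> (\<exists>t. v = w + scale t (d i))"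
proof -
  have "e + v \<in> aline w i \<longleftrightarrow> (\<exists>t. v = w + scale t (d i))"
  proof
    assume "e + v \<in> aline w i"
    then obtain a b where "e + v = scale a (e + w) + scale b (d i)" unfolding in_ln by (elim exE)
    then have 1: "scale 1 e + v = scale a e + (scale a w + scale b (d i))"
      by (simp add: scale_right_distrib add.assoc)
    have 2: "scale a w + scale b (d i) \<in> H"
      using assms d_in_H by (simp add: subspace_add subspace_scale subspace_H)
    from decompose_unique[OF assms(1) 2 1] show "\<exists>t. v = w + scale t (d i)" by (intro exI[of _ b]) simp
  next
    assume "\<exists>t. v = w + scale t (d i)"
    then obtain t where "v = w + scale t (d i)" by (elim exE)
    then have "e + v = scale 1 (e + w) + scale t (d i)" by (simp add: add.assoc)
    then show "e + v \<in> aline w i" unfolding in_ln by (intro exI)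
  qed
  then show ?thesis by (simp add: pt_subset_iff[OF subspace_ln])
qed

lemma pt_eq_iff:
  assumes "v \<in> H" "w \<in> H"
  shows "apoint v = apoint w \<longleftrightarrow> v = w"
proof
  assume "apoint v = apoint w"
  then obtain a where "e + v = scale a (e + w)"
    unfolding apoint_def span_singleton_eq_iff[OF e_plus_nonzero[OF assms(1)]] by (elim exE conjE)
  then have 1: "scale 1 e + v = scale a e + scale a w" by (simp add: scale_right_distrib)
  have 2: "scale a w \<in> H" using assms by (simp add: subspace_scale subspace_H)
  from decompose_unique[OF assms(1) 2 1] show "v = w" by simp
qed simp

lemma ln_shift:
  assumes "v = w + scale t (d i)"
  shows "aline v i = aline w i"
proof -
  have *: "aline v i \<subseteq> aline w i" if "v = w + scale t (d i)" for v w t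
  proof -
    have "e + v = scale 1 (e + w) + scale t (d i)" using that by (simp add: add.assoc)
    then have "e + v \<in> aline w i" unfolding in_ln by (intro exI)
    moreover have "d i \<in> aline w i" by (simp add: aline_def span_base)
    ultimately show ?thesis unfolding aline_def[of v] by (intro span_minimal subspace_ln) simp
  qed
  have "w = v + scale (- t) (d i)" using assms by simp
  from *[OF assms] *[OF this] show ?thesis by (rule equalityI)
qed

lemma ln_eq_iff:
  assumes "v \<in> H" "w \<in> H" "i < q" "j < q"
  shows "aline v i = aline w j \<longleftrightarrow> i = j \<and> (\<exists>t. v = w + scale t (d i))"
proof
  assume eq: "aline v i = aline w j"
  \<comment> \<open>The vectors v and \<open>v + d i\<close> are two points of the line, and their
    difference recovers its direction.\<close>
  have vi: "v + d i \<in> H" using assms d_in_H by (simp add: subspace_add subspace_H)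
  have "\<exists>t. v = v + scale t (d i)" by (rule exI[of _ 0]) simp
  then have "apoint v \<subseteq> aline w j" using pt_subset_ln[OF assms(1,1,3)] eq by simp
  then obtain t where t: "v = w + scale t (d j)" unfolding pt_subset_ln[OF assms(1,2,4)] by (elim exE)
  have "\<exists>t. v + d i = v + scale t (d i)" by (rule exI[of _ 1]) simp
  then have "apoint (v + d i) \<subseteq> aline w j" using pt_subset_ln[OF vi assms(1,3)] eq by simp
  then obtain s where "v + d i = w + scale s (d j)" unfolding pt_subset_ln[OF vi assms(2,4)] by (elim exE)
  then have "scale 1 (d i) = scale (s - t) (d j)" using t by (simp add: scale_left_diff_distrib algebra_simps)
  from d_pair(1)[OF assms(3,4) _ this] have "i = j" by (metis zero_neq_one)
  with t show "i = j \<and> (\<exists>t. v = w + scale t (d i))" by (intro conjI exI[of _ t]) simp_all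
next
  assume "i = j \<and> (\<exists>t. v = w + scale t (d i))"
  then obtain t where "i = j" "v = w + scale t (d i)" by (elim exE conjE)
  with ln_shift[of v w t i] show "aline v i = aline w j" by simp
qed

lemma e_plus_d_independent:
  assumes "v \<in> H" "i < q"
  shows "independent {e + v, d i}" "e + v \<noteq> d i"
proof -
  have "e + v \<notin> span {d i}" using span_d_subset_H[OF assms(2)] e_plus_notin_H[OF assms(1)] by auto
  then show "independent {e + v, d i}" using d_nonzero[OF assms(2)] by (simp add: independent_insertI)
  show "e + v \<noteq> d i" using e_plus_notin_H[OF assms(1)] d_in_H[OF assms(2)] by auto
qed

lemma dim_ln: "v \<in> H \<Longrightarrow> i < q \<Longrightarrow> dim (aline v i) = 2"
  using dim_span_eq_card_independent[of "{e + v, d i}"] e_plus_d_independent[of v i] by (simp add: aline_def)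

lemma affine_lines_eq: "affine_lines scale H K = {aline v i | v i. v \<in> H \<and> i < q}"
proof (rule Set.set_eqI, rule iffI)
  fix l assume "l \<in> affine_lines scale H K"
  then have l: "subspace l" "dim l = 2" "\<not> l \<subseteq> H" and "\<exists>x\<in>K. x \<subseteq> l"
    by (simp_all add: affine_lines_def pg_lines_def)
  then obtain i where i: "i < q" "span {d i} \<subseteq> l" unfolding K_eq by auto
  from l(3) obtain u where u: "u \<in> l" "u \<notin> H" by auto
  from u(2) obtain v a where v: "v \<in> H" "a \<noteq> 0" "u = scale a (e + v)" by (rule affine_normal_form)
  have "e + v = scale (inverse a) u" using v by simp
  then have "e + v \<in> l" using subspace_scale[OF l(1) u(1)] by simp
  moreover have "d i \<in> l" using i(2) span_base[of "d i" "{d i}"] by auto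
  ultimately have "aline v i \<subseteq> l" unfolding aline_def by (intro span_minimal l(1)) simp
  interpret F: finite_dimensional_vector_space scale "insert e (d ` {..n})"
    by unfold_locales (simp_all add: indep_frame span_frame)
  have "aline v i = l"
    by (rule F.subspace_dim_equal[OF subspace_ln l(1) \<open>aline v i \<subseteq> l\<close>]) (simp add: dim_ln[OF v(1) i(1)] l(2))
  with v(1) i(1) show "l \<in> {aline v i | v i. v \<in> H \<and> i < q}" by (intro CollectI exI[of _ v] exI[of _ i]) simp
next
  fix l assume "l \<in> {aline v i | v i. v \<in> H \<and> i < q}"
  then obtain v i where l: "l = aline v i" "v \<in> H" "i < q" by (elim CollectE exE conjE)
  have "e + v \<in> l" by (simp add: l(1) aline_def span_base)
  then have "\<not> l \<subseteq> H" using e_plus_notin_H[OF l(2)] by auto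
  moreover have "span {d i} \<subseteq> l" unfolding l(1) aline_def by (rule span_mono) simp
  then have "\<exists>x\<in>K. x \<subseteq> l" using l(3) unfolding K_eq by (intro bexI[of _ "span {d i}"]) simp_all
  ultimately show "l \<in> affine_lines scale H K"
    using dim_ln[OF l(2,3)] by (simp add: affine_lines_def pg_lines_def l(1) subspace_ln)
qed

lemma pt_neq_ln:
  assumes "v \<in> H" "i < q"
  shows "apoint v \<noteq> aline w i"
proof
  assume "apoint v = aline w i"
  moreover have "d i \<in> aline w i" by (simp add: aline_def span_base)
  ultimately have "d i \<in> apoint v" by simp
  then obtain a where "d i = scale a (e + v)" unfolding in_pt by (elim exE)
  then have 1: "scale 0 e + d i = scale a e + scale a v" by (simp add: scale_right_distrib)
  have 2: "scale a v \<in> H" using assms by (simp add: subspace_scale subspace_H)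
  from decompose_unique[OF d_in_H[OF assms(2)] 2 1] have "d i = 0" by auto
  with d_nonzero[OF assms(2)] show False by simp
qed

lemma vertex_cases:
  assumes "x \<in> fst \<Gamma>"
  obtains v where "v \<in> H" "x = apoint v" | v i where "v \<in> H" "i < q" "x = aline v i"
  using assms unfolding Gamma_def affine_points_eq affine_lines_eq fst_conv by blast

lemma pt_vertex: "v \<in> H \<Longrightarrow> apoint v \<in> fst \<Gamma>"
  and ln_vertex: "v \<in> H \<Longrightarrow> i < q \<Longrightarrow> aline v i \<in> fst \<Gamma>"
  unfolding Gamma_def affine_points_eq affine_lines_eq by auto

text \<open>Any point of a line can serve as its base vector; taking the incident one describes
  every edge by a single vector and a direction.\<close>

lemma edges_eq: "snd \<Gamma> = {{apoint v, aline v i} | v i. v \<in> H \<and> i < q}"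
proof (rule Set.set_eqI, rule iffI)
  fix y assume "y \<in> snd \<Gamma>"
  then have "\<exists>x l. y = {x, l} \<and> x \<in> affine_points scale H \<and> l \<in> affine_lines scale H K \<and> x \<subseteq> l"
    by (simp add: Gamma_def)
  then obtain x l where y: "y = {x, l}" "x \<in> apoint ` H" "l \<in> {aline v i | v i. v \<in> H \<and> i < q}" "x \<subseteq> l"
    unfolding affine_points_eq affine_lines_eq by (elim exE conjE)
  from y(2) obtain v where v: "v \<in> H" "x = apoint v" by (elim imageE)
  from y(3) obtain w i where w: "w \<in> H" "i < q" "l = aline w i" by (elim CollectE exE conjE)
  from y(4) obtain t where "v = w + scale t (d i)"
    unfolding v(2) w(3) pt_subset_ln[OF v(1) w(1,2)] by (elim exE)
  then have "y = {apoint v, aline v i}" using ln_shift y(1) v(2) w(3) by metis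
  with v(1) w(2) show "y \<in> {{apoint v, aline v i} | v i. v \<in> H \<and> i < q}" by (intro CollectI exI conjI)
next
  fix y assume "y \<in> {{apoint v, aline v i} | v i. v \<in> H \<and> i < q}"
  then obtain v i where y: "y = {apoint v, aline v i}" "v \<in> H" "i < q" by (elim CollectE exE conjE)
  have "v = v + scale 0 (d i)" by simp
  then have "apoint v \<subseteq> aline v i" unfolding pt_subset_ln[OF y(2,2,3)] by (rule exI)
  moreover have "apoint v \<in> affine_points scale H" using y(2) by (simp add: affine_points_eq)
  moreover have "aline v i \<in> affine_lines scale H K" using y(2,3) by (auto simp: affine_lines_eq)
  ultimately have "\<exists>x l. y = {x, l} \<and> x \<in> affine_points scale H \<and> l \<in> affine_lines scale H K \<and> x \<subseteq> l"
    using y(1) by (intro exI[of _ "apoint v"] exI[of _ "aline v i"]) simp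
  then show "y \<in> snd \<Gamma>" by (simp add: Gamma_def)
qed

lemma edge_pt_ln:
  assumes "v \<in> H" "w \<in> H" "i < q"
  shows "{apoint v, aline w i} \<in> snd \<Gamma> \<longleftrightarrow> (\<exists>t. v = w + scale t (d i))"
proof
  assume "{apoint v, aline w i} \<in> snd \<Gamma>"
  then obtain v' j where x: "{apoint v, aline w i} = {apoint v', aline v' j}" "v' \<in> H" "j < q"
    unfolding edges_eq by (elim CollectE exE conjE)
  then have "apoint v = apoint v'" "aline w i = aline v' j"
    using pt_neq_ln[OF assms(1) x(3), of v'] by (simp_all add: doubleton_eq_iff)
  then have "v = v'" "i = j \<and> (\<exists>t. w = v' + scale t (d i))"
    using pt_eq_iff[OF assms(1) x(2)] ln_eq_iff[OF assms(2) x(2) assms(3) x(3)] by metis+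
  then obtain t where "w = v + scale t (d i)" by auto
  then have "v = w + scale (- t) (d i)" by simp
  then show "\<exists>t. v = w + scale t (d i)" by (rule exI)
next
  assume "\<exists>t. v = w + scale t (d i)"
  then obtain t where "v = w + scale t (d i)" by (elim exE)
  then have "{apoint v, aline w i} = {apoint v, aline v i}" using ln_shift by metis
  with assms(1,3) show "{apoint v, aline w i} \<in> snd \<Gamma>" unfolding edges_eq by (intro CollectI exI conjI)
qed

lemma edge_pt_pt: "v \<in> H \<Longrightarrow> w \<in> H \<Longrightarrow> {apoint v, apoint w} \<notin> snd \<Gamma>"
  unfolding edges_eq using pt_neq_ln by (auto simp: doubleton_eq_iff)

lemma edge_ln_ln:
  assumes "v \<in> H" "w \<in> H" "i < q" "j < q"
  shows "{aline v i, aline w j} \<notin> snd \<Gamma>"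
proof
  assume "{aline v i, aline w j} \<in> snd \<Gamma>"
  then obtain u k where u: "{aline v i, aline w j} = {apoint u, aline u k}" "u \<in> H" "k < q"
    unfolding edges_eq by (elim CollectE exE conjE)
  then have "apoint u = aline v i \<or> apoint u = aline w j" by (auto simp: doubleton_eq_iff)
  then show False using pt_neq_ln[OF u(2) assms(3)] pt_neq_ln[OF u(2) assms(4)] by auto
qed

end

section \<open>Collinearity, transversals, regularity and the separation of points from
  lines\<close>

lemma dist2_sym: "dist2 G u v \<longleftrightarrow> dist2 G v u"
  by (auto simp: dist2_def)

context arc_frame
begin

lemma H_add_d: "v \<in> H \<Longrightarrow> i < q \<Longrightarrow> v + scale t (d i) \<in> H"
  by (simp add: subspace_add subspace_scale subspace_H d_in_H)

lemma dist2_pt_pt: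
  assumes "v \<in> H" "w \<in> H"
  shows "dist2 \<Gamma> (apoint v) (apoint w) \<longleftrightarrow> v \<noteq> w \<and> (\<exists>i<q. \<exists>t. w = v + scale t (d i))"
proof
  assume "dist2 \<Gamma> (apoint v) (apoint w)"
  then obtain u where u: "u \<in> fst \<Gamma>" "{apoint v, u} \<in> snd \<Gamma>" "{apoint w, u} \<in> snd \<Gamma>" and ne: "v \<noteq> w"
    unfolding dist2_def by auto
  from u(1) show "v \<noteq> w \<and> (\<exists>i<q. \<exists>t. w = v + scale t (d i))"
  proof (cases rule: vertex_cases)
    case (1 x)
    with u(2) edge_pt_pt[OF assms(1) 1(1)] show ?thesis by simp
  next
    case (2 x i)
    obtain s t where "v = x + scale s (d i)" "w = x + scale t (d i)"
      using u(2,3) edge_pt_ln[OF assms(1) 2(1,2)] edge_pt_ln[OF assms(2) 2(1,2)] unfolding 2(3) by auto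
    then have "w = v + scale (t - s) (d i)" by (simp add: scale_left_diff_distrib)
    with ne 2(2) show ?thesis by auto
  qed
next
  assume "v \<noteq> w \<and> (\<exists>i<q. \<exists>t. w = v + scale t (d i))"
  then obtain i t where i: "v \<noteq> w" "i < q" "w = v + scale t (d i)" by (elim exE conjE)
  have "v = v + scale 0 (d i)" by simp
  then have "{apoint v, aline v i} \<in> snd \<Gamma>" unfolding edge_pt_ln[OF assms(1,1) i(2)] by (rule exI)
  moreover have "{apoint w, aline v i} \<in> snd \<Gamma>" unfolding edge_pt_ln[OF assms(2,1) i(2)] using i(3) by (rule exI)
  moreover have "apoint v \<noteq> apoint w" using i(1) assms by (simp add: pt_eq_iff)
  ultimately show "dist2 \<Gamma> (apoint v) (apoint w)"
    unfolding dist2_def using ln_vertex[OF assms(1) i(2)] by (intro conjI bexI[of _ "aline v i"])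
qed

lemma dist2_pt_ln:
  assumes "v \<in> H" "w \<in> H" "i < q"
  shows "\<not> dist2 \<Gamma> (apoint v) (aline w i)"
proof
  assume "dist2 \<Gamma> (apoint v) (aline w i)"
  then obtain u where u: "u \<in> fst \<Gamma>" "{apoint v, u} \<in> snd \<Gamma>" "{aline w i, u} \<in> snd \<Gamma>"
    unfolding dist2_def by auto
  from u(1) show False
  proof (cases rule: vertex_cases)
    case (1 x)
    with u(2) edge_pt_pt[OF assms(1) 1(1)] show ?thesis by simp
  next
    case (2 x j)
    with u(3) edge_ln_ln[OF assms(2) 2(1) assms(3) 2(2)] show ?thesis by simp
  qed
qed

lemma dist2_ln_ln:
  assumes "v \<in> H" "w \<in> H" "i < q" "j < q"
  shows "dist2 \<Gamma> (aline v i) (aline w j) \<longleftrightarrow>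
    aline v i \<noteq> aline w j \<and> (\<exists>s t. v + scale s (d i) = w + scale t (d j))"
proof
  assume "dist2 \<Gamma> (aline v i) (aline w j)"
  then obtain u where u: "u \<in> fst \<Gamma>" "{aline v i, u} \<in> snd \<Gamma>" "{aline w j, u} \<in> snd \<Gamma>" and ne: "aline v i \<noteq> aline w j"
    unfolding dist2_def by auto
  from u(1) show "aline v i \<noteq> aline w j \<and> (\<exists>s t. v + scale s (d i) = w + scale t (d j))"
  proof (cases rule: vertex_cases)
    case (1 x)
    from u(2) obtain s where s: "x = v + scale s (d i)"
      unfolding 1(2) insert_commute[of "aline v i"] edge_pt_ln[OF 1(1) assms(1,3)] by (elim exE)
    from u(3) obtain t where "x = w + scale t (d j)"
      unfolding 1(2) insert_commute[of "aline w j"] edge_pt_ln[OF 1(1) assms(2,4)] by (elim exE)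
    with s have "v + scale s (d i) = w + scale t (d j)" by simp
    with ne show ?thesis by (intro conjI exI)
  next
    case (2 x k)
    with u(2) edge_ln_ln[OF assms(1) 2(1) assms(3) 2(2)] show ?thesis by simp
  qed
next
  assume "aline v i \<noteq> aline w j \<and> (\<exists>s t. v + scale s (d i) = w + scale t (d j))"
  then obtain s t where ne: "aline v i \<noteq> aline w j" and x: "v + scale s (d i) = w + scale t (d j)" by (elim exE conjE)
  let ?x = "v + scale s (d i)"
  have H: "?x \<in> H" by (rule H_add_d[OF assms(1,3)])
  have "{aline v i, apoint ?x} \<in> snd \<Gamma>"
    unfolding insert_commute[of "aline v i"] edge_pt_ln[OF H assms(1,3)] by (rule exI[of _ s]) (rule refl)
  moreover have "{aline w j, apoint ?x} \<in> snd \<Gamma>"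
    unfolding insert_commute[of "aline w j"] edge_pt_ln[OF H assms(2,4)] using x by (intro exI)
  ultimately show "dist2 \<Gamma> (aline v i) (aline w j)"
    unfolding dist2_def using ne pt_vertex[OF H] by (intro conjI bexI[of _ "apoint ?x"])
qed

lemma exists_third_scalar: "\<exists>c :: 'f. c \<noteq> 0 \<and> c \<noteq> 1"
proof (rule ccontr)
  assume "\<nexists>c :: 'f. c \<noteq> 0 \<and> c \<noteq> 1"
  then have "(UNIV :: 'f set) \<subseteq> {0, 1}" by auto
  then have "card (UNIV :: 'f set) \<le> card {0, 1 :: 'f}" by (intro card_mono) simp_all
  with card_field q_gt_2 show False by simp
qed

text \<open>In the plane through v with directions i and j, these are two parallel lines and their q
  transversals in the other direction. Three transversals make a line rich; two suffice later to
  show that automorphisms preserve parallelism.\<close>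

lemma parallel_transversals:
  assumes v: "v \<in> H" and i: "i < q" and j: "j < q" "j \<noteq> i" and b: "b \<noteq> 0"
  shows "aline (v + scale b (d j)) i \<noteq> aline v i"
    and "\<not> dist2 \<Gamma> (aline v i) (aline (v + scale b (d j)) i)"
    and "a \<noteq> a' \<Longrightarrow> aline (v + scale a (d i)) j \<noteq> aline (v + scale a' (d i)) j"
    and "dist2 \<Gamma> (aline (v + scale a (d i)) j) (aline v i)"
    and "dist2 \<Gamma> (aline (v + scale a (d i)) j) (aline (v + scale b (d j)) i)"
proof -
  have w: "v + scale b (d j) \<in> H" by (rule H_add_d[OF v j(1)])
  have x: "v + scale a (d i) \<in> H" for a by (rule H_add_d[OF v i])
  have no: "scale t (d i) \<noteq> scale b (d j) + scale s (d i)" for s t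
  proof
    assume "scale t (d i) = scale b (d j) + scale s (d i)"
    then have "scale b (d j) = scale (t - s) (d i)" by (simp add: scale_left_diff_distrib)
    from d_pair(1)[OF j(1) i j(2) this] b show False by simp
  qed
  show "aline (v + scale b (d j)) i \<noteq> aline v i"
    unfolding ln_eq_iff[OF w v i i] using no[of _ 0] by (auto simp: eq_commute[of "scale b (d j)"])
  show "\<not> dist2 \<Gamma> (aline v i) (aline (v + scale b (d j)) i)"
    unfolding dist2_ln_ln[OF v w i i] using no by (simp add: add.assoc)
  show "aline (v + scale a (d i)) j \<noteq> aline (v + scale a' (d i)) j" if "a \<noteq> a'"
  proof
    assume "aline (v + scale a (d i)) j = aline (v + scale a' (d i)) j"
    then obtain t where "v + scale a (d i) = v + scale a' (d i) + scale t (d j)"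
      unfolding ln_eq_iff[OF x x j(1) j(1)] by (elim exE conjE)
    then have "scale (a - a') (d i) = scale t (d j)" by (simp add: scale_left_diff_distrib algebra_simps)
    from d_pair(1)[OF i j(1) j(2)[symmetric] this] that show False by simp
  qed
  have "v + scale a (d i) + scale 0 (d j) = v + scale a (d i)" by simp
  then have "\<exists>s t. v + scale a (d i) + scale s (d j) = v + scale t (d i)" by (intro exI)
  then show "dist2 \<Gamma> (aline (v + scale a (d i)) j) (aline v i)"
    using j(2) unfolding dist2_ln_ln[OF x v j(1) i] ln_eq_iff[OF x v j(1) i] by simp
  have "v + scale a (d i) + scale b (d j) = v + scale b (d j) + scale a (d i)" by (simp add: algebra_simps)
  then have "\<exists>s t. v + scale a (d i) + scale s (d j) = v + scale b (d j) + scale t (d i)" by (intro exI)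
  then show "dist2 \<Gamma> (aline (v + scale a (d i)) j) (aline (v + scale b (d j)) i)"
    using j(2) unfolding dist2_ln_ln[OF x w j(1) i] ln_eq_iff[OF x w j(1) i] by simp
qed

lemma rich_line:
  assumes v: "v \<in> H" and i: "i < q"
  shows "rich_vertex \<Gamma> (aline v i)"
proof -
  obtain j where j: "j < q" "j \<noteq> i"
  proof (cases "i = 0")
    case True
    then show ?thesis using that[of 1] q_gt_2 by simp
  next
    case False
    then show ?thesis using that[of 0] q_gt_2 by simp
  qed
  \<comment> \<open>The scalars 0, 1 and c place three distinct transversals.\<close>
  obtain c :: 'f where c: "c \<noteq> 0" "c \<noteq> 1" using exists_third_scalar by (elim exE conjE)
  note P = parallel_transversals[OF v i j one_neq_zero]
  have w: "aline (v + scale 1 (d j)) i \<in> fst \<Gamma>" by (rule ln_vertex[OF H_add_d[OF v j(1)] i])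
  have V: "aline (v + scale a (d i)) j \<in> fst \<Gamma>" for a by (rule ln_vertex[OF H_add_d[OF v i] j(1)])
  show ?thesis
    unfolding rich_vertex_def
    by (rule bexI[OF _ w], intro conjI P(1,2),
        rule bexI[OF _ V[of 0]], rule bexI[OF _ V[of 1]], rule bexI[OF _ V[of c]])
      (intro conjI P(3,5) P(4)[unfolded dist2_sym[of _ _ "aline v i"]], use c in simp_all)
qed

lemma sum_delta_d:
  assumes "finite S" "k \<in> S"
  shows "(\<Sum>m\<in>S. scale (if m = k then r else 0) (d m)) = scale r (d k)"
proof -
  have "(\<Sum>m\<in>S. scale (if m = k then r else 0) (d m)) = (\<Sum>m\<in>S. if m = k then scale r (d m) else 0)"
    by (rule sum.cong) simp_all
  also have "\<dots> = scale r (d k)" using assms by (subst sum.delta) simp_all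
  finally show ?thesis .
qed

text \<open>Subtraction gives a relation on at most four indices, where \<open>d_independent\<close>
  applies. Writing its coefficients as sums of indicator terms covers all coincidences among the
  indices at once.\<close>

lemma d_two_term_unique:
  assumes idx: "i < q" "j < q" "k < q" "l < q" "i \<noteq> j" "k \<noteq> l" and nz: "a \<noteq> 0" "b \<noteq> 0" "a' \<noteq> 0" "b' \<noteq> 0"
    and eq: "scale a (d i) + scale b (d j) = scale a' (d k) + scale b' (d l)"
  shows "i = k \<and> a = a' \<or> i = l \<and> a = b'"
proof -
  define c where "c m = (if m = i then a else 0) + (if m = j then b else 0)
    - (if m = k then a' else 0) - (if m = l then b' else 0)" for m
  let ?S = "{i, j, k, l}"
  have "(\<Sum>m\<in>?S. scale (c m) (d m)) = scale a (d i) + scale b (d j) - scale a' (d k) - scale b' (d l)"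
    unfolding c_def scale_left_distrib scale_left_diff_distrib sum.distrib sum_subtractf
    by (simp only: sum_delta_d finite_insert finite.emptyI insert_iff simp_thms)
  then have 0: "(\<Sum>m\<in>?S. scale (c m) (d m)) = 0" using eq by (simp add: algebra_simps)
  have card: "card ?S \<le> 4" by (simp add: card_insert_if)
  have "c i = 0" by (rule d_independent[OF _ card 0]) (use idx in auto)
  then show ?thesis using idx nz by (auto simp: c_def split: if_splits)
qed

text \<open>A common neighbour of v and w writes \<open>w - v\<close> as a combination of two
  directions. This expression is unique up to order, so the neighbour is
  \<open>v + a1 * d i1\<close> or \<open>v + b1 * d j1\<close>, and a third one is
  impossible.\<close>

lemma not_rich_point:
  assumes v: "v \<in> H"
  shows "\<not> rich_vertex \<Gamma> (apoint v)"
proof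
  assume "rich_vertex \<Gamma> (apoint v)"
  then obtain y x1 x2 x3 where V: "y \<in> fst \<Gamma>" "x1 \<in> fst \<Gamma>" "x2 \<in> fst \<Gamma>" "x3 \<in> fst \<Gamma>"
    and ne: "y \<noteq> apoint v" "\<not> dist2 \<Gamma> (apoint v) y" "x1 \<noteq> x2" "x1 \<noteq> x3" "x2 \<noteq> x3"
    and D: "dist2 \<Gamma> (apoint v) x1" "dist2 \<Gamma> (apoint v) x2" "dist2 \<Gamma> (apoint v) x3"
      "dist2 \<Gamma> x1 y" "dist2 \<Gamma> x2 y" "dist2 \<Gamma> x3 y"
    unfolding rich_vertex_def by (elim bexE conjE)
  have pt: "\<exists>u\<in>H. x = apoint u" if "u \<in> H" "x \<in> fst \<Gamma>" "dist2 \<Gamma> (apoint u) x" for u x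
    using that(2)
  proof (cases rule: vertex_cases)
    case (2 w i)
    with dist2_pt_ln[OF that(1) 2(1,2)] that(3) show ?thesis by simp
  qed auto
  obtain u1 u2 u3 where u: "u1 \<in> H" "x1 = apoint u1" "u2 \<in> H" "x2 = apoint u2" "u3 \<in> H" "x3 = apoint u3"
    using pt[OF v V(2) D(1)] pt[OF v V(3) D(2)] pt[OF v V(4) D(3)] by (elim bexE)
  obtain w where w: "w \<in> H" "y = apoint w"
    using pt[OF u(1) V(1) D(4)[unfolded u(2)]] by (elim bexE)
  have vw: "v \<noteq> w" "\<not> (\<exists>i<q. \<exists>t. w = v + scale t (d i))"
    using ne(1,2) dist2_pt_pt[OF v w(1)] pt_eq_iff[OF w(1) v] unfolding w(2) by auto
  have decomp: "\<exists>i j a b. i < q \<and> j < q \<and> i \<noteq> j \<and> a \<noteq> 0 \<and> b \<noteq> 0 \<and> x = v + scale a (d i)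
      \<and> w - v = scale a (d i) + scale b (d j)"
    if x: "x \<in> H" "dist2 \<Gamma> (apoint v) (apoint x)" "dist2 \<Gamma> (apoint x) (apoint w)" for x
  proof -
    from x(2) obtain i a where ia: "v \<noteq> x" "i < q" "x = v + scale a (d i)"
      unfolding dist2_pt_pt[OF v x(1)] by (elim exE conjE)
    from x(3) obtain j b where jb: "x \<noteq> w" "j < q" "w = x + scale b (d j)"
      unfolding dist2_pt_pt[OF x(1) w(1)] by (elim exE conjE)
    have "i \<noteq> j"
    proof
      assume "i = j"
      then have "w = v + scale (a + b) (d i)" using ia jb by (simp add: scale_left_distrib add.assoc)
      with vw(2) ia(2) show False by auto
    qed
    moreover have "a \<noteq> 0" "b \<noteq> 0" using ia(1,3) jb(1,3) by auto
    moreover have "w - v = scale a (d i) + scale b (d j)" using ia(3) jb(3) by simp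
    ultimately show ?thesis using ia(2,3) jb(2) by (intro exI conjI)
  qed
  obtain i1 j1 a1 b1 where 1: "i1 < q" "j1 < q" "i1 \<noteq> j1" "a1 \<noteq> 0" "b1 \<noteq> 0" "u1 = v + scale a1 (d i1)"
    "w - v = scale a1 (d i1) + scale b1 (d j1)"
    using decomp[OF u(1) D(1)[unfolded u(2)] D(4)[unfolded u(2) w(2)]] by (elim exE conjE)
  have other: "x = u1 \<or> x = v + scale b1 (d j1)"
    if x: "x \<in> H" "dist2 \<Gamma> (apoint v) (apoint x)" "dist2 \<Gamma> (apoint x) (apoint w)" for x
  proof -
    obtain i j a b where 2: "i < q" "j < q" "i \<noteq> j" "a \<noteq> 0" "b \<noteq> 0" "x = v + scale a (d i)"
      "w - v = scale a (d i) + scale b (d j)"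
      using decomp[OF x] by (elim exE conjE)
    have "scale a (d i) + scale b (d j) = scale a1 (d i1) + scale b1 (d j1)" using 1(7) 2(7) by simp
    from d_two_term_unique[OF 2(1,2) 1(1,2) 2(3) 1(3) 2(4,5) 1(4,5) this]
    show ?thesis using 1(6) 2(6) by auto
  qed
  have "u2 = v + scale b1 (d j1)"
    using other[OF u(3) D(2)[unfolded u(4)] D(5)[unfolded u(4) w(2)]] ne(3) u by auto
  moreover have "u3 = v + scale b1 (d j1)"
    using other[OF u(5) D(3)[unfolded u(6)] D(6)[unfolded u(6) w(2)]] ne(4) u by auto
  ultimately show False using ne(5) u by simp
qed

lemma not_vertex_transitive: "\<not> vertex_transitive \<Gamma>"
proof
  assume vt: "vertex_transitive \<Gamma>"
  have 0: "0 \<in> H" by (rule subspace_0[OF subspace_H])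
  have q0: "0 < q" using q_gt_2 by simp
  obtain f where f: "graph_automorphism \<Gamma> f" "f (aline 0 0) = apoint 0"
    using vt ln_vertex[OF 0 q0] pt_vertex[OF 0] unfolding vertex_transitive_def by metis
  from rich_vertex_automorphism[OF f(1) ln_vertex[OF 0 q0] rich_line[OF 0 q0]] not_rich_point[OF 0] f(2)
  show False by simp
qed

text \<open>An affine point lies on one line for each point of the arc, and a line has one affine
  point for each scalar. The two degrees agree because the arc is as large as the field.\<close>

lemma regular: "regular_graph \<Gamma>"
  unfolding regular_graph_def
proof (intro exI[of _ q] ballI)
  fix x assume "x \<in> fst \<Gamma>"
  then show "card {y \<in> snd \<Gamma>. x \<in> y} = q"
  proof (cases rule: vertex_cases)
    case (1 v)
    have "{y \<in> snd \<Gamma>. x \<in> y} = (\<lambda>i. {apoint v, aline v i}) ` {..<q}"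
    proof
      show "{y \<in> snd \<Gamma>. x \<in> y} \<subseteq> (\<lambda>i. {apoint v, aline v i}) ` {..<q}"
      proof
        fix y assume "y \<in> {y \<in> snd \<Gamma>. x \<in> y}"
        then obtain w i where y: "y = {apoint w, aline w i}" "w \<in> H" "i < q" "apoint v \<in> y"
          unfolding edges_eq 1(2) by auto
        then have "apoint v = apoint w" using pt_neq_ln[OF 1(1) y(3), of w] by auto
        then have "v = w" using pt_eq_iff[OF 1(1) y(2)] by simp
        with y show "y \<in> (\<lambda>i. {apoint v, aline v i}) ` {..<q}" by auto
      qed
      show "(\<lambda>i. {apoint v, aline v i}) ` {..<q} \<subseteq> {y \<in> snd \<Gamma>. x \<in> y}"
        using 1 unfolding edges_eq by auto
    qed
    moreover have "inj_on (\<lambda>i. {apoint v, aline v i}) {..<q}"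
    proof (rule inj_onI)
      fix i j assume ij: "i \<in> {..<q}" "j \<in> {..<q}" "{apoint v, aline v i} = {apoint v, aline v j}"
      then have "aline v i = aline v j" by (auto simp: doubleton_eq_iff)
      with ij ln_eq_iff[OF 1(1) 1(1), of i j] show "i = j" by simp
    qed
    ultimately show ?thesis by (simp add: card_image)
  next
    case (2 v i)
    let ?f = "\<lambda>t. {apoint (v + scale t (d i)), aline v i}"
    have "{y \<in> snd \<Gamma>. x \<in> y} = range ?f"
    proof
      show "{y \<in> snd \<Gamma>. x \<in> y} \<subseteq> range ?f"
      proof
        fix y assume "y \<in> {y \<in> snd \<Gamma>. x \<in> y}"
        then obtain w j where y: "y = {apoint w, aline w j}" "w \<in> H" "j < q" "aline v i \<in> y"
          unfolding edges_eq 2(3) by auto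
        then have eq: "aline w j = aline v i" using pt_neq_ln[OF y(2) 2(2), of v] by auto
        then obtain t where t: "w = v + scale t (d i)"
          using ln_eq_iff[OF y(2) 2(1) y(3) 2(2)] by auto
        have "y = ?f t" unfolding y(1) eq by (simp only: t)
        then show "y \<in> range ?f" by (rule range_eqI)
      qed
      show "range ?f \<subseteq> {y \<in> snd \<Gamma>. x \<in> y}"
      proof
        fix y assume "y \<in> range ?f"
        then obtain t where y: "y = ?f t" by (elim rangeE)
        have "y \<in> snd \<Gamma>" unfolding y edge_pt_ln[OF H_add_d[OF 2(1,2)] 2(1,2)] by (rule exI[of _ t]) (rule refl)
        then show "y \<in> {y \<in> snd \<Gamma>. x \<in> y}" by (simp add: y 2(3))
      qed
    qed
    moreover have "inj ?f"
    proof (rule injI)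
      fix s t assume "?f s = ?f t"
      then have "apoint (v + scale s (d i)) = apoint (v + scale t (d i))"
        using pt_neq_ln[OF H_add_d[OF 2(1,2)] 2(2)] by (auto simp: doubleton_eq_iff)
      then show "s = t"
        using d_nonzero[OF 2(2)] by (simp add: pt_eq_iff[OF H_add_d[OF 2(1,2)] H_add_d[OF 2(1,2)]])
    qed
    ultimately show ?thesis by (simp add: card_image card_field)
  qed
qed

end

section \<open>The action of the collineations on the graph\<close>

context arc_frame
begin

lemma Gamma_action_induced:
  assumes "x \<in> fst \<Gamma>"
  shows "Gamma_action scale H K (induced UNIV \<phi>) x = \<phi> ` x"
proof -
  have x: "subspace x \<and> (\<exists>u\<in>x. u \<noteq> 0)"
    using assms
  proof (cases rule: vertex_cases)
    case (1 v)
    then show ?thesis using e_plus_nonzero[OF 1(1)] by (auto simp: apoint_def intro!: bexI[of _ "e + v"] span_base)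
  next
    case (2 v i)
    then show ?thesis using e_plus_nonzero[OF 2(1)] by (auto simp: aline_def intro!: bexI[of _ "e + v"] span_base)
  qed
  then have sub: "subspace x" ..
  have "\<Union> (pg_points scale x) = x"
  proof
    show "\<Union> (pg_points scale x) \<subseteq> x" by (auto simp: pg_points_def)
    have nz: "u \<in> \<Union> (pg_points scale x)" if "u \<in> x" "u \<noteq> 0" for u
    proof (rule UnionI)
      show "span {u} \<in> pg_points scale x" unfolding pg_points_iff[OF sub] using that by (intro bexI[of _ u]) simp_all
    qed (simp add: span_base)
    show "x \<subseteq> \<Union> (pg_points scale x)"
    proof
      fix u assume u: "u \<in> x"
      show "u \<in> \<Union> (pg_points scale x)"
      proof (cases "u = 0")
        \<comment> \<open>The zero vector belongs to every point, so it is covered as soon as x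
          contains some point.\<close>
        case True
        from x obtain u' where u': "u' \<in> x" "u' \<noteq> 0" by auto
        show ?thesis
        proof (rule UnionI)
          show "span {u'} \<in> pg_points scale x" unfolding pg_points_iff[OF sub] using u' by (intro bexI[of _ u']) simp_all
        qed (simp add: True span_zero)
      qed (rule nz[OF u])
    qed
  qed
  moreover have "induced UNIV \<phi> y = \<phi> ` y" if "y \<in> pg_points scale x" for y
  proof -
    have "y \<in> pg_points scale UNIV" using that by (simp add: pg_points_def)
    then show ?thesis by (simp add: induced_def)
  qed
  then have "(\<Union>y\<in>pg_points scale x. induced UNIV \<phi> y) = (\<Union>y\<in>pg_points scale x. \<phi> ` y)" by simp
  ultimately show ?thesis
    unfolding Gamma_action_def using assms by (simp flip: image_Union)
qed

lemma Gamma_action_outside: "x \<notin> fst \<Gamma> \<Longrightarrow> Gamma_action scale H K g x = x"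
  by (simp add: Gamma_action_def)

context
  fixes \<sigma> \<pi> c \<phi> a w
  assumes f: "frame_map \<sigma> \<pi> c \<phi>" and e: "\<phi> e = scale a e + w" and a: "a \<noteq> 0" and w: "w \<in> H"
begin

text \<open>This is the affine map of H induced by \<phi>: the image of \<open>e + v\<close> is
  scaled back to have \<open>e\<close>-coefficient 1.\<close>

definition "aff v = scale (inverse a) (w + \<phi> v)"

lemma phi_H: "v \<in> H \<Longrightarrow> \<phi> v \<in> H" using frame_map_image_H[OF f] by auto

lemma aff_H: "v \<in> H \<Longrightarrow> aff v \<in> H"
  by (simp add: aff_def subspace_scale subspace_add subspace_H w phi_H)

lemma phi_e_plus: "\<phi> (e + v) = scale a (e + aff v)"
  using semilinear_onD(2)[OF frame_mapD(1)[OF f], of e v] a e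
  by (simp add: aff_def scale_right_distrib add.assoc)

lemma image_apoint: "v \<in> H \<Longrightarrow> \<phi> ` apoint v = apoint (aff v)"
proof -
  assume v: "v \<in> H"
  have "\<phi> ` apoint v = span {scale a (e + aff v)}"
    unfolding apoint_def using semilinear_on_image_span[OF frame_mapD(1)[OF f], of "{e + v}"] by (simp add: phi_e_plus)
  also have "\<dots> = apoint (aff v)"
    unfolding apoint_def using span_image_scale[of "{e + aff v}" "\<lambda>_. a"] a by simp
  finally show ?thesis .
qed

lemma image_aline:
  assumes "v \<in> H" "i < q"
  shows "\<phi> ` aline v i = aline (aff v) (\<pi> i)"
proof -
  let ?u = "e + aff v" and ?d = "d (\<pi> i)"
  have i: "\<pi> i < q" "c i \<noteq> 0" using frame_mapD(4,6)[OF f assms(2)] by simp_all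
  have ud: "?u \<noteq> ?d" using e_plus_d_independent(2)[OF aff_H[OF assms(1)] i(1)] .
  have "\<phi> ` aline v i = span {scale a ?u, scale (c i) ?d}"
    unfolding aline_def using semilinear_on_image_span[OF frame_mapD(1)[OF f], of "{e + v, d i}"]
    by (simp add: phi_e_plus frame_mapD(5)[OF f assms(2)])
  \<comment> \<open>The two spanning vectors are scaled by different factors, so the factor is made
    a function of the vector; this is consistent because the vectors differ.\<close>
  also have "{scale a ?u, scale (c i) ?d} = (\<lambda>x. scale (if x = ?u then a else c i) x) ` {?u, ?d}"
    using ud by auto
  also have "span \<dots> = aline (aff v) (\<pi> i)"
    unfolding aline_def using a i(2) by (intro span_image_scale) simp_all
  finally show ?thesis .
qed

lemma action_automorphism: "graph_automorphism \<Gamma> (Gamma_action scale H K (induced UNIV \<phi>))"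
proof -
  let ?g = "Gamma_action scale H K (induced UNIV \<phi>)"
  have inj\<phi>: "inj \<phi>" using frame_map_bij_UNIV(1)[OF f e a w] by (rule bij_is_inj)
  have g_pt: "?g (apoint v) = apoint (aff v)" if "v \<in> H" for v
    by (simp add: Gamma_action_induced[OF pt_vertex[OF that]] image_apoint[OF that])
  have g_ln: "?g (aline v i) = aline (aff v) (\<pi> i)" if "v \<in> H" "i < q" for v i
    by (simp add: Gamma_action_induced[OF ln_vertex[OF that]] image_aline[OF that])
  have pi: "\<pi> i < q" if "i < q" for i by (rule frame_mapD(6)[OF f that])
  have "?g ` fst \<Gamma> \<subseteq> fst \<Gamma>"
  proof
    fix y assume "y \<in> ?g ` fst \<Gamma>"
    then obtain x where x: "x \<in> fst \<Gamma>" "y = ?g x" by (elim imageE)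
    from x(1) show "y \<in> fst \<Gamma>"
    proof (cases rule: vertex_cases)
      case (1 v)
      then show ?thesis using g_pt[OF 1(1)] pt_vertex[OF aff_H[OF 1(1)]] x(2) by simp
    next
      case (2 v i)
      then show ?thesis using g_ln[OF 2(1,2)] ln_vertex[OF aff_H[OF 2(1)] pi[OF 2(2)]] x(2) by simp
    qed
  qed
  moreover have "inj_on ?g (fst \<Gamma>)"
    by (rule inj_onI) (simp add: Gamma_action_induced inj_image_eq_iff[OF inj\<phi>])
  moreover have "finite (Pow (UNIV :: 'v set))" by (simp only: finite_Pow_iff finite_UNIV_v)
  then have "finite (fst \<Gamma>)" by (rule finite_subset[rotated]) auto
  ultimately have "bij_betw ?g (fst \<Gamma>) (fst \<Gamma>)" by (simp add: bij_betw_def endo_inj_surj)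
  then have perm: "?g permutes fst \<Gamma>" by (rule bij_imp_permutes) (rule Gamma_action_outside)
  have pt_ln: "{?g (apoint v), ?g (aline w' i)} \<in> snd \<Gamma> \<longleftrightarrow> {apoint v, aline w' i} \<in> snd \<Gamma>"
    if vwi: "v \<in> H" "w' \<in> H" "i < q" for v w' i
  proof -
    have "{apoint v, aline w' i} \<in> snd \<Gamma> \<longleftrightarrow> apoint v \<subseteq> aline w' i"
      by (simp only: edge_pt_ln[OF vwi] pt_subset_ln[OF vwi])
    also have "\<dots> \<longleftrightarrow> \<phi> ` apoint v \<subseteq> \<phi> ` aline w' i" by (simp only: inj_image_subset_iff[OF inj\<phi>])
    also have "\<dots> \<longleftrightarrow> {apoint (aff v), aline (aff w') (\<pi> i)} \<in> snd \<Gamma>"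
      using vwi by (simp only: image_apoint image_aline edge_pt_ln[OF aff_H aff_H pi] pt_subset_ln[OF aff_H aff_H pi])
    finally show ?thesis using vwi by (simp only: g_pt g_ln)
  qed
  have "{u, v} \<in> snd \<Gamma> \<longleftrightarrow> {?g u, ?g v} \<in> snd \<Gamma>" if u: "u \<in> fst \<Gamma>" and v: "v \<in> fst \<Gamma>" for u v
    using u
  proof (cases rule: vertex_cases)
    case U: (1 x)
    from v show ?thesis
    proof (cases rule: vertex_cases)
      case (1 y)
      then show ?thesis using U edge_pt_pt aff_H by (simp add: g_pt)
    next
      case (2 y j)
      then show ?thesis using U pt_ln[OF U(1) 2(1,2)] by simp
    qed
  next
    case U: (2 x i)
    from v show ?thesis
    proof (cases rule: vertex_cases)
      case (1 y)
      then show ?thesis using U pt_ln[OF 1(1) U(1,2)] by (simp add: insert_commute)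
    next
      case (2 y j)
      then show ?thesis using U edge_ln_ln aff_H pi by (simp add: g_ln)
    qed
  qed
  with perm show ?thesis by (simp add: graph_automorphism_def)
qed

end

lemma Gamma_action_hom: "Gamma_action scale H K \<in> hom stab_UNIV (graph_Aut \<Gamma>)"
proof (rule homI)
  fix g assume "g \<in> carrier stab_UNIV"
  then obtain \<sigma> \<pi> c \<phi> a w where f: "frame_map \<sigma> \<pi> c \<phi>" "\<phi> e = scale a e + w" "a \<noteq> 0" "w \<in> H" "g = induced UNIV \<phi>"
    by (rule stab_UNIV_E)
  show "Gamma_action scale H K g \<in> carrier (graph_Aut \<Gamma>)"
    using action_automorphism[OF f(1-4)] by (simp add: graph_Aut_def map_group_def f(5))
  fix g' assume "g' \<in> carrier stab_UNIV"
  then obtain \<tau> \<rho> b \<psi> r u where p: "frame_map \<tau> \<rho> b \<psi>" "\<psi> e = scale r e + u" "r \<noteq> 0" "u \<in> H" "g' = induced UNIV \<psi>"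
    by (rule stab_UNIV_E)
  have comp: "g \<circ> g' = induced UNIV (\<phi> \<circ> \<psi>)"
    unfolding f(5) p(5) by (rule induced_comp[OF frame_map_bij_UNIV(2)[OF p(1-4)] subspace_UNIV, symmetric])
  have "Gamma_action scale H K (g \<circ> g') x = Gamma_action scale H K g (Gamma_action scale H K g' x)" for x
  proof (cases "x \<in> fst \<Gamma>")
    case True
    have "Gamma_action scale H K g' x \<in> fst \<Gamma>"
      using permutes_in_image[OF graph_automorphismD(1)[OF action_automorphism[OF p(1-4)]], of x] True
      by (simp add: p(5))
    moreover have "Gamma_action scale H K (g \<circ> g') x = (\<phi> \<circ> \<psi>) ` x"
      unfolding comp by (rule Gamma_action_induced[OF True])
    ultimately show ?thesis
      by (simp add: f(5) p(5) Gamma_action_induced True image_comp)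
  qed (simp add: Gamma_action_outside)
  then show "Gamma_action scale H K (g \<otimes>\<^bsub>stab_UNIV\<^esub> g') =
      Gamma_action scale H K g \<otimes>\<^bsub>graph_Aut \<Gamma>\<^esub> Gamma_action scale H K g'"
    by (simp add: PGammaL_simps graph_Aut_def map_group_def fun_eq_iff)
qed

text \<open>If two semilinear maps agree on the affine points up to scalars, say
  \<open>\<phi> (e + v) = k v * \<psi> (e + v)\<close>, then comparing \<open>e\<close>-coefficients in \<open>\<phi> v = \<phi> (e + v) - \<phi> e\<close> gives
  \<open>k v = k 0\<close>, so they also agree on the points at infinity.\<close>

lemma Gamma_action_inj: "inj_on (Gamma_action scale H K) (carrier stab_UNIV)"
proof (rule inj_onI)
  fix g g' assume g: "g \<in> carrier stab_UNIV" and g': "g' \<in> carrier stab_UNIV"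
    and eq: "Gamma_action scale H K g = Gamma_action scale H K g'"
  from g obtain \<sigma> \<pi> c \<phi> a w where f: "frame_map \<sigma> \<pi> c \<phi>" "\<phi> e = scale a e + w" "a \<noteq> 0" "w \<in> H" "g = induced UNIV \<phi>"
    by (rule stab_UNIV_E)
  from g' obtain \<tau> \<rho> b \<psi> r u where p: "frame_map \<tau> \<rho> b \<psi>" "\<psi> e = scale r e + u" "r \<noteq> 0" "u \<in> H" "g' = induced UNIV \<psi>"
    by (rule stab_UNIV_E)
  note add\<phi> = semilinear_onD(2)[OF frame_mapD(1)[OF f(1)] UNIV_I UNIV_I]
    and add\<psi> = semilinear_onD(2)[OF frame_mapD(1)[OF p(1)] UNIV_I UNIV_I]
  note b\<phi> = frame_map_bij_UNIV(2)[OF f(1-4)] and b\<psi> = frame_map_bij_UNIV(2)[OF p(1-4)]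
  have pt: "\<phi> ` apoint v = \<psi> ` apoint v" if v: "v \<in> H" for v
    using fun_cong[OF eq, of "apoint v"] unfolding f(5) p(5) by (simp add: Gamma_action_induced pt_vertex[OF v])
  have "\<exists>k. \<phi> (e + v) = scale k (\<psi> (e + v)) \<and> k \<noteq> 0" if v: "v \<in> H" for v
  proof -
    have "span {\<phi> (e + v)} = span {\<psi> (e + v)}"
      using pt[OF v] semilinear_bij_span(1)[OF b\<phi> subspace_UNIV, of "e + v"]
        semilinear_bij_span(1)[OF b\<psi> subspace_UNIV, of "e + v"] by (simp add: apoint_def)
    moreover have "\<phi> (e + v) \<noteq> 0"
      using semilinear_bij_span(3)[OF b\<phi> subspace_UNIV, of "e + v"] e_plus_nonzero[OF v] by simp
    ultimately show ?thesis using span_singleton_eq_iff[of "\<phi> (e + v)" "\<psi> (e + v)"] by auto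
  qed
  then obtain k where k: "\<And>v. v \<in> H \<Longrightarrow> \<phi> (e + v) = scale (k v) (\<psi> (e + v)) \<and> k v \<noteq> 0"
    by metis
  have 0: "0 \<in> H" by (rule subspace_0[OF subspace_H])
  have lin: "\<phi> v = scale (k 0) (\<psi> v)" if v: "v \<in> H" for v
  proof -
    have H: "\<phi> v \<in> H" "\<psi> v \<in> H" using v frame_map_image_H[OF f(1)] frame_map_image_H[OF p(1)] by auto
    have e: "\<phi> e = scale (k 0) (\<psi> e)" using k[OF 0] by simp
    have "\<phi> e + \<phi> v = scale (k v) (\<psi> e) + scale (k v) (\<psi> v)"
      using k[OF v] by (simp add: add\<phi> add\<psi> scale_right_distrib)
    then have "scale (k 0 * r) e + (scale (k 0) u + \<phi> v) = scale (k v * r) e + (scale (k v) u + scale (k v) (\<psi> v))"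
      unfolding e p(2) by (simp add: scale_right_distrib add.assoc)
    from decompose_unique[OF _ _ this] H p(4) have "k 0 * r = k v * r"
      "scale (k 0) u + \<phi> v = scale (k v) u + scale (k v) (\<psi> v)"
      by (simp_all add: subspace_add subspace_scale subspace_H)
    then show ?thesis using p(3) by simp
  qed
  show "g = g'"
  proof
    fix x
    show "g x = g' x"
    proof (cases "x \<in> pg_points scale UNIV")
      case True
      show ?thesis
      proof (cases "x \<in> pg_points scale H")
        case True
        then obtain v where v: "v \<in> H" "v \<noteq> 0" "x = span {v}" unfolding pg_points_iff[OF subspace_H] by (elim bexE conjE)
        have "span {\<phi> v} = span {\<psi> v}"
          using span_image_scale[of "{\<psi> v}" "\<lambda>_. k 0"] k[OF 0] lin[OF v(1)] by simp
        then show ?thesis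
          unfolding f(5) p(5) v(3) induced_span[OF b\<phi> subspace_UNIV UNIV_I] induced_span[OF b\<psi> subspace_UNIV UNIV_I] .
      next
        case False
        with True have "x \<in> apoint ` H" using affine_points_eq by (auto simp: affine_points_def)
        then obtain v where "v \<in> H" "x = apoint v" by (elim imageE)
        with pt True show ?thesis unfolding f(5) p(5) by (simp add: induced_def)
      qed
    qed (simp add: f(5) p(5) induced_def)
  qed
qed

lemma Gamma_action_mon: "Gamma_action scale H K \<in> mon stab_UNIV (graph_Aut \<Gamma>)"
  using Gamma_action_hom Gamma_action_inj by (simp add: mon_def)

text \<open>Transposing two arc directions with all coefficients 1 respects the zero sum, so it is
  admissible for both values of \<open>q\<close>. Together with a translation it moves the flag
  given by v and i to the one given by u and j.\<close>

lemma edge_transitive: "edge_transitive \<Gamma>"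
  unfolding edge_transitive_def
proof (intro ballI)
  fix x y assume "x \<in> snd \<Gamma>" "y \<in> snd \<Gamma>"
  then obtain v i u j where x: "x = {apoint v, aline v i}" "v \<in> H" "i < q" and y: "y = {apoint u, aline u j}" "u \<in> H" "j < q"
    unfolding edges_eq by (elim CollectE exE conjE)
  let ?t = "Transposition.transpose i j"
  have t: "?t permutes {..<q}" using x(3) y(3) by (simp add: permutes_swap_id)
  have ex: "\<exists>\<phi>. frame_map id ?t (\<lambda>_. 1) \<phi> \<and> \<phi> e = z" for z
  proof -
    have "\<exists>\<phi>. semilinear_on UNIV id \<phi> \<and> \<phi> e = z \<and> (\<forall>i<q. \<phi> (d i) = scale 1 (d (?t i)))"
      by (rule exists_frame_map[OF field_automorphism_id t]) simp
    then obtain \<phi> where "semilinear_on UNIV id \<phi>" "\<phi> e = z" "\<forall>i<q. \<phi> (d i) = scale 1 (d (?t i))"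
      by (elim exE conjE)
    with t show ?thesis by (intro exI[of _ \<phi>]) (simp add: frame_map_def)
  qed
  obtain \<psi> where \<psi>: "frame_map id ?t (\<lambda>_. 1) \<psi>" using ex[of e] by (elim exE conjE)
  \<comment> \<open>The translation must carry the image of v to u. That image is read off from the
    auxiliary \<psi>, as it does not depend on where \<open>e\<close> is sent.\<close>
  let ?w = "u - \<psi> v"
  have w: "?w \<in> H" using y(2) frame_map_image_H[OF \<psi>] x(2) by (auto intro!: subspace_diff subspace_H)
  obtain \<phi> where \<phi>: "frame_map id ?t (\<lambda>_. 1) \<phi>" and e: "\<phi> e = scale 1 e + ?w"
    using ex[of "scale 1 e + ?w"] by (elim exE conjE)
  have "\<phi> v = \<psi> v" by (rule frame_map_cong[OF \<phi> \<psi> _ x(2)]) simp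
  then have aff: "aff \<phi> 1 ?w v = u" by (simp add: aff_def[OF \<phi> e one_neq_zero w])
  let ?g = "Gamma_action scale H K (induced UNIV \<phi>)"
  have "?g ` x = {apoint (aff \<phi> 1 ?w v), aline (aff \<phi> 1 ?w v) (?t i)}"
    using Gamma_action_induced[OF pt_vertex[OF x(2)], of \<phi>] Gamma_action_induced[OF ln_vertex[OF x(2,3)], of \<phi>]
      image_apoint[OF \<phi> e one_neq_zero w x(2)] image_aline[OF \<phi> e one_neq_zero w x(2,3)]
    by (simp add: x(1))
  then have "?g ` x = y" unfolding aff y(1) by simp
  with action_automorphism[OF \<phi> e one_neq_zero w]
  show "\<exists>f. graph_automorphism \<Gamma> f \<and> f ` x = y" by (intro exI conjI)
qed

lemma semisymmetric: "semisymmetric \<Gamma>"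
  using regular edge_transitive not_vertex_transitive by (simp add: semisymmetric_def)

end

section \<open>All automorphisms of the graph\<close>

context arc_frame
begin

text \<open>The difference of the two sides involves at most the directions k, k', m and m'. The
  nonzero coefficient \<open>r\<close> is what makes the third direction recoverable.\<close>

lemma d_three_term_unique:
  assumes idx: "k < q" "k' < q" "m < q" "m' < q" "k \<noteq> k'" "m \<notin> {k, k'}" "m' \<notin> {k, k'}"
    and eq: "scale s (d k) + scale t (d k') + scale r (d m) = scale s' (d k) + scale t' (d k') + scale r' (d m')"
    and r: "r \<noteq> 0"
  shows "m = m' \<and> s = s'"
proof -
  define c where "c i = (if i = k then s - s' else 0) + (if i = k' then t - t' else 0)
    + (if i = m then r else 0) - (if i = m' then r' else 0)" for i
  let ?S = "{k, k', m, m'}"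
  have "(\<Sum>i\<in>?S. scale (c i) (d i)) = scale (s - s') (d k) + scale (t - t') (d k') + scale r (d m) - scale r' (d m')"
    unfolding c_def scale_left_distrib scale_left_diff_distrib[of "_ + _"] sum.distrib sum_subtractf
    by (simp only: sum_delta_d finite_insert finite.emptyI insert_iff simp_thms)
  then have 0: "(\<Sum>i\<in>?S. scale (c i) (d i)) = 0" using eq by (simp add: scale_left_diff_distrib algebra_simps)
  have card: "card ?S \<le> 4" by (simp add: card_insert_if)
  have "c k = 0" "c m = 0" by (rule d_independent[OF _ card 0], use idx in auto)+
  then show ?thesis using idx r by (auto simp: c_def split: if_splits)
qed

text \<open>Skew lines of the graph have at most one common transversal, whereas parallel lines in a
  common plane with a third direction have \<open>q\<close>: this is how automorphisms recognise parallelism.\<close>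

lemma transversal_unique:
  assumes H: "x \<in> H" "y \<in> H" "u1 \<in> H" "u2 \<in> H"
    and idx: "k < q" "k' < q" "m1 < q" "m2 < q" "k \<noteq> k'"
    and skew: "\<not> dist2 \<Gamma> (aline x k) (aline y k')"
    and 1: "dist2 \<Gamma> (aline u1 m1) (aline x k)" "dist2 \<Gamma> (aline u1 m1) (aline y k')"
    and 2: "dist2 \<Gamma> (aline u2 m2) (aline x k)" "dist2 \<Gamma> (aline u2 m2) (aline y k')"
  shows "aline u1 m1 = aline u2 m2"
proof -
  have skew': "x + scale s (d k) \<noteq> y + scale t (d k')" for s t
    using skew idx(5) unfolding dist2_ln_ln[OF H(1,2) idx(1,2)] ln_eq_iff[OF H(1,2) idx(1,2)] by auto
  \<comment> \<open>A transversal joins the points with parameters s and t of the two lines, so it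
    writes \<open>y - x\<close> in the directions k, k' and its own. Its direction differs from k
    and k', since otherwise the two lines would meet.\<close>
  have tr: "\<exists>s t r. r \<noteq> 0 \<and> m \<notin> {k, k'} \<and> u + scale s' (d m) = x + scale s (d k) \<and>
      y - x = scale s (d k) + scale (- t) (d k') + scale r (d m)"
    if u: "u \<in> H" "m < q" "u + scale s' (d m) = x + scale s (d k)" "u + scale t' (d m) = y + scale t (d k')"
    for u m s s' t t'
  proof -
    let ?r = "t' - s'"
    have yx: "y + scale t (d k') = x + scale s (d k) + scale ?r (d m)"
      unfolding u(3,4)[symmetric] by (simp add: scale_left_diff_distrib algebra_simps)
    have "?r \<noteq> 0" using yx skew'[of s t] by auto
    moreover have "m \<noteq> k"
    proof
      assume "m = k"
      then have "x + scale (s + ?r) (d k) = y + scale t (d k')" using yx by (simp add: scale_left_distrib add.assoc)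
      with skew' show False by simp
    qed
    moreover have "m \<noteq> k'"
    proof
      assume "m = k'"
      then have "y + scale (t - ?r) (d k') = x + scale s (d k)"
        using yx unfolding scale_left_diff_distrib[of t] by (simp add: algebra_simps)
      with skew'[of s "t - ?r"] show False by simp
    qed
    moreover have "y - x = scale s (d k) + scale (- t) (d k') + scale ?r (d m)"
      using yx by (simp add: algebra_simps)
    ultimately show ?thesis using u(3) by (intro exI[of _ s] exI[of _ t] exI[of _ ?r]) simp
  qed
  have tr': "\<exists>s' s t r. r \<noteq> 0 \<and> m \<notin> {k, k'} \<and> u + scale s' (d m) = x + scale s (d k) \<and>
      y - x = scale s (d k) + scale (- t) (d k') + scale r (d m)"
    if u: "u \<in> H" "m < q" "dist2 \<Gamma> (aline u m) (aline x k)" "dist2 \<Gamma> (aline u m) (aline y k')" for u m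
  proof -
    from u(3) obtain s' s where A: "u + scale s' (d m) = x + scale s (d k)"
      unfolding dist2_ln_ln[OF u(1) H(1) u(2) idx(1)] by (elim exE conjE)
    from u(4) obtain t' t where B: "u + scale t' (d m) = y + scale t (d k')"
      unfolding dist2_ln_ln[OF u(1) H(2) u(2) idx(2)] by (elim exE conjE)
    from tr[OF u(1,2) A B] show ?thesis by (rule exI[of _ s'])
  qed
  obtain s1' s1 t1 r1 where A: "r1 \<noteq> 0" "m1 \<notin> {k, k'}" "u1 + scale s1' (d m1) = x + scale s1 (d k)"
      "y - x = scale s1 (d k) + scale (- t1) (d k') + scale r1 (d m1)"
    using tr'[OF H(3) idx(3) 1] by (elim exE conjE)
  obtain s2' s2 t2 r2 where B: "m2 \<notin> {k, k'}" "u2 + scale s2' (d m2) = x + scale s2 (d k)"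
      "y - x = scale s2 (d k) + scale (- t2) (d k') + scale r2 (d m2)"
    using tr'[OF H(4) idx(4) 2] by (elim exE conjE)
  have "m1 = m2 \<and> s1 = s2"
    by (rule d_three_term_unique[OF idx(1-5) A(2) B(1) trans[OF A(4)[symmetric] B(3)] A(1)])
  then have m: "m1 = m2" and "u1 + scale s1' (d m1) = u2 + scale s2' (d m1)" using A(3) B(2) by simp_all
  then have "u1 = u2 + scale (s2' - s1') (d m1)" by (simp add: scale_left_diff_distrib algebra_simps)
  then show ?thesis using ln_shift m by metis
qed

lemma span_d_minus:
  assumes q: "q = n + 2" and i: "i < q"
  shows "span (d ` ({..<q} - {i})) = H"
proof
  let ?S = "d ` ({..<q} - {i})"
  show "span ?S \<subseteq> H" using d_in_H by (intro span_minimal subspace_H) auto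
  have "d i + (\<Sum>j\<in>{..<q} - {i}. d j) = 0"
    using sum_d[OF q] sum.remove[of "{..<q}" i d] i by simp
  then have "d i = - (\<Sum>j\<in>{..<q} - {i}. d j)" by (simp add: eq_neg_iff_add_eq_0)
  then have "d i \<in> span ?S" by (auto intro!: span_neg span_sum intro: span_base)
  moreover have "d j \<in> span ?S" if "j < q" "j \<noteq> i" for j using that by (intro span_base) auto
  ultimately have "d ` {..<q} \<subseteq> span ?S" by auto
  then show "H \<subseteq> span ?S" unfolding span_d[symmetric] by (rule span_minimal) simp
qed

text \<open>Any vector of H is reached from 0 by steps along the directions in \<open>S\<close>. The
  set is a parameter because one later argument has to avoid a single direction.\<close>

lemma H_induct [consumes 3, case_names zero step]:
  assumes "v \<in> H" and S: "span (d ` S) = H" "S \<subseteq> {..<q}" and "P 0"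
    and "\<And>v j t. v \<in> H \<Longrightarrow> j \<in> S \<Longrightarrow> P v \<Longrightarrow> P (v + scale t (d j))"
  shows "P v"
proof -
  have "v \<in> span (d ` S)" using assms(1) S(1) by simp
  then have "v \<in> H \<and> P v"
  proof (induction rule: span_induct_alt)
    case base
    show ?case using assms(4) by (simp add: subspace_0[OF subspace_H])
  next
    case (step t b y)
    then obtain j where j: "j \<in> S" "b = d j" by auto
    with step assms(5)[of y j t] S(2) H_add_d[of y j t] show ?case by (auto simp: add.commute)
  qed
  then show ?thesis ..
qed

section \<open>A fixed automorphism of the graph in coordinates\<close>

context
  fixes f
  assumes f: "graph_automorphism \<Gamma> f"
begin

lemma aut_inj: "f x = f y \<longleftrightarrow> x = y"
  using permutes_inj[OF graph_automorphismD(1)[OF f]] by (simp add: inj_eq)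

lemma aut_vertex: "f x \<in> fst \<Gamma> \<longleftrightarrow> x \<in> fst \<Gamma>"
  by (rule permutes_in_image[OF graph_automorphismD(1)[OF f]])

lemma aut_point: "v \<in> H \<Longrightarrow> \<exists>v'\<in>H. f (apoint v) = apoint v'"
proof -
  assume v: "v \<in> H"
  have "f (apoint v) \<in> fst \<Gamma>" using pt_vertex[OF v] by (simp add: aut_vertex)
  then show ?thesis
  proof (cases rule: vertex_cases)
    case (2 w i)
    have "rich_vertex \<Gamma> (f (apoint v))" using rich_line[OF 2(1,2)] by (simp add: 2(3))
    then show ?thesis
      using not_rich_point[OF v] by (simp add: rich_vertex_automorphism_iff[OF f pt_vertex[OF v]])
  qed auto
qed

definition "aut_pt v = (SOME v'. v' \<in> H \<and> f (apoint v) = apoint v')"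

lemma aut_pt:
  assumes "v \<in> H"
  shows "aut_pt v \<in> H" "f (apoint v) = apoint (aut_pt v)"
proof -
  have "\<exists>v'. v' \<in> H \<and> f (apoint v) = apoint v'" using aut_point[OF assms] by auto
  from someI_ex[OF this] show "aut_pt v \<in> H" "f (apoint v) = apoint (aut_pt v)"
    by (simp_all add: aut_pt_def)
qed

lemma aut_line: "v \<in> H \<Longrightarrow> i < q \<Longrightarrow> \<exists>j<q. f (aline v i) = aline (aut_pt v) j"
proof -
  assume vi: "v \<in> H" "i < q"
  have "v = v + scale 0 (d i)" by simp
  then have "{apoint v, aline v i} \<in> snd \<Gamma>" unfolding edge_pt_ln[OF vi(1,1,2)] by (rule exI)
  then have edge: "{apoint (aut_pt v), f (aline v i)} \<in> snd \<Gamma>"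
    using graph_automorphismD(2)[OF f pt_vertex[OF vi(1)] ln_vertex[OF vi]] by (simp add: aut_pt[OF vi(1)])
  have "f (aline v i) \<in> fst \<Gamma>" using ln_vertex[OF vi] by (simp add: aut_vertex)
  then show ?thesis
  proof (cases rule: vertex_cases)
    case (1 w)
    then show ?thesis using edge edge_pt_pt[OF aut_pt(1)[OF vi(1)] 1(1)] by simp
  next
    case (2 w j)
    then obtain t where "aut_pt v = w + scale t (d j)"
      using edge edge_pt_ln[OF aut_pt(1)[OF vi(1)] 2(1,2)] by auto
    then have "aline (aut_pt v) j = aline w j" by (rule ln_shift)
    then show ?thesis using 2 by auto
  qed
qed

definition "aut_dir v i = (SOME j. j < q \<and> f (aline v i) = aline (aut_pt v) j)"

lemma aut_dir:
  assumes "v \<in> H" "i < q"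
  shows "aut_dir v i < q" "f (aline v i) = aline (aut_pt v) (aut_dir v i)"
  using someI_ex[OF aut_line[OF assms]] by (simp_all add: aut_dir_def)

text \<open>Two distinct coplanar parallel lines have several transversals. If their images had
  different directions, these would be skew, all transversals would have the same image, and
  \<open>f\<close> would not be injective. If \<open>j = i\<close> or \<open>b = 0\<close>, the two
  lines coincide.\<close>

lemma aut_dir_step:
  assumes v: "v \<in> H" and i: "i < q" and j: "j < q"
  shows "aut_dir (v + scale b (d j)) i = aut_dir v i"
proof -
  let ?v' = "v + scale b (d j)"
  have v': "?v' \<in> H" by (rule H_add_d[OF v j])
  note D = aut_dir[OF v i] and D' = aut_dir[OF v' i]
  show ?thesis
  proof (cases "j = i \<or> b = 0")
    case True
    have "aline ?v' i = aline v i"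
    proof (cases "b = 0")
      case False
      with True show ?thesis using ln_shift[of ?v' v b i] by simp
    qed simp
    then have "aline (aut_pt ?v') (aut_dir ?v' i) = aline (aut_pt v) (aut_dir v i)" using D D' by simp
    then show ?thesis by (simp add: ln_eq_iff[OF aut_pt(1)[OF v'] aut_pt(1)[OF v] D'(1) D(1)])
  next
    case False
    then have ji: "j \<noteq> i" and b: "b \<noteq> 0" by simp_all
    note P = parallel_transversals[OF v i j ji b]
    let ?N = "\<lambda>a. v + scale a (d i)"
    have N: "?N a \<in> H" for a by (rule H_add_d[OF v i])
    note DN = aut_dir[OF N j]
    show ?thesis
    proof (rule ccontr)
      assume "aut_dir ?v' i \<noteq> aut_dir v i"
      then have ne: "aut_dir v i \<noteq> aut_dir ?v' i" by simp
      have "f (aline (?N 0) j) = f (aline (?N 1) j)"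
        unfolding DN(2)
      proof (rule transversal_unique[OF aut_pt(1)[OF v] aut_pt(1)[OF v'] aut_pt(1)[OF N] aut_pt(1)[OF N]
            D(1) D'(1) DN(1) DN(1) ne])
        show "\<not> dist2 \<Gamma> (aline (aut_pt v) (aut_dir v i)) (aline (aut_pt ?v') (aut_dir ?v' i))"
          unfolding D(2)[symmetric] D'(2)[symmetric] dist2_automorphism[OF f ln_vertex[OF v i] ln_vertex[OF v' i]]
          by (rule P(2))
      qed (unfold D(2)[symmetric] D'(2)[symmetric] DN(2)[symmetric]
          dist2_automorphism[OF f ln_vertex[OF N j] ln_vertex[OF v i]]
          dist2_automorphism[OF f ln_vertex[OF N j] ln_vertex[OF v' i]], (rule P(4,5))+)
      then show False using P(3)[of 0 1] by (simp only: aut_inj zero_neq_one not_False_eq_True)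
    qed
  qed
qed

lemma aut_dir_const:
  assumes "v \<in> H" "i < q"
  shows "aut_dir v i = aut_dir 0 i"
  using assms(1) span_d order_refl
  by (induction rule: H_induct) (simp_all add: aut_dir_step assms(2))

definition "aut_perm i = (if i < q then aut_dir 0 i else i)"

lemma aut_perm_permutes: "aut_perm permutes {..<q}"
proof -
  have 0: "0 \<in> H" by (rule subspace_0[OF subspace_H])
  have "inj_on aut_perm {..<q}"
  proof (rule inj_onI)
    fix i j assume "i \<in> {..<q}" "j \<in> {..<q}" "aut_perm i = aut_perm j"
    then have ij: "i < q" "j < q" "aut_dir 0 i = aut_dir 0 j" by (simp_all add: aut_perm_def)
    then have "f (aline 0 i) = f (aline 0 j)" using aut_dir(2)[OF 0] by simp
    then show "i = j" using ln_eq_iff[OF 0 0 ij(1,2)] by (simp add: aut_inj)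
  qed
  moreover have "aut_perm ` {..<q} \<subseteq> {..<q}" using aut_dir(1)[OF 0] by (auto simp: aut_perm_def)
  ultimately have "bij_betw aut_perm {..<q} {..<q}" by (simp add: bij_betw_def endo_inj_surj)
  then show ?thesis by (rule bij_imp_permutes) (simp add: aut_perm_def)
qed

lemma aut_perm_less: "i < q \<Longrightarrow> aut_perm i < q"
  using permutes_in_image[OF aut_perm_permutes, of i] by simp

lemma aut_line_eq: "v \<in> H \<Longrightarrow> i < q \<Longrightarrow> f (aline v i) = aline (aut_pt v) (aut_perm i)"
  using aut_dir(2)[of v i] aut_dir_const[of v i] by (simp add: aut_perm_def)

lemma aut_pt_shift:
  assumes v: "v \<in> H" and i: "i < q"
  shows "\<exists>s. aut_pt (v + scale t (d i)) = aut_pt v + scale s (d (aut_perm i))"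
proof -
  have v': "v + scale t (d i) \<in> H" by (rule H_add_d[OF v i])
  have "{apoint (v + scale t (d i)), aline v i} \<in> snd \<Gamma>"
    unfolding edge_pt_ln[OF v' v i] by (rule exI[of _ t]) (rule refl)
  then have "{apoint (aut_pt (v + scale t (d i))), aline (aut_pt v) (aut_perm i)} \<in> snd \<Gamma>"
    using graph_automorphismD(2)[OF f pt_vertex[OF v'] ln_vertex[OF v i]] by (simp add: aut_pt[OF v'] aut_line_eq[OF v i])
  then show ?thesis unfolding edge_pt_ln[OF aut_pt(1)[OF v'] aut_pt(1)[OF v] aut_perm_less[OF i]] .
qed

text \<open>This is \<open>g i v t\<close> of the overview, with \<open>aut_pt\<close> in the role
  of \<open>F\<close> and \<open>aut_perm\<close> in that of \<pi>.\<close>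

definition "aut_coeff v i t = (SOME s. aut_pt (v + scale t (d i)) = aut_pt v + scale s (d (aut_perm i)))"

lemma aut_coeff:
  "v \<in> H \<Longrightarrow> i < q \<Longrightarrow> aut_pt (v + scale t (d i)) = aut_pt v + scale (aut_coeff v i t) (d (aut_perm i))"
  unfolding aut_coeff_def by (rule someI_ex) (rule aut_pt_shift)

text \<open>Both ways round the parallelogram with sides \<open>t * d i\<close> and
  \<open>s * d j\<close> end in the same point. The image directions are independent, so opposite
  sides have equal coefficients.\<close>

lemma aut_coeff_step:
  assumes v: "v \<in> H" and i: "i < q" and j: "j < q" "j \<noteq> i"
  shows "aut_coeff (v + scale s (d j)) i t = aut_coeff v i t"
proof -
  let ?a = "aut_coeff v i t" and ?b = "aut_coeff (v + scale t (d i)) j s"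
    and ?a' = "aut_coeff (v + scale s (d j)) i t" and ?b' = "aut_coeff v j s"
  let ?di = "d (aut_perm i)" and ?dj = "d (aut_perm j)"
  have "aut_pt v + scale ?a ?di + scale ?b ?dj = aut_pt (v + scale t (d i) + scale s (d j))"
    by (simp only: aut_coeff[OF H_add_d[OF v i] j(1)] aut_coeff[OF v i])
  also have "v + scale t (d i) + scale s (d j) = v + scale s (d j) + scale t (d i)" by (simp add: algebra_simps)
  also have "aut_pt \<dots> = aut_pt v + scale ?b' ?dj + scale ?a' ?di"
    by (simp only: aut_coeff[OF H_add_d[OF v j(1)] i] aut_coeff[OF v j(1)])
  finally have eq: "scale (?a' - ?a) ?di = scale (?b - ?b') ?dj"
    by (simp add: scale_left_diff_distrib algebra_simps)
  have "aut_perm i \<noteq> aut_perm j" using permutes_inj[OF aut_perm_permutes] j(2) by (auto dest: injD)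
  from d_pair(1)[OF aut_perm_less[OF i] aut_perm_less[OF j(1)] this eq] show ?thesis by simp
qed

context
  assumes qn: "q = n + 2" and prime_q: "prime q"
begin

text \<open>\<open>aut_coeff_step\<close> excludes steps in the direction i itself, so v is reached
  by the other directions, which span H because the zero sum expresses \<open>d i\<close> through
  them.\<close>

lemma aut_coeff_const:
  assumes "v \<in> H" "i < q"
  shows "aut_coeff v i t = aut_coeff 0 i t"
  using assms(1) span_d_minus[OF qn assms(2)] Diff_subset
  by (induction rule: H_induct) (simp_all add: aut_coeff_step assms(2))

lemma aut_pt_add:
  "v \<in> H \<Longrightarrow> i < q \<Longrightarrow> aut_pt (v + scale t (d i)) = aut_pt v + scale (aut_coeff 0 i t) (d (aut_perm i))"
  using aut_coeff[of v i t] aut_coeff_const[of v i t] by simp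

text \<open>Steps by \<open>t\<close> along all q directions lead back to 0. In the image they give
  a relation whose coefficients are the \<open>aut_coeff 0 i t\<close>, and relations have constant
  coefficients.\<close>

lemma aut_coeff_same:
  assumes i: "i < q"
  shows "aut_coeff 0 i t = aut_coeff 0 0 t"
proof -
  let ?g = "\<lambda>i. aut_coeff 0 i t" and ?r = "inv' aut_perm"
  have r: "?r permutes {..<q}" by (rule permutes_inv[OF aut_perm_permutes])
  have partial: "(\<Sum>i<m. scale t (d i)) \<in> H \<and>
      aut_pt (\<Sum>i<m. scale t (d i)) = aut_pt 0 + (\<Sum>i<m. scale (?g i) (d (aut_perm i)))" if "m \<le> q" for m
    using that
  proof (induction m)
    case 0
    show ?case by (simp add: subspace_0[OF subspace_H])
  next
    case (Suc m)
    then show ?case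
      using aut_pt_add[of "\<Sum>i<m. scale t (d i)" m t] H_add_d[of "\<Sum>i<m. scale t (d i)" m t] by (simp add: add.assoc)
  qed
  have "(\<Sum>i<q. scale t (d i)) = 0" using sum_d[OF qn] by (simp flip: scale_sum_right)
  then have "(\<Sum>i<q. scale (?g i) (d (aut_perm i))) = 0" using partial[of q] by simp
  also have "(\<Sum>i<q. scale (?g i) (d (aut_perm i))) = (\<Sum>i<q. scale (?g (?r i)) (d i))"
    by (subst sum.permute[OF aut_perm_permutes]) (simp add: permutes_inverses[OF aut_perm_permutes])
  finally have 0: "(\<Sum>i<q. scale (?g (?r i)) (d i)) = 0" .
  have "?g i = ?g (?r 0)" if "i < q" for i
    using d_relation(1)[OF 0 aut_perm_less[OF that]] by (simp add: permutes_inverses[OF aut_perm_permutes])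
  from this[OF i] this[of 0] n_lt_q show ?thesis by simp
qed

lemma aut_coeff_linear: "aut_coeff 0 0 x = x * aut_coeff 0 0 1"
proof -
  let ?G = "aut_coeff 0 0"
  have q0: "0 < q" using q_gt_2 by simp
  have H0: "0 \<in> H" by (rule subspace_0[OF subspace_H])
  have cancel: "s = t" if "a + scale s (d (aut_perm 0)) = a + scale t (d (aut_perm 0))" for a s t
    using that d_nonzero[OF aut_perm_less[OF q0]] by simp
  have add: "?G (s + t) = ?G s + ?G t" for s t
  proof (rule cancel)
    show "aut_pt 0 + scale (?G (s + t)) (d (aut_perm 0)) = aut_pt 0 + scale (?G s + ?G t) (d (aut_perm 0))"
      using aut_pt_add[OF H0 q0, of "s + t"] aut_pt_add[OF H0 q0, of s] aut_pt_add[OF H_add_d[OF H0 q0] q0, of s t]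
      by (simp add: scale_left_distrib add.assoc)
  qed
  have "?G 0 + ?G 0 = ?G 0 + 0" using add[of 0 0] by simp
  then have zero: "?G 0 = 0" by (simp only: add_left_cancel)
  have "?G (of_nat k) = of_nat k * ?G 1" for k
    by (induction k) (simp_all add: zero add distrib_right)
  \<comment> \<open>Primality of \<open>q\<close> enters here: the multiples of 1 exhaust the
    field.\<close>
  moreover have "\<exists>k. x = of_nat k"
  proof -
    have "CHAR('f) = q" using CHAR_eq_if_card_prime_power[of q 1] prime_q card_field by simp
    then have "card (of_nat ` {..<q} :: 'f set) = card (UNIV :: 'f set)"
      using inj_on_of_nat_CHAR[where 'f = 'f] by (simp add: card_image card_field)
    then have "of_nat ` {..<q} = (UNIV :: 'f set)" by (intro card_subset_eq) simp_all
    then show ?thesis by auto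
  qed
  ultimately show ?thesis by auto
qed

text \<open>The monomial map with permutation \<open>aut_perm\<close>, constant coefficient
  \<open>?c\<close> and translation part \<open>aut_pt 0\<close> changes like \<open>f\<close> along
  every step in an arc direction, so both agree on points. Lines follow from base vector and
  direction.\<close>

lemma aut_is_collineation: "\<exists>g\<in>carrier stab_UNIV. Gamma_action scale H K g = f"
proof -
  let ?c = "aut_coeff 0 0 1"
  have q0: "0 < q" using q_gt_2 by simp
  have H0: "0 \<in> H" by (rule subspace_0[OF subspace_H])
  have shift: "aut_pt (v + scale t (d i)) = aut_pt v + scale (t * ?c) (d (aut_perm i))" if "v \<in> H" "i < q" for v i t
    using aut_pt_add[OF that] aut_coeff_same[OF that(2)] aut_coeff_linear[of t] by simp
  have c: "?c \<noteq> 0"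
  proof
    assume "?c = 0"
    then have "f (apoint (0 + scale 1 (d 0))) = f (apoint 0)"
      using shift[OF H0 q0, of 1] aut_pt(2)[OF H_add_d[OF H0 q0, of 1]] aut_pt(2)[OF H0] by simp
    then show False using pt_eq_iff[OF H_add_d[OF H0 q0, of 1] H0] d_nonzero[OF q0] by (simp add: aut_inj)
  qed
  have "\<exists>\<phi>. semilinear_on UNIV id \<phi> \<and> \<phi> e = scale 1 e + aut_pt 0 \<and> (\<forall>i<q. \<phi> (d i) = scale ?c (d (aut_perm i)))"
    by (rule exists_frame_map[OF field_automorphism_id aut_perm_permutes]) simp
  then obtain \<phi> where p: "semilinear_on UNIV id \<phi>" "\<phi> e = scale 1 e + aut_pt 0" "\<forall>i<q. \<phi> (d i) = scale ?c (d (aut_perm i))"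
    by (elim exE conjE)
  have fm: "frame_map id aut_perm (\<lambda>_. ?c) \<phi>" using p(1,3) c aut_perm_permutes by (simp add: frame_map_def)
  have aut_eq: "aut_pt v = aut_pt 0 + \<phi> v" if "v \<in> H" for v
    using that span_d order_refl
  proof (induction rule: H_induct)
    case zero
    show ?case by (simp add: semilinear_on_zero[OF p(1)])
  next
    case (step v j t)
    then show ?case
      using shift[of v j t] p(3) semilinear_onD(2,3)[OF p(1)] by simp
  qed
  note act = fm p(2) one_neq_zero aut_pt(1)[OF H0]
  have aff: "aff \<phi> 1 (aut_pt 0) v = aut_pt v" if "v \<in> H" for v
    using aut_eq[OF that] by (simp add: aff_def[OF act])
  have "Gamma_action scale H K (induced UNIV \<phi>) x = f x" for x
  proof (cases "x \<in> fst \<Gamma>")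
    case True
    then show ?thesis
    proof (cases rule: vertex_cases)
      case (1 v)
      then show ?thesis
        using Gamma_action_induced[OF pt_vertex[OF 1(1)], of \<phi>] image_apoint[OF act 1(1)] aff[OF 1(1)] aut_pt(2)[OF 1(1)]
        by simp
    next
      case (2 v i)
      then show ?thesis
        using Gamma_action_induced[OF ln_vertex[OF 2(1,2)], of \<phi>] image_aline[OF act 2(1,2)] aff[OF 2(1)]
          aut_line_eq[OF 2(1,2)] by simp
    qed
  next
    case False
    then show ?thesis
      using permutes_not_in[OF graph_automorphismD(1)[OF f]] by (simp add: Gamma_action_outside)
  qed
  then have "Gamma_action scale H K (induced UNIV \<phi>) = f" by (rule ext)
  then show ?thesis using frame_map_stab(2)[OF act] by (rule bexI)
qed

end

end

lemma graph_Aut_iso: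
  assumes "q = n + 2" "prime q"
  shows "graph_Aut \<Gamma> \<cong> stab_UNIV"
proof -
  have "Gamma_action scale H K ` carrier stab_UNIV = carrier (graph_Aut \<Gamma>)"
  proof
    show "Gamma_action scale H K ` carrier stab_UNIV \<subseteq> carrier (graph_Aut \<Gamma>)"
      using Gamma_action_hom by (auto simp: hom_def)
    show "carrier (graph_Aut \<Gamma>) \<subseteq> Gamma_action scale H K ` carrier stab_UNIV"
    proof
      fix f assume "f \<in> carrier (graph_Aut \<Gamma>)"
      then have "graph_automorphism \<Gamma> f" by (simp add: graph_Aut_def map_group_def)
      from aut_is_collineation[OF this assms]
      show "f \<in> Gamma_action scale H K ` carrier stab_UNIV" by auto
    qed
  qed
  then have "Gamma_action scale H K \<in> iso stab_UNIV (graph_Aut \<Gamma>)"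
    using Gamma_action_hom Gamma_action_inj by (simp add: iso_def bij_betw_def)
  then have "stab_UNIV \<cong> graph_Aut \<Gamma>" by (rule is_isoI)
  then show ?thesis by (rule group.iso_sym[OF group_PGammaL_stab[OF subspace_UNIV]])
qed

end

section \<open>Every such arc admits a frame\<close>

context projective_geometry
begin

text \<open>If the representatives were dependent, a maximal independent subset would have fewer
  than \<open>m\<close> elements. Extending it to a basis of H and dropping a new basis vector would
  leave a hyperplane containing \<open>m\<close> points of the arc.\<close>

lemma arc_independent:
  assumes arc: "arc scale q H K" and H: "subspace H" "dim H = m" and m: "0 < m"
    and d: "\<And>i. i \<in> I \<Longrightarrow> span {d i} \<in> K" and inj: "inj_on (\<lambda>i. span {d i}) I" and I: "finite I" "card I = m"
  shows "independent (d ` I)" "inj_on d I"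
proof -
  obtain B where "B \<subseteq> H" "independent B" "H \<subseteq> span B" "card B = dim H" using basis_exists by blast
  then have B: "B \<subseteq> H" "independent B" "H \<subseteq> span B" "card B = m" "finite B"
    using H(2) m by (simp_all add: card_ge_0_finite)
  show inj_d: "inj_on d I"
  proof (rule inj_onI)
    fix i j assume "i \<in> I" "j \<in> I" "d i = d j"
    then show "i = j" using inj_onD[OF inj, of i j] by simp
  qed
  have dH: "d i \<in> H" if "i \<in> I" for i
  proof -
    have "span {d i} \<subseteq> H" using d[OF that] arc by (auto simp: arc_def pg_points_def)
    then show ?thesis using span_base[of "d i" "{d i}"] by auto
  qed
  show "independent (d ` I)"
  proof (rule ccontr)
    assume dep: "\<not> independent (d ` I)"
    obtain C where C: "C \<subseteq> d ` I" "independent C" "d ` I \<subseteq> span C"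
      by (rule maximal_independent_subset)
    have CH: "C \<subseteq> H" using C(1) dH by auto
    have "C \<noteq> d ` I" using C(2) dep by auto
    then have "card C < card (d ` I)" using C(1) I(1) by (intro psubset_card_mono) auto
    then have cardC: "card C < m" by (simp add: card_image[OF inj_d] I(2))
    obtain D where D: "C \<subseteq> D" "D \<subseteq> H" "independent D" "H \<subseteq> span D"
      by (rule maximal_independent_subset_extend[OF CH C(2)])
    have cardD: "card D = m" using basis_card_eq_dim[OF D(2,4,3)] H(2) by simp
    have "C \<noteq> D" using cardC cardD by auto
    then obtain b where b: "b \<in> D" "b \<notin> C" using D(1) by auto
    have finD: "finite D" using cardD m by (simp add: card_ge_0_finite)
    let ?W = "span (D - {b})"
    have "dim ?W + 1 = dim H"
    proof -
      have "independent (D - {b})" by (rule independent_mono[OF D(3)]) auto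
      then have "dim ?W = card (D - {b})" by (rule dim_span_eq_card_independent)
      then show ?thesis using b(1) finD cardD H(2) m by simp
    qed
    moreover have "?W \<subseteq> H" using D(2) by (intro span_minimal H(1)) auto
    ultimately have hyp: "pg_hyperplane scale H ?W" by (simp add: pg_hyperplane_def)
    have "span C \<subseteq> ?W" using D(1) b(2) by (intro span_mono) auto
    then have "span {d i} \<subseteq> ?W" if "i \<in> I" for i
      using C(3) that by (intro span_minimal) auto
    then have "\<forall>x\<in>(\<lambda>i. span {d i}) ` I. x \<subseteq> ?W" by auto
    moreover have "(\<lambda>i. span {d i}) ` I \<subseteq> K" using d by auto
    moreover have "card ((\<lambda>i. span {d i}) ` I) = dim H" by (simp add: card_image[OF inj] I(2) H(2))
    ultimately show False using arc hyp unfolding arc_def by blast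
  qed
qed

end

lemma exists_arc_frame:
  fixes scale :: "'f::finite_field \<Rightarrow> 'v::ab_group_add \<Rightarrow> 'v"
  assumes card: "card (UNIV :: 'f set) = q"
    and vs: "vector_space scale" and dim: "vector_space.dim scale UNIV = n + 2"
    and hyp: "pg_hyperplane scale UNIV H"
    and arc: "arc scale q H K"
    and n: "n \<ge> 2" and q: "q = n + 1 \<or> q = n + 2" and nq: "(n, q) \<noteq> (2, 4)"
  shows "\<exists>e d. arc_frame scale n q e d H K"
proof -
  interpret vector_space scale by (rule vs)
  interpret projective_geometry scale by unfold_locales
  have H: "subspace H" "dim H = n + 1" using hyp dim by (simp_all add: pg_hyperplane_def)
  have K: "K \<subseteq> pg_points scale H" "finite K" "card K = q" using arc by (simp_all add: arc_def)
  have n_lt_q: "n < q" using q by auto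
  obtain x where x: "bij_betw x {0..<q} K" using ex_bij_betw_nat_finite[OF K(2)] K(3) by auto
  have "\<exists>v. v \<in> H \<and> v \<noteq> 0 \<and> x i = span {v}" if "i < q" for i
  proof -
    have "x i \<in> pg_points scale H" using x K(1) that by (auto simp: bij_betw_def)
    then show ?thesis unfolding pg_points_iff[OF H(1)] by auto
  qed
  then obtain b where b: "\<And>i. i < q \<Longrightarrow> b i \<in> H \<and> b i \<noteq> 0 \<and> x i = span {b i}" by metis
  \<comment> \<open>All choices of representatives are treated together, so that independence and
    spanning apply to the initial choice as well as to the rescaled one.\<close>
  define rep where "rep d \<longleftrightarrow> (\<forall>i<q. d i \<in> H \<and> span {d i} = x i)" for d
  have indep: "independent (d ` I) \<and> inj_on d I" if d: "rep d" and I: "I \<subseteq> {..<q}" "card I = n + 1" for d I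
  proof -
    have di: "span {d i} = x i" "x i \<in> K" if "i \<in> I" for i
      using d I(1) that x by (auto simp: rep_def bij_betw_def)
    have "inj_on x I" by (rule inj_on_subset[OF bij_betw_imp_inj_on[OF x]]) (use I(1) in auto)
    then have "inj_on (\<lambda>i. span {d i}) I" using di(1) by (simp add: inj_on_def)
    moreover have "finite I" using I(2) by (simp add: card_ge_0_finite)
    ultimately show ?thesis using arc_independent[OF arc H _ _ _ _ I(2), of d] di by simp
  qed
  have span_H: "span (d ` {..n}) = H" if d: "rep d" for d
  proof -
    have I: "{..n} \<subseteq> {..<q}" "card {..n} = n + 1" using n_lt_q by auto
    note ind = indep[OF d I]
    have sub: "d ` {..n} \<subseteq> H" using d n_lt_q by (auto simp: rep_def)
    obtain B where B: "d ` {..n} \<subseteq> B" "B \<subseteq> H" "independent B" "H \<subseteq> span B"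
      by (rule maximal_independent_subset_extend[OF sub conjunct1[OF ind]])
    have cardB: "card B = n + 1" using basis_card_eq_dim[OF B(2,4,3)] H(2) by simp
    then have "finite B" by (simp add: card_ge_0_finite)
    moreover have "card (d ` {..n}) = n + 1" using card_image[OF conjunct2[OF ind]] I(2) by simp
    ultimately have "d ` {..n} = B" using B(1) cardB by (intro card_subset_eq) simp_all
    then have "H \<subseteq> span (d ` {..n})" using B(4) by simp
    with span_minimal[OF sub H(1)] show ?thesis by (rule equalityI)
  qed
  have rep_b: "rep b" using b by (simp add: rep_def)
  have "\<exists>d. rep d \<and> (q = n + 2 \<longrightarrow> (\<Sum>i<q. d i) = 0)"
  proof (cases "q = n + 2")
    case False
    with rep_b show ?thesis by auto
  next
    case qn: True
    have "{..n} \<subseteq> {..<q}" using n_lt_q by auto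
    then have inj: "inj_on b {..n}" using indep[OF rep_b, of "{..n}"] by simp
    have "b (n + 1) \<in> span (b ` {..n})" using span_H[OF rep_b] b[of "n + 1"] qn by simp
    then obtain u where "b (n + 1) = (\<Sum>v\<in>b ` {..n}. scale (u v) v)" by (auto simp: span_finite)
    then have bu: "b (n + 1) = (\<Sum>i\<le>n. scale (u (b i)) (b i))" by (simp add: sum.reindex[OF inj])
    have nz: "u (b j) \<noteq> 0" if j: "j \<le> n" for j
    proof
      assume 0: "u (b j) = 0"
      \<comment> \<open>Exchanging j for the last index gives another n + 1 points of the arc; a
        vanishing coefficient would make their representatives dependent.\<close>
      let ?I = "insert (n + 1) ({..n} - {j})"
      have I: "?I \<subseteq> {..<q}" "card ?I = n + 1" using j qn by (auto simp: card_insert_if)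
      note indI = indep[OF rep_b I]
      have "b (n + 1) = (\<Sum>i\<in>{..n} - {j}. scale (u (b i)) (b i))"
        unfolding bu using j 0 by (simp add: sum.remove[of "{..n}" j])
      then have "b (n + 1) \<in> span (b ` ({..n} - {j}))"
        by (auto intro!: span_sum span_scale intro: span_base)
      moreover have "b k \<noteq> b (n + 1)" if "k \<in> {..n} - {j}" for k
        using inj_onD[OF conjunct2[OF indI], of k "n + 1"] that by auto
      then have "b ` ?I - {b (n + 1)} = b ` ({..n} - {j})" by auto
      ultimately have "dependent (b ` ?I)" unfolding dependent_def by (intro bexI[of _ "b (n + 1)"]) simp_all
      with indI show False by simp
    qed
    \<comment> \<open>The coefficients of the last representative are absorbed, negated, into the
      others, so that the sum becomes 0.\<close>
    define d where "d i = (if i \<le> n then scale (- u (b i)) (b i) else b i)" for i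
    have "rep d"
      unfolding rep_def
    proof (intro allI impI)
      fix i assume i: "i < q"
      show "d i \<in> H \<and> span {d i} = x i"
      proof (cases "i \<le> n")
        case True
        then have "span {d i} = span {b i}"
          using span_image_scale[of "{b i}" "\<lambda>_. - u (b i)"] nz[OF True] by (simp add: d_def)
        moreover have "d i \<in> H" using subspace_scale[OF H(1), of "b i" "- u (b i)"] b[OF i] True by (simp add: d_def)
        ultimately show ?thesis using b[OF i] by simp
      next
        case False
        then show ?thesis using b[OF i] by (simp add: d_def)
      qed
    qed
    moreover have "(\<Sum>i<q. d i) = 0"
    proof -
      have "(\<Sum>i<q. d i) = (\<Sum>i\<le>n. d i) + d (n + 1)" by (simp add: qn lessThan_Suc_atMost)
      also have "(\<Sum>i\<le>n. d i) = - (\<Sum>i\<le>n. scale (u (b i)) (b i))"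
        unfolding sum_negf[symmetric] by (rule sum.cong) (simp_all add: d_def)
      also have "d (n + 1) = b (n + 1)" by (simp add: d_def)
      finally show ?thesis using bu by simp
    qed
    ultimately show ?thesis by auto
  qed
  then obtain d where d: "rep d" and sum: "q = n + 2 \<longrightarrow> (\<Sum>i<q. d i) = 0" by (elim exE conjE)
  have I: "{..n} \<subseteq> {..<q}" "card {..n} = n + 1" using n_lt_q by auto
  note ind = indep[OF d I]
  have "H \<noteq> UNIV" using H(2) dim by auto
  then obtain e where e: "e \<notin> H" by auto
  have frame: "independent (insert e (d ` {..n}))" using e ind span_H[OF d] by (simp add: independent_insertI)
  obtain B where B: "insert e (d ` {..n}) \<subseteq> B" "independent B" "UNIV \<subseteq> span B"
    using maximal_independent_subset_extend[OF subset_UNIV frame] by metis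
  have cardB: "card B = n + 2" using basis_card_eq_dim[OF subset_UNIV B(3,2)] dim by simp
  then have "finite B" by (simp add: card_ge_0_finite)
  moreover have "e \<notin> d ` {..n}"
  proof
    assume "e \<in> d ` {..n}"
    then have "e \<in> span (d ` {..n})" by (rule span_base)
    with e span_H[OF d] show False by simp
  qed
  then have "card (insert e (d ` {..n})) = n + 2" using card_image[OF conjunct2[OF ind]] by simp
  ultimately have "insert e (d ` {..n}) = B" using B(1) cardB by (intro card_subset_eq) simp_all
  then have span: "span (insert e (d ` {..n})) = UNIV" using B(3) by auto
  have K_eq: "K = (\<lambda>i. span {d i}) ` {..<q}"
  proof -
    have "(\<lambda>i. span {d i}) ` {..<q} = x ` {..<q}" by (rule image_cong) (use d in \<open>auto simp: rep_def\<close>)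
    then show ?thesis using x by (simp add: bij_betw_def atLeast0LessThan)
  qed
  have "arc_frame scale n q e d H K"
  proof
    show "q = n + 1 \<or> q = n + 2 \<and> 3 \<le> n" using q n nq by auto
  qed (use card n ind span_H[OF d] e span sum K_eq in auto)
  then show ?thesis by auto
qed

lemma (in arc_frame) arc_frame_summary:
  assumes "prime p" and "q = p ^ h"
  shows "semisymmetric \<Gamma>
    \<and> Gamma_action scale H K
        \<in> mon stab_UNIV (graph_Aut \<Gamma>)
    \<and> iso_semidirect stab_UNIV
        (Persp scale H) stab_H
    \<and> (q = n + 2 \<longrightarrow>
        iso_semidirect stab_H
          (sym_group q) (field_Aut :: ('f \<Rightarrow> 'f) monoid) \<and>
        order stab_UNIV = h * q ^ (n + 1) * (q - 1) * fact q)
    \<and> (q = n + 1 \<longrightarrow>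
        iso_semidirect stab_H
          (PMon q :: 'f mat set monoid) (field_Aut :: ('f \<Rightarrow> 'f) monoid) \<and>
        order stab_UNIV = h * q ^ (n + 1) * (q - 1) ^ (n + 1) * fact q)
    \<and> (q = n + 2 \<and> prime q \<longrightarrow>
        graph_Aut \<Gamma> \<cong> stab_UNIV)"
proof -
  have order_Aut: "order (field_Aut :: ('f \<Rightarrow> 'f) monoid) = h"
    using order_field_Aut[OF assms(1)] card_field assms(2) by simp
  have order: "order stab_UNIV = q ^ (n + 1) * (q - 1) * order stab_H"
    using order_iso_semidirect[OF stab_UNIV_semidirect] by (simp add: order_Persp)
  have 1: "iso_semidirect stab_H (sym_group q) (field_Aut :: ('f \<Rightarrow> 'f) monoid) \<and>
      order stab_UNIV = h * q ^ (n + 1) * (q - 1) * fact q" if "q = n + 2"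
  proof -
    note iso = stab_H_sym_group[OF that]
    have "order (sym_group q) = fact q"
      by (simp add: Coset.order_def sym_group_def card_permutations)
    with iso order order_iso_semidirect[OF iso] order_Aut show ?thesis by simp
  qed
  \<comment> \<open>One factor \<open>q - 1\<close> comes from \<open>Persp\<close> and n factors
    from \<open>PMon\<close>, so the exponent is n + 1. An exponent n would contradict the
    semidirect decompositions.\<close>
  have 2: "iso_semidirect stab_H (PMon q :: 'f mat set monoid) (field_Aut :: ('f \<Rightarrow> 'f) monoid) \<and>
      order stab_UNIV = h * q ^ (n + 1) * (q - 1) ^ (n + 1) * fact q" if "q = n + 1"
  proof -
    note iso = stab_H_PMon[OF that]
    from iso order order_iso_semidirect[OF iso(1)] order_Aut show ?thesis by simp
  qed
  have 3: "q = n + 2 \<and> prime q \<longrightarrow> graph_Aut \<Gamma> \<cong> stab_UNIV"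
    by (rule impI, elim conjE, rule graph_Aut_iso)
  show ?thesis
    by (intro conjI semisymmetric Gamma_action_mon stab_UNIV_semidirect impI[OF 1] impI[OF 2] 3)
qed

theorem theorem3p6:
  fixes scale :: "'f::finite_field \<Rightarrow> 'v::ab_group_add \<Rightarrow> 'v"
    and p h q n :: nat
    and H :: "'v set"
    and K :: "'v set set"
  assumes "prime p" and "q = p ^ h" and "card (UNIV :: 'f set) = q"
    and "vector_space scale" and "vector_space.dim scale UNIV = n + 2"
    and "pg_hyperplane scale UNIV H"
    and "arc scale q H K"
    and "n \<ge> 2"
    and "q = n + 1 \<or> q = n + 2"
    and "(n, q) \<noteq> (2, 4)"
  shows "semisymmetric (Gamma scale H K)
    \<and> Gamma_action scale H K
        \<in> mon (PGammaL_stab scale UNIV K) (graph_Aut (Gamma scale H K))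
    \<and> iso_semidirect (PGammaL_stab scale UNIV K)
        (Persp scale H) (PGammaL_stab scale H K)
    \<and> (q = n + 2 \<longrightarrow>
        iso_semidirect (PGammaL_stab scale H K)
          (sym_group q) (field_Aut :: ('f \<Rightarrow> 'f) monoid) \<and>
        order (PGammaL_stab scale UNIV K) = h * q ^ (n + 1) * (q - 1) * fact q)
    \<and> (q = n + 1 \<longrightarrow>
        iso_semidirect (PGammaL_stab scale H K)
          (PMon q :: 'f mat set monoid) (field_Aut :: ('f \<Rightarrow> 'f) monoid) \<and>
        order (PGammaL_stab scale UNIV K) = h * q ^ (n + 1) * (q - 1) ^ (n + 1) * fact q)
    \<and> (q = n + 2 \<and> prime q \<longrightarrow>
        graph_Aut (Gamma scale H K) \<cong> PGammaL_stab scale UNIV K)"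
proof -
  obtain e d where "arc_frame scale n q e d H K" using exists_arc_frame[OF assms(3-10)] by (elim exE)
  from arc_frame.arc_frame_summary[OF this assms(1,2)] show ?thesis .
qed

end
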